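(* Let $\overline{p}(n)$ denote the number of overpartitions of $n$. For every positive integer $r$, the sequence $\{\overline{p}(n)\}_{n\geq 1}$ is asymptotically $r$-log-concave, i.e. there exists $N$ such that the sequences $\hat{\mathscr{L}}\{\overline{p}(n)\}_{n\geq N},\ \hat{\mathscr{L}}^2\{\overline{p}(n)\}_{n\geq N},\ \ldots,\ \hat{\mathscr{L}}^r\{\overline{p}(n)\}_{n\geq N}$ all consist of non-negative terms.
   Context: An overpartition of a nonnegative integer $n$ is a partition of $n$ (a non-increasing sequence of positive integers summing to $n$) in which the first occurrence of each distinct part may be overlined; $\overline{p}(n)$ is the number of overpartitions of $n$ (with $\overline{p}(0)=1$). For a sequence $\{a_n\}_{n\geq 0}$, define $\hat{\mathscr{L}}\{a_n\}_{n\geq 0}=\{a_{n+1}^2-a_na_{n+2}\}_{n\geq 0}$ and $\hat{\mathscr{L}}^k\{a_n\}=\hat{\mathscr{L}}(\hat{\mathscr{L}}^{k-1}\{a_n\})$ (applied to a sequence indexed from $N$, the operator is applied after reindexing from $0$). *)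

theory Defs
  imports "HOL-Analysis.Analysis"
begin

text \<open>
  An overpartition is encoded as the list of its parts in non-increasing order; the Boolean
  attached to a part says whether that part is overlined.
\<close>

definition overpartitions :: "nat \<Rightarrow> (nat \<times> bool) list set" where
  "overpartitions n =
     {xs. sorted_wrt (\<ge>) (map fst xs) \<and>
          (\<forall>x \<in> set xs. fst x > 0) \<and>
          sum_list (map fst xs) = n \<and>
          (\<forall>i < length xs. snd (xs ! i) \<longrightarrow> (\<forall>j < i. fst (xs ! j) \<noteq> fst (xs ! i)))}"

definition overp :: "nat \<Rightarrow> nat" where
  "overp n = card (overpartitions n)"

definition logc_op :: "(nat \<Rightarrow> real) \<Rightarrow> nat \<Rightarrow> real" where
  "logc_op a = (\<lambda>n. (a (n + 1))\<^sup>2 - a n * a (n + 2))"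

lemma finite_overpartitions: "finite (overpartitions n)"
proof (rule finite_subset)
  show "overpartitions n \<subseteq> {xs. set xs \<subseteq> {..n} \<times> UNIV \<and> length xs \<le> n}"
  proof
    fix xs assume xs: "xs \<in> overpartitions n"
    have len: "length ys \<le> sum_list (map fst ys)"
      if "\<forall>x \<in> set ys. fst x > 0" for ys :: "(nat \<times> bool) list"
      using that by (induction ys) auto
    have "fst x \<le> n" if "x \<in> set xs" for x
      using xs that member_le_sum_list[of "fst x" "map fst xs"]
      by (auto simp: overpartitions_def)
    then show "xs \<in> {xs. set xs \<subseteq> {..n} \<times> UNIV \<and> length xs \<le> n}"
      using xs len[of xs] by (auto simp: overpartitions_def)
  qed
  show "finite {xs. set xs \<subseteq> {..n} \<times> (UNIV :: bool set) \<and> length xs \<le> n}"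
    by (rule finite_lists_length_le) simp
qed

lemma overp_0: "overp 0 = 1"
proof -
  have "overpartitions 0 = {[]}"
  proof
    show "overpartitions 0 \<subseteq> {[]}"
    proof
      fix xs assume "xs \<in> overpartitions 0"
      then show "xs \<in> {[]}"
        by (cases xs) (auto simp: overpartitions_def)
    qed
  qed (simp add: overpartitions_def)
  then show ?thesis by (simp add: overp_def)
qed

end

theory Submission
  imports Defs "HOL-Complex_Analysis.Complex_Analysis"
begin

text \<open>
  By Gauss, the generating function \<open>P(q)\<close> of overpartitions is \<open>1 / \<Sum> (-1)\<^sup>n q\<^bsup>n\<^sup>2\<^esup>\<close>, so theta inversion
  makes \<open>P(e\<^bsup>-t\<^esup>)\<close> a constant multiple of \<open>\<surd>t exp(\<pi>\<^sup>2/4t)\<close> up to a bounded error in a sector around the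
  positive axis. With \<open>m(x) = d/dx (sinh(\<pi>\<surd>x) / (\<pi>\<surd>x))\<close>, which is entire, the series \<open>\<Sum> m(n) q\<^sup>n\<close> has
  the same behaviour at \<open>q = 1\<close> and no other singularity, while \<open>P\<close> is exponentially smaller away
  from \<open>q = 1\<close>. Cauchy's inequality for the difference gives \<open>p(n) = \<kappa> m(n) (1 + O(e\<^bsup>-\<delta>\<surd>n\<^esup>))\<close> for some
  \<open>\<kappa> > 0\<close>. The values of \<open>\<kappa>\<close> and of the constant in the inversion formula are irrelevant here, so they
  are never computed.

  Consequently \<open>1 - p(n) p(n+2) / p(n+1)\<^sup>2 = n\<^bsup>-3/2\<^esup> w(n\<^bsup>-1/2\<^esup>)\<close> up to errors smaller than every power of
  \<open>n\<close>, with \<open>w\<close> analytic at \<open>0\<close> and \<open>w(0) = \<pi>/4 > 0\<close>. A positive sequence of this kind is mapped by the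
  log-concavity operator to a sequence of the same kind, with \<open>w(0)\<close> doubled; now iterate.
\<close>

section \<open>Generating function of overpartitions\<close>

text \<open>Each application of the log-concavity operator costs a factor \<open>z ^ 3\<close> of
  precision, where z = n^(-1/2), so an error of fixed power order would be used up after finitely
  many iterations. The comparison sequence must therefore be exact to all orders, which a truncated
  saddle-point expansion is not. The sequence m arises by matching term by term: the sum of n^j
  exp(-nt) is j!/t^(j+1) + O(1) near t = 0, so dividing the coefficients of Kummer's function by j!
  gives a series whose generating function equals that function of pi^2/(4t), up to O(1).

  Theta inversion comes from Polya's finite identity for row 2m of Pascal's triangle, with h nodes.
  Along h = aX, m = (bX)^2 both sides converge to theta series as X grows, which gives the inversion
  at squares of rationals; the identity theorem does the rest.

  The leading coefficient stays positive because n -> n + 1 acts on z as z -> z / sqrt(1 + z^2) = z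
  - z^3/2 + ... . Hence f(n) f(n+2) / f(n+1)^2 is 1 + o(z^3) for every f analytic and nonzero at z =
  0, and the curvature of order z^3 stems from exp(pi sqrt n) alone.\<close>

definition op_le :: "nat \<Rightarrow> nat \<Rightarrow> (nat \<times> bool) list set" where
  "op_le m n = {xs \<in> overpartitions n. \<forall>x\<in>set xs. fst x \<le> m}"

definition op_plain :: "nat \<Rightarrow> nat \<Rightarrow> (nat \<times> bool) list set" where
  "op_plain m n = {xs \<in> op_le m n. (m, True) \<notin> set xs}"

lemma finite_op_le [simp]: "finite (op_le m n)"
  by (rule finite_subset[OF _ finite_overpartitions[of n]]) (auto simp: op_le_def)

lemma finite_op_plain [simp]: "finite (op_plain m n)"
  by (rule finite_subset[OF _ finite_op_le[of m n]]) (auto simp: op_plain_def)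

lemma Nil_in_overpartitions: "[] \<in> overpartitions n \<longleftrightarrow> n = 0"
  by (auto simp: overpartitions_def)

text \<open>The head is the first occurrence of its part, so the mark b is free. Any further k in
  the tail is a later occurrence and must be unmarked, which is exactly membership in
  \<open>op_plain k\<close>.\<close>

lemma Cons_in_overpartitions:
  "(k, b) # ys \<in> overpartitions n \<longleftrightarrow> k > 0 \<and> k \<le> n \<and> ys \<in> op_plain k (n - k)"
proof -
  let ?C = "\<lambda>xs. \<forall>i < length xs. snd (xs ! i) \<longrightarrow> (\<forall>j < i. fst (xs ! j) \<noteq> fst (xs ! i))"
  have "?C ((k, b) # ys) \<longleftrightarrow> ?C ys \<and> (\<forall>i<length ys. snd (ys ! i) \<longrightarrow> fst (ys ! i) \<noteq> k)"
    by (auto simp: All_less_Suc2 nth_Cons split: nat.splits)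
  also have "(\<forall>i<length ys. snd (ys ! i) \<longrightarrow> fst (ys ! i) \<noteq> k) \<longleftrightarrow> (k, True) \<notin> set ys"
    by (auto simp: in_set_conv_nth prod_eq_iff)
  finally show ?thesis
    by (auto simp: overpartitions_def op_plain_def op_le_def)
qed

lemma op_le_0: "op_le 0 n = (if n = 0 then {[]} else {})"
proof -
  have "xs \<in> op_le 0 n \<longleftrightarrow> xs = [] \<and> n = 0" for xs
    by (cases xs) (auto simp: op_le_def Nil_in_overpartitions Cons_in_overpartitions)
  then show ?thesis by auto
qed

text \<open>Lists are sorted by whether they begin with the part m + 1. The guard is essential
  because subtraction on naturals truncates at 0.\<close>

lemma op_plain_Suc:
  "op_plain (Suc m) n = op_le m n \<union>
     (if Suc m \<le> n then (#) (Suc m, False) ` op_plain (Suc m) (n - Suc m) else {})"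
proof -
  have "xs \<in> op_plain (Suc m) n \<longleftrightarrow> xs \<in> op_le m n \<union>
     (if Suc m \<le> n then (#) (Suc m, False) ` op_plain (Suc m) (n - Suc m) else {})" for xs
  proof (cases xs)
    case Nil
    then show ?thesis by (auto simp: op_plain_def op_le_def)
  next
    case (Cons a ys)
    then show ?thesis
      by (cases a) (auto simp: op_plain_def op_le_def Cons_in_overpartitions le_Suc_eq image_iff
          split: if_splits)
  qed
  then show ?thesis by blast
qed

lemma op_le_Suc:
  "op_le (Suc m) n = op_plain (Suc m) n \<union>
     (if Suc m \<le> n then (#) (Suc m, True) ` op_plain (Suc m) (n - Suc m) else {})"
proof -
  have "xs \<in> op_le (Suc m) n \<longleftrightarrow> xs \<in> op_plain (Suc m) n \<union>
     (if Suc m \<le> n then (#) (Suc m, True) ` op_plain (Suc m) (n - Suc m) else {})" for xs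
  proof (cases xs)
    case Nil
    then show ?thesis by (auto simp: op_plain_def op_le_def)
  next
    case (Cons a ys)
    then show ?thesis
      by (cases a) (auto simp: op_plain_def op_le_def Cons_in_overpartitions le_Suc_eq image_iff
          split: if_splits)
  qed
  then show ?thesis by blast
qed

text \<open>On generating functions this recursion is division by 1 - q^(m+1); the companion
  \<open>card_op_le_Suc\<close> is multiplication by 1 + q^(m+1). Together they produce one factor
  of \<open>over_prod\<close>.\<close>

lemma card_op_plain_Suc:
  "card (op_plain (Suc m) n) =
     card (op_le m n) + (if Suc m \<le> n then card (op_plain (Suc m) (n - Suc m)) else 0)"
proof -
  have "op_le m n \<inter> (#) (Suc m, False) ` A = {}" for A
    by (auto simp: op_le_def)
  then show ?thesis
    by (subst op_plain_Suc, subst card_Un_disjoint) (auto simp: card_image)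
qed

lemma card_op_le_Suc:
  "card (op_le (Suc m) n) =
     card (op_plain (Suc m) n) + (if Suc m \<le> n then card (op_plain (Suc m) (n - Suc m)) else 0)"
proof -
  have "op_plain (Suc m) n \<inter> (#) (Suc m, True) ` A = {}" for A
    by (auto simp: op_plain_def)
  then show ?thesis
    by (subst op_le_Suc, subst card_Un_disjoint) (auto simp: card_image)
qed

lemma op_le_eq_overpartitions: "n \<le> m \<Longrightarrow> op_le m n = overpartitions n"
proof -
  assume "n \<le> m"
  have "fst x \<le> m" if "xs \<in> overpartitions n" "x \<in> set xs" for x xs
    using that \<open>n \<le> m\<close> member_le_sum_list[of "fst x" "map fst xs"]
    by (fastforce simp: overpartitions_def)
  then show ?thesis by (auto simp: op_le_def)
qed

lemma card_op_le_le_overp: "card (op_le m n) \<le> overp n"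
  unfolding overp_def by (intro card_mono finite_overpartitions) (auto simp: op_le_def)

section \<open>The finite products and their limit\<close>

definition over_prod :: "nat \<Rightarrow> 'a :: field \<Rightarrow> 'a" where
  "over_prod m q = (\<Prod>k=1..m. (1 + q ^ k) / (1 - q ^ k))"

lemma over_prod_0 [simp]: "over_prod 0 q = 1"
  by (simp add: over_prod_def)

lemma over_prod_Suc: "over_prod (Suc m) q = over_prod m q * ((1 + q ^ Suc m) / (1 - q ^ Suc m))"
  by (simp add: over_prod_def)

lemma norm_power_less_one: "norm q < 1 \<Longrightarrow> norm (q ^ Suc n) < (1::real)"
  for q :: "'a :: real_normed_div_algebra"
  unfolding norm_power by (rule power_less_one_iff[THEN iffD2]) auto

lemma sums_shift_zero:
  fixes f :: "nat \<Rightarrow> 'a :: real_normed_vector"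
  assumes "f sums s"
  shows "(\<lambda>n. if k \<le> n then f (n - k) else 0) sums s"
proof -
  have "(\<lambda>n. if k \<le> n + k then f (n + k - k) else 0) sums s"
    using assms by simp
  then have "(\<lambda>n. if k \<le> n then f (n - k) else 0) sums (s + (\<Sum>i<k. if k \<le> i then f (i - k) else 0))"
    by (subst (asm) sums_iff_shift) simp
  then show ?thesis by simp
qed

text \<open>The recursion bounds a partial sum S by C + r^(m+1) S, which can be solved for S.
  Arguing with partial sums avoids presupposing the convergence that is to be shown.\<close>

lemma op_plain_summable:
  fixes r :: real
  assumes r: "0 \<le> r" "r < 1" and s: "summable (\<lambda>n. card (op_le m n) * r ^ n)"
  shows "summable (\<lambda>n. card (op_plain (Suc m) n) * r ^ n)"
proof (rule summableI_nonneg_bounded)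
  fix N
  let ?d = "\<lambda>n. card (op_plain (Suc m) n) * r ^ n"
  let ?c = "\<lambda>n. card (op_le m n) * r ^ n"
  have "(\<Sum>n<N. ?d n) = (\<Sum>n<N. ?c n + (if Suc m \<le> n then r ^ Suc m * ?d (n - Suc m) else 0))"
  proof (rule sum.cong)
    fix n
    show "?d n = ?c n + (if Suc m \<le> n then r ^ Suc m * ?d (n - Suc m) else 0)"
      by (subst card_op_plain_Suc) (auto simp: algebra_simps simp flip: power_add power_Suc)
  qed simp
  also have "\<dots> = (\<Sum>n<N. ?c n) + r ^ Suc m * (\<Sum>n<N. if Suc m \<le> n then ?d (n - Suc m) else 0)"
    unfolding sum.distrib sum_distrib_left by (intro arg_cong2[of _ _ _ _ "(+)"] sum.cong) auto
  also have "(\<Sum>n<N. if Suc m \<le> n then ?d (n - Suc m) else 0) =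
             (\<Sum>n\<in>{Suc m..<N}. ?d (n - Suc m))"
    by (rule sum.mono_neutral_cong_right) auto
  also have "\<dots> = (\<Sum>n<N - Suc m. ?d n)"
    by (rule sum.reindex_bij_witness[of _ "\<lambda>n. n + Suc m" "\<lambda>n. n - Suc m"]) auto
  also have "\<dots> \<le> (\<Sum>n<N. ?d n)"
    using r by (intro sum_mono2) auto
  finally have 1: "(\<Sum>n<N. ?d n) \<le> (\<Sum>n<N. ?c n) + r ^ Suc m * (\<Sum>n<N. ?d n)"
    using r by (simp add: mult_left_mono)
  have 2: "(\<Sum>n<N. ?c n) \<le> suminf ?c"
    using r s by (intro sum_le_suminf) auto
  have "r ^ Suc m < 1" using r norm_power_less_one[of r m] by simp
  with 1 2 show "(\<Sum>n<N. ?d n) \<le> suminf ?c / (1 - r ^ Suc m)"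
    by (simp add: field_simps del: power_Suc)
qed (use r in auto)

lemma op_le_sums:
  fixes q :: "'a :: {real_normed_field, banach}"
  assumes "norm q < 1"
  shows "summable (\<lambda>n. real (card (op_le m n)) * norm q ^ n) \<and>
         (\<lambda>n. of_nat (card (op_le m n)) * q ^ n) sums over_prod m q"
proof (induction m)
  case 0
  have "(\<lambda>n. of_nat (card (op_le 0 n)) * q ^ n) = (\<lambda>n. if n = 0 then 1 else 0)"
       "(\<lambda>n. real (card (op_le 0 n)) * norm q ^ n) = (\<lambda>n. if n = 0 then 1 else 0)"
    by (auto simp: op_le_0)
  then
  show ?case
    using sums_single[of 0 "\<lambda>_. 1 :: 'a"] sums_single[of 0 "\<lambda>_. 1 :: real"]
    by (simp add: sums_iff)
next
  case (Suc m)
  let ?c = "\<lambda>n. of_nat (card (op_le m n)) * q ^ n"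
  let ?C = "\<lambda>n. of_nat (card (op_le (Suc m) n)) * q ^ n"
  let ?d = "\<lambda>n. of_nat (card (op_plain (Suc m) n)) * q ^ n"
  have sd: "summable (\<lambda>n. real (card (op_plain (Suc m) n)) * norm q ^ n)"
    using assms Suc.IH by (intro op_plain_summable) auto
  then have "summable ?d"
    by (intro summable_norm_cancel[of ?d]) (simp add: norm_mult norm_power)
  then obtain D where D: "?d sums D" by blast
  have sh: "(\<lambda>n. q ^ Suc m * (if Suc m \<le> n then ?d (n - Suc m) else 0)) sums (q ^ Suc m * D)"
    by (intro sums_mult sums_shift_zero D)
  have "(\<lambda>n. ?c n + q ^ Suc m * (if Suc m \<le> n then ?d (n - Suc m) else 0))
          sums (over_prod m q + q ^ Suc m * D)"
    using Suc.IH by (intro sums_add sh) auto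
  also have "(\<lambda>n. ?c n + q ^ Suc m * (if Suc m \<le> n then ?d (n - Suc m) else 0)) = ?d"
    by (rule ext, subst (2) card_op_plain_Suc) (auto simp: algebra_simps simp flip: power_add power_Suc)
  finally have "D = over_prod m q + q ^ Suc m * D"
    using D sums_unique2 by blast
  moreover have ne: "1 - q ^ Suc m \<noteq> 0"
    using norm_power_less_one[OF assms, of m] by (metis eq_iff_diff_eq_0 norm_one order_less_irrefl)
  ultimately have Deq: "D = over_prod m q / (1 - q ^ Suc m)"
    by (simp add: field_simps del: power_Suc)
  have "(\<lambda>n. ?d n + q ^ Suc m * (if Suc m \<le> n then ?d (n - Suc m) else 0)) sums (D + q ^ Suc m * D)"
    by (intro sums_add sh D)
  also have "(\<lambda>n. ?d n + q ^ Suc m * (if Suc m \<le> n then ?d (n - Suc m) else 0)) = ?C"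
    by (rule ext, subst card_op_le_Suc) (auto simp: algebra_simps simp flip: power_add power_Suc)
  also have "D + q ^ Suc m * D = over_prod (Suc m) q"
    by (simp add: Deq over_prod_Suc distrib_left add_divide_distrib mult.commute del: power_Suc)
  finally have 1: "?C sums over_prod (Suc m) q" .
  have "summable (\<lambda>n. real (card (op_plain (Suc m) n)) * norm q ^ n +
         norm q ^ Suc m * (if Suc m \<le> n then real (card (op_plain (Suc m) (n - Suc m))) * norm q ^ (n - Suc m) else 0))"
    by (intro summable_add[OF sd] summable_mult sums_summable[OF sums_shift_zero[OF summable_sums[OF sd]]])
  also have "(\<lambda>n. real (card (op_plain (Suc m) n)) * norm q ^ n +
         norm q ^ Suc m * (if Suc m \<le> n then real (card (op_plain (Suc m) (n - Suc m))) * norm q ^ (n - Suc m) else 0))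
       = (\<lambda>n. real (card (op_le (Suc m) n)) * norm q ^ n)"
    by (rule ext, subst card_op_le_Suc) (auto simp: algebra_simps simp flip: power_add power_Suc)
  finally show ?case using 1 by simp
qed

lemma sum_power_le_geometric:
  fixes r :: real
  assumes r: "0 \<le> r" "r < 1"
  shows "(\<Sum>k=1..m. r ^ k) \<le> 1 / (1 - r)"
proof -
  have "(\<Sum>k=1..m. r ^ k) \<le> (\<Sum>k. r ^ k)"
    using r by (intro sum_le_suminf) (auto simp: summable_geometric)
  also have "\<dots> = 1 / (1 - r)"
    using r by (simp add: suminf_geometric)
  finally show ?thesis .
qed

text \<open>Each factor is 1 + 2x/(1 - x) with x = r^k, hence at most exp(2x/(1 - r)), and the
  exponents form a geometric series. The point is that the bound does not depend on m.\<close>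

lemma over_prod_real_bounds:
  fixes r :: real
  assumes r: "0 \<le> r" "r < 1"
  shows "1 \<le> over_prod m r" "over_prod m r \<le> exp (2 / (1 - r)\<^sup>2)"
proof -
  have pow: "0 \<le> r ^ k" "r ^ k \<le> r" if "k \<ge> 1" for k
    using r that power_decreasing[of 1 k r] by auto
  show "1 \<le> over_prod m r"
    unfolding over_prod_def
  proof (rule prod_ge_1)
    fix k assume "k \<in> {1..m}"
    with pow[of k] r show "1 \<le> (1 + r ^ k) / (1 - r ^ k)" by (simp add: field_simps)
  qed
  have "over_prod m r \<le> (\<Prod>k=1..m. exp (2 / (1 - r) * r ^ k))"
    unfolding over_prod_def
  proof (rule prod_mono, safe)
    fix k assume k: "k \<in> {1..m}"
    show "0 \<le> (1 + r ^ k) / (1 - r ^ k)" using pow[of k] k r by (simp add: field_simps)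
    have "(1 + r ^ k) / (1 - r ^ k) = 1 + 2 * r ^ k / (1 - r ^ k)"
      using pow[of k] k r by (simp add: field_simps)
    also have "\<dots> \<le> 1 + 2 * r ^ k / (1 - r)"
      using pow[of k] k r by (intro add_left_mono divide_left_mono) auto
    also have "\<dots> \<le> exp (2 / (1 - r) * r ^ k)"
      using exp_ge_add_one_self[of "2 / (1 - r) * r ^ k"] by simp
    finally show "(1 + r ^ k) / (1 - r ^ k) \<le> exp (2 / (1 - r) * r ^ k)" .
  qed
  also have "\<dots> = exp (2 / (1 - r) * (\<Sum>k=1..m. r ^ k))"
    by (simp add: exp_sum sum_distrib_left)
  also have "\<dots> \<le> exp (2 / (1 - r) * (1 / (1 - r)))"
    using mult_left_mono[OF sum_power_le_geometric[OF r, of m], of "2 / (1 - r)"] r by simp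
  finally show "over_prod m r \<le> exp (2 / (1 - r)\<^sup>2)"
    by (simp add: power2_eq_square)
qed

lemma norm_factor_le:
  fixes z :: "'a :: real_normed_field"
  assumes "norm z < 1"
  shows "norm ((1 + z) / (1 - z)) \<le> (1 + norm z) / (1 - norm z)"
        "norm ((1 - z) / (1 + z)) \<le> (1 + norm z) / (1 - norm z)"
proof -
  have "norm (1 + z) \<le> 1 + norm z" "norm (1 - z) \<le> 1 + norm z"
    using norm_triangle_ineq[of 1 z] norm_triangle_ineq4[of 1 z] by auto
  moreover have "1 - norm z \<le> norm (1 - z)" "1 - norm z \<le> norm (1 + z)"
    using norm_triangle_ineq2[of 1 z] norm_triangle_ineq2[of 1 "-z"] by auto
  ultimately show "norm ((1 + z) / (1 - z)) \<le> (1 + norm z) / (1 - norm z)"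
        "norm ((1 - z) / (1 + z)) \<le> (1 + norm z) / (1 - norm z)"
    using assms by (auto simp: norm_divide intro!: frac_le)
qed

lemma norm_pow_less_one: "norm q < 1 \<Longrightarrow> 1 \<le> k \<Longrightarrow> norm (q ^ k) < (1::real)"
  for q :: "'a :: real_normed_div_algebra"
  using norm_power_less_one[of q "k - 1"] by simp

lemma one_pm_power_nonzero:
  fixes q :: "'a :: real_normed_field"
  assumes "norm q < 1" "1 \<le> k"
  shows "1 - q ^ k \<noteq> 0" "1 + q ^ k \<noteq> 0"
proof -
  have "q ^ k \<noteq> 1" "q ^ k \<noteq> -1"
    using norm_pow_less_one[OF assms] by auto
  then show "1 - q ^ k \<noteq> 0" "1 + q ^ k \<noteq> 0"
    by (auto simp: add_eq_0_iff equation_minus_iff)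
qed

lemma over_prod_nonzero:
  fixes q :: "'a :: real_normed_field"
  assumes "norm q < 1"
  shows "over_prod m q \<noteq> 0"
  using one_pm_power_nonzero[OF assms] by (auto simp: over_prod_def)

text \<open>Replacing z by -z exchanges (1 + z)/(1 - z) with its reciprocal, so the product and its
  reciprocal share one majorant.\<close>

lemma norm_over_prod_le:
  fixes q :: "'a :: real_normed_field"
  assumes "norm q < 1"
  shows "norm (over_prod m q) \<le> over_prod m (norm q)"
        "norm (1 / over_prod m q) \<le> over_prod m (norm q)"
proof -
  have *: "norm (q ^ k) < 1" if "k \<in> {1..m}" for k
    using norm_pow_less_one[OF assms] that by auto
  show "norm (over_prod m q) \<le> over_prod m (norm q)"
    unfolding over_prod_def prod_norm[symmetric]
    by (rule prod_mono) (use * norm_factor_le in \<open>auto simp flip: norm_power\<close>)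
  have "1 / over_prod m q = (\<Prod>k=1..m. (1 - q ^ k) / (1 + q ^ k))"
    unfolding over_prod_def prod_dividef by simp
  then show "norm (1 / over_prod m q) \<le> over_prod m (norm q)"
    unfolding over_prod_def prod_norm[symmetric]
    by (simp only: prod_norm[symmetric])
       (rule prod_mono, use * norm_factor_le in \<open>auto simp flip: norm_power\<close>)
qed

text \<open>Below degree N, bounding the parts by N changes nothing, so a partial sum of the full
  series is at most \<open>over_prod N r\<close>, which is bounded uniformly in N.\<close>

lemma overp_summable_real:
  fixes r :: real
  assumes r: "0 \<le> r" "r < 1"
  shows "summable (\<lambda>n. overp n * r ^ n)"
proof (rule summableI_nonneg_bounded)
  fix N
  have s: "(\<lambda>n. card (op_le N n) * r ^ n) sums over_prod N r"
    using op_le_sums[of r N] r by simp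
  have "(\<Sum>n<N. overp n * r ^ n) = (\<Sum>n<N. card (op_le N n) * r ^ n)"
    by (intro sum.cong) (auto simp: op_le_eq_overpartitions overp_def)
  also have "\<dots> \<le> over_prod N r"
    using sum_le_suminf[OF sums_summable[OF s], of "{..<N}"] sums_unique[OF s] r by auto
  also have "\<dots> \<le> exp (2 / (1 - r)\<^sup>2)"
    by (intro over_prod_real_bounds r)
  finally show "(\<Sum>n<N. overp n * r ^ n) \<le> exp (2 / (1 - r)\<^sup>2)" .
qed (use r in auto)

definition over_gf :: "'a :: {real_normed_field, banach} \<Rightarrow> 'a" where
  "over_gf q = (\<Sum>n. of_nat (overp n) * q ^ n)"

lemma overp_summable:
  fixes q :: "'a :: {real_normed_field, banach}"
  assumes "norm q < 1"
  shows "summable (\<lambda>n. norm (of_nat (overp n) * q ^ n))"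
        "summable (\<lambda>n. of_nat (overp n) * q ^ n)"
proof -
  show "summable (\<lambda>n. norm (of_nat (overp n) * q ^ n))"
    using overp_summable_real[of "norm q"] assms by (simp add: norm_mult norm_power)
  then show "summable (\<lambda>n. of_nat (overp n) * q ^ n)"
    by (rule summable_norm_cancel)
qed

text \<open>Tannery's theorem: the coefficient of q^n is constant once m reaches n, and
  \<open>overp n\<close> dominates it for all m.\<close>

lemma over_prod_tendsto:
  fixes q :: "'a :: {real_normed_field, banach}"
  assumes q: "norm q < 1"
  shows "(\<lambda>m. over_prod m q) \<longlonglongrightarrow> over_gf q"
proof -
  have "(\<lambda>m. \<Sum>n. of_nat (card (op_le m n)) * q ^ n) \<longlonglongrightarrow> (\<Sum>n. of_nat (overp n) * q ^ n)"
  proof (rule tannerys_theorem[THEN conjunct2, THEN conjunct2])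
    fix n
    have "\<forall>\<^sub>F m in sequentially. of_nat (overp n) * q ^ n = of_nat (card (op_le m n)) * q ^ n"
      using eventually_ge_at_top[of n]
      by eventually_elim (simp add: op_le_eq_overpartitions overp_def)
    then show "((\<lambda>m. of_nat (card (op_le m n)) * q ^ n) \<longlongrightarrow> of_nat (overp n) * q ^ n) sequentially"
      by (rule tendsto_eventually[OF eventually_mono]) auto
  next
    show "\<forall>\<^sub>F (n, m) in at_top \<times>\<^sub>F sequentially.
            norm (of_nat (card (op_le m n)) * q ^ n) \<le> real (overp n) * norm q ^ n"
      by (intro always_eventually allI)
         (auto simp: norm_mult norm_power card_op_le_le_overp intro!: mult_right_mono)
    show "summable (\<lambda>n. real (overp n) * norm q ^ n)"
      using overp_summable_real[of "norm q"] q by simp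
  qed auto
  moreover have "(\<Sum>n. of_nat (card (op_le m n)) * q ^ n) = over_prod m q" for m
    using op_le_sums[OF q, of m] by (simp add: sums_iff)
  ultimately show ?thesis by (simp add: over_gf_def)
qed

lemma over_gf_real_ge_1:
  fixes r :: real
  assumes r: "0 \<le> r" "r < 1"
  shows "1 \<le> over_gf r"
  by (rule LIMSEQ_le_const[OF over_prod_tendsto]) (use assms over_prod_real_bounds in auto)

text \<open>The reciprocals of the finite products are bounded uniformly in m, so the products stay
  away from 0 in the limit.\<close>

lemma over_gf_nonzero:
  fixes q :: "'a :: {real_normed_field, banach}"
  assumes q: "norm q < 1"
  shows "over_gf q \<noteq> 0"
proof
  assume "over_gf q = 0"
  define B where "B = exp (2 / (1 - norm q)\<^sup>2)"
  have "norm (over_prod m q) \<ge> 1 / B" for m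
  proof -
    have "norm (1 / over_prod m q) \<le> B"
      unfolding B_def using q
      by (intro order_trans[OF norm_over_prod_le(2)] over_prod_real_bounds) auto
    then show ?thesis
      using over_prod_nonzero[OF q, of m] by (simp add: norm_divide field_simps B_def)
  qed
  then have "1 / B \<le> norm (over_gf q)"
    by (intro LIMSEQ_le_const[OF tendsto_norm[OF over_prod_tendsto[OF q]]]) auto
  then show False using \<open>over_gf q = 0\<close> by (simp add: B_def)
qed

text \<open>Shanks' finite form of Gauss's identity: consecutive differences in \<open>n\<close> telescope.\<close>

lemma gauss_finite:
  fixes q :: "'a :: real_normed_field"
  assumes q: "norm q < 1"
  shows "(\<Sum>s\<le>n. (-1) ^ s * (over_prod s q / over_prod n q) * (2 / (1 + q ^ s)) * q ^ (s * (n + 1))) =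
         1 + 2 * (\<Sum>s<n. (-1) ^ Suc s * q ^ (Suc s)\<^sup>2)"
proof (induction n)
  case 0
  then show ?case by simp
next
  case (Suc n)
  define R where "R = (\<lambda>s. over_prod s q)"
  define N where "N = Suc n"
  \<comment> \<open>Up to a factor independent of s, the s-th summand changes by
    \<open>T s + T (Suc s)\<close> when n becomes N. With signs this telescopes, and
    \<open>T 0 = 0\<close> removes the lower end; the upper end merges with the new summand s = N
    into the next theta term.\<close>
  define T where "T = (\<lambda>s. if s = 0 then 0 else q ^ (s * N) * R (s - 1))"
  define F where "F = (\<lambda>n. \<Sum>s\<le>n. (-1) ^ s * (R s / R n) * (2 / (1 + q ^ s)) * q ^ (s * (n + 1)))"
  have R0: "R s \<noteq> 0" for s using over_prod_nonzero[OF q] by (simp add: R_def)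
  have nz: "1 - q ^ k \<noteq> 0" "1 + q ^ k \<noteq> 0" if "k \<ge> 1" for k
    using one_pm_power_nonzero[OF q that] by auto
  have nz2: "1 + q ^ k \<noteq> 0" for k
    using nz(2)[of k] by (cases "k = 0") auto
  have RN: "R N = R n * ((1 + q ^ N) / (1 - q ^ N))"
    by (simp add: R_def N_def over_prod_Suc)
  have step: "(R s / R N) * (2 / (1 + q ^ s)) * q ^ (s * (N + 1)) - (R s / R n) * (2 / (1 + q ^ s)) * q ^ (s * (n + 1))
        = - 2 / (R n * (1 + q ^ N)) * (T s + T (Suc s))" for s
  proof -
    have Ts: "T s = q ^ (s * N) * (R s * (1 - q ^ s) / (1 + q ^ s))"
    proof (cases s)
      case (Suc k)
      then show ?thesis using nz[of s] by (simp add: T_def R_def over_prod_Suc)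
    qed (simp add: T_def)
    have Ts1: "T (Suc s) = q ^ (s * N) * q ^ N * R s"
      by (simp add: T_def power_add)
    have e: "q ^ (s * (N + 1)) = q ^ (s * N) * q ^ s" "q ^ (s * (n + 1)) = q ^ (s * N)"
      by (auto simp: N_def algebra_simps simp flip: power_add)
    show ?thesis
      unfolding Ts Ts1 e RN using nz[of N] nz2[of s] R0[of n] R0[of s]
      by (simp add: N_def[symmetric] divide_simps) (simp add: N_def algebra_simps)
  qed
  have tel: "(\<Sum>s\<le>k. (-1) ^ s * (T s + T (Suc s))) = (-1) ^ k * T (Suc k)" for k
    by (induction k) (auto simp: T_def algebra_simps)
  have "F N = (\<Sum>s\<le>n. (-1) ^ s * ((R s / R N) * (2 / (1 + q ^ s)) * q ^ (s * (N + 1)))) +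
               (-1) ^ N * (2 / (1 + q ^ N)) * q ^ (N * (N + 1))"
    using R0[of N] by (simp add: F_def N_def mult.assoc)
  also have "(\<Sum>s\<le>n. (-1) ^ s * ((R s / R N) * (2 / (1 + q ^ s)) * q ^ (s * (N + 1)))) =
       (\<Sum>s\<le>n. (-1) ^ s * ((R s / R n) * (2 / (1 + q ^ s)) * q ^ (s * (n + 1)) +
          - 2 / (R n * (1 + q ^ N)) * (T s + T (Suc s))))"
    by (intro sum.cong refl arg_cong2[of _ _ _ _ "(*)"], subst step[symmetric]) simp
  also have "\<dots> = F n + - 2 / (R n * (1 + q ^ N)) * (\<Sum>s\<le>n. (-1) ^ s * (T s + T (Suc s)))"
    unfolding F_def sum_distrib_left sum.distrib[symmetric]
    by (intro sum.cong refl) (simp only: distrib_left distrib_right mult_ac)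
  also have "(\<Sum>s\<le>n. (-1) ^ s * (T s + T (Suc s))) = (-1) ^ n * (q ^ (N * N) * R n)"
    by (subst tel) (simp add: T_def N_def)
  also have "F n + - 2 / (R n * (1 + q ^ N)) * ((-1) ^ n * (q ^ (N * N) * R n)) + (-1) ^ N * (2 / (1 + q ^ N)) * q ^ (N * (N + 1))
      = F n + 2 * ((-1) ^ N * q ^ (N * N))"
    using nz[of N] R0[of n] by (simp add: N_def[symmetric] power_add divide_simps) (simp add: N_def algebra_simps)
  also have "F n = 1 + 2 * (\<Sum>s<n. (-1) ^ Suc s * q ^ (Suc s)\<^sup>2)"
    using Suc.IH by (simp add: F_def R_def)
  finally show ?case
    by (simp add: F_def R_def N_def power2_eq_square distrib_left del: mult_Suc mult_Suc_right power_Suc)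
qed

text \<open>In \<open>gauss_finite\<close> the summand s = 0 is \<open>1 / over_prod n q\<close>,
  since 2/(1 + q^0) = 1. For s >= 1 the exponent s(n + 1) is at least n + s, so the remaining
  summands are O(|q|^n) in total.\<close>

lemma gauss_identity:
  fixes q :: "'a :: {real_normed_field, banach}"
  assumes q: "norm q < 1"
  shows "(\<lambda>n. 1 + 2 * (\<Sum>s<n. (-1) ^ Suc s * q ^ (Suc s)\<^sup>2)) \<longlonglongrightarrow> 1 / over_gf q"
proof -
  define B where "B = exp (2 / (1 - norm q)\<^sup>2)"
  define g where "g = (\<lambda>n s. (-1) ^ s * (over_prod s q / over_prod n q) * (2 / (1 + q ^ s)) * q ^ (s * (n + 1)))"
  have B: "norm (over_prod m q) \<le> B" "norm (1 / over_prod m q) \<le> B" for m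
    unfolding B_def using q
    by (auto intro!: order_trans[OF norm_over_prod_le(2)] order_trans[OF norm_over_prod_le(1)] over_prod_real_bounds)
  have lim: "(\<lambda>n. B * B * (2 / (1 - norm q)) * (norm q ^ n * (1 / (1 - norm q)))) \<longlonglongrightarrow> B * B * (2 / (1 - norm q)) * (0 * (1 / (1 - norm q)))"
    using q by (intro tendsto_intros LIMSEQ_power_zero) auto
  have "(\<lambda>n. \<Sum>s=1..n. g n s) \<longlonglongrightarrow> 0"
  proof (rule Lim_null_comparison[OF always_eventually])
    show "(\<lambda>n. B * B * (2 / (1 - norm q)) * (norm q ^ n * (1 / (1 - norm q)))) \<longlonglongrightarrow> 0"
      using lim by simp
    show "\<forall>n. norm (\<Sum>s=1..n. g n s) \<le> B * B * (2 / (1 - norm q)) * (norm q ^ n * (1 / (1 - norm q)))"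
    proof
      fix n
      have "norm (\<Sum>s=1..n. g n s) \<le> (\<Sum>s=1..n. B * B * (2 / (1 - norm q)) * (norm q ^ n * norm q ^ s))"
      proof (rule sum_norm_le)
        fix s assume s: "s \<in> {1..n}"
        have "norm (q ^ s) \<le> norm q"
          using power_decreasing[of 1 s "norm q"] q s by (auto simp: norm_power)
        then have "1 - norm q \<le> norm (1 + q ^ s)"
          using norm_triangle_ineq2[of 1 "- (q ^ s)"] by simp
        then have 1: "norm (2 / (1 + q ^ s)) \<le> 2 / (1 - norm q)"
          using q by (auto simp: norm_divide intro!: frac_le)
        have "n + s \<le> s * (n + 1)" using s by (cases s) auto
        then have 2: "norm (q ^ (s * (n + 1))) \<le> norm q ^ n * norm q ^ s"
          using q by (auto simp: norm_power simp flip: power_add intro!: power_decreasing)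
        have "norm (g n s) = norm (over_prod s q) * norm (1 / over_prod n q) * norm (2 / (1 + q ^ s)) * norm (q ^ (s * (n + 1)))"
          by (simp add: g_def norm_mult norm_divide norm_power)
        also have "\<dots> \<le> B * B * (2 / (1 - norm q)) * (norm q ^ n * norm q ^ s)"
          using B 1 2 q by (intro mult_mono) (auto simp: B_def)
        finally show "norm (g n s) \<le> B * B * (2 / (1 - norm q)) * (norm q ^ n * norm q ^ s)" .
      qed
      also have "\<dots> = B * B * (2 / (1 - norm q)) * (norm q ^ n * (\<Sum>s=1..n. norm q ^ s))"
        by (simp add: sum_distrib_left)
      also have "\<dots> \<le> B * B * (2 / (1 - norm q)) * (norm q ^ n * (1 / (1 - norm q)))"
        using q sum_power_le_geometric[of "norm q" n] by (intro mult_left_mono) (auto simp: B_def)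
      finally show "norm (\<Sum>s=1..n. g n s) \<le> B * B * (2 / (1 - norm q)) * (norm q ^ n * (1 / (1 - norm q)))" .
    qed
  qed
  then have "(\<lambda>n. 1 / over_prod n q + (\<Sum>s=1..n. g n s)) \<longlonglongrightarrow> 1 / over_gf q + 0"
    using over_gf_nonzero[OF q] over_prod_tendsto[OF q] by (intro tendsto_intros) auto
  also have "(\<lambda>n. 1 / over_prod n q + (\<Sum>s=1..n. g n s)) = (\<lambda>n. \<Sum>s\<le>n. g n s)"
  proof
    fix n :: nat
    have "{..n} = insert 0 {1..n}" by auto
    then show "1 / over_prod n q + (\<Sum>s=1..n. g n s) = (\<Sum>s\<le>n. g n s)"
      by (simp add: g_def)
  qed
  also have "\<dots> = (\<lambda>n. 1 + 2 * (\<Sum>s<n. (-1) ^ Suc s * q ^ (Suc s)\<^sup>2))"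
    unfolding g_def using gauss_finite[OF q] by simp
  finally show ?thesis by simp
qed

section \<open>Theta inversion\<close>

text \<open>The concave sine lies above its chord from 0 to pi/2. This supplies the majorant in
  \<open>dual_side_tendsto\<close> and the distance estimate in
  \<open>minor_arc_bound\<close>.\<close>

lemma jordan_inequality:
  fixes y :: real
  assumes "0 \<le> y" "y \<le> pi / 2"
  shows "2 * y / pi \<le> sin y"
proof -
  have "convex_on {0..pi/2} (\<lambda>x. - sin x :: real)"
    by (rule f''_ge0_imp_convex[where f' = "\<lambda>x. - cos x" and f'' = "\<lambda>x. sin x"])
       (auto intro!: derivative_eq_intros sin_ge_zero)
  from convex_onD_Icc[OF this, of "2 * y / pi"] assms show ?thesis
    by (simp add: field_simps)
qed

lemma cos_double_power_expansion:
  fixes x :: real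
  shows "(2 * cos x) ^ (2 * m) = (\<Sum>k\<le>2*m. real ((2 * m) choose k) * cos ((2 * real k - 2 * real m) * x))"
proof -
  have "complex_of_real (2 * cos x) = cis (-x) * (1 + cis (2 * x))"
    by (simp add: distrib_left cis_mult) (simp add: complex_eq_iff)
  then have "complex_of_real ((2 * cos x) ^ (2 * m)) = (cis (-x) * (1 + cis (2 * x))) ^ (2 * m)"
    by (simp only: of_real_power)
  also have "\<dots> = cis (- real (2*m) * x) * (cis (2 * x) + 1) ^ (2 * m)"
    by (simp add: power_mult_distrib add.commute Complex.DeMoivre)
  also have "\<dots> = (\<Sum>k\<le>2*m. of_nat ((2 * m) choose k) * (cis (- real (2*m) * x) * cis (2 * x) ^ k))"
    unfolding binomial_ring by (simp add: sum_distrib_left mult_ac)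
  also have "\<dots> = (\<Sum>k\<le>2*m. of_nat ((2 * m) choose k) * cis ((2 * real k - 2 * real m) * x))"
    by (intro sum.cong refl) (simp add: Complex.DeMoivre cis_mult algebra_simps)
  finally have "Re (complex_of_real ((2 * cos x) ^ (2 * m))) =
     Re (\<Sum>k\<le>2*m. of_nat ((2 * m) choose k) * cis ((2 * real k - 2 * real m) * x))"
    by (rule arg_cong)
  then show ?thesis by (simp add: Re_sum del: of_real_power)
qed

lemma sum_symmetric_binomial:
  fixes g :: "real \<Rightarrow> real"
  assumes even: "\<And>x. g (- x) = g x"
  shows "(\<Sum>k\<le>2*m. real ((2 * m) choose k) * g (real k - real m)) =
           real ((2 * m) choose m) * g 0 + 2 * (\<Sum>e=1..m. real ((2 * m) choose (m + e)) * g (real e))"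
proof -
  let ?f = "\<lambda>k. real ((2 * m) choose k) * g (real k - real m)"
  have "{..2*m} = {..m} \<union> {m+1..2*m}" by auto
  then have "sum ?f {..2*m} = sum ?f {..m} + sum ?f {m+1..2*m}"
    using sum.union_disjoint[of "{..m}" "{m+1..2*m}" ?f] by auto
  also have "sum ?f {..m} = sum ?f {..<m} + ?f m"
    by (simp flip: lessThan_Suc_atMost)
  also have "sum ?f {m+1..2*m} = (\<Sum>e=1..m. real ((2 * m) choose (m + e)) * g (real e))"
    by (rule sum.reindex_bij_witness[of _ "\<lambda>e. m + e" "\<lambda>k. k - m"]) (auto simp: of_nat_diff)
  also have "sum ?f {..<m} = (\<Sum>e=1..m. real ((2 * m) choose (m + e)) * g (real e))"
  proof (rule sum.reindex_bij_witness[of _ "\<lambda>e. m - e" "\<lambda>k. m - k"])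
    fix k assume k: "k \<in> {..<m}"
    have "(2 * m) choose k = (2 * m) choose (m + (m - k))"
      using k by (subst binomial_symmetric) (auto simp: mult_2)
    moreover have "g (real (m - k)) = g (real k - real m)"
      using k even[of "real k - real m"] by (simp add: of_nat_diff)
    ultimately show "real ((2 * m) choose (m + (m - k))) * g (real (m - k)) = ?f k" by simp
  qed auto
  finally show ?thesis by (simp add: algebra_simps)
qed

text \<open>Multiplication by 2 sin(pi e / l) makes the sum telescope when l does not divide e. The
  nodes are odd multiples of pi/(2l); this half-step offset from the roots of unity creates the
  sign, and thereby the alternating theta series.\<close>

lemma sum_cos_odd_multiples:
  fixes l e :: nat
  assumes l: "l > 0"
  shows "(\<Sum>j<l. cos (2 * real e * (pi * (2 * real j + 1) / (2 * real l)))) =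
           (if l dvd e then real l * (-1) ^ (e div l) else 0)"
proof (cases "l dvd e")
  case True
  then obtain i where i: "e = l * i" by auto
  have "cos (2 * real e * (pi * (2 * real j + 1) / (2 * real l))) = (-1) ^ i" for j
  proof -
    have "2 * real e * (pi * (2 * real j + 1) / (2 * real l)) = real ((2 * j + 1) * i) * pi"
      using l by (simp add: i field_simps)
    then show ?thesis
      by (simp only: cos_npi) (simp add: power_mult power_add)
  qed
  then show ?thesis using l i by simp
next
  case False
  define s where "s = sin (pi * real e / real l)"
  have "s \<noteq> 0"
  proof
    assume "s = 0"
    then obtain i :: int where "pi * real e / real l = of_int i * pi"
      unfolding s_def sin_zero_iff_int2 by auto
    then have "real e = of_int i * real l" using l by (simp add: field_simps)
    then have "int e = i * int l" by (metis of_int_eq_iff of_int_mult of_int_of_nat_eq)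
    then show False using False by (metis dvd_triv_right int_dvd_int_iff)
  qed
  have "2 * s * (\<Sum>j<l. cos (2 * real e * (pi * (2 * real j + 1) / (2 * real l)))) =
        (\<Sum>j<l. sin (2 * pi * real (Suc j) * real e / real l) - sin (2 * pi * real j * real e / real l))"
    unfolding sum_distrib_left
  proof (intro sum.cong refl)
    fix j
    define A B where "A = 2 * real e * (pi * (2 * real j + 1) / (2 * real l))" and "B = pi * real e / real l"
    have "2 * pi * real (Suc j) * real e / real l = A + B" "2 * pi * real j * real e / real l = A - B"
      using l by (simp_all add: A_def B_def field_simps)
    then show "2 * s * cos (2 * real e * (pi * (2 * real j + 1) / (2 * real l))) =
        sin (2 * pi * real (Suc j) * real e / real l) - sin (2 * pi * real j * real e / real l)"
      unfolding s_def A_def[symmetric] B_def[symmetric] by (simp only: sin_add sin_diff) simp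
  qed
  also have "\<dots> = sin (2 * pi * real l * real e / real l) - sin (2 * pi * real 0 * real e / real l)"
    by (rule sum_lessThan_telescope)
  also have "\<dots> = 0"
    using l sin_int_2pin[of "int e"] by (simp add: mult_ac)
  finally show ?thesis using \<open>s \<noteq> 0\<close> False by simp
qed

text \<open>A discrete Gaussian: for k of order sqrt m it is close to exp(-k^2/m). Normalising by
  the central coefficient makes the value at k = 0 equal to 1.\<close>

definition cbin_ratio :: "nat \<Rightarrow> nat \<Rightarrow> real" where
  "cbin_ratio m k = real ((2 * m) choose (m + k)) / real ((2 * m) choose m)"

text \<open>Polya's finite theta identity: a roots-of-unity filter on a central binomial row.\<close>

lemma finite_theta_identity:
  assumes h: "h > 0" and m: "m > 0"
  shows "real h * (1 + 2 * (\<Sum>i<m. (-1) ^ Suc i * cbin_ratio m (2 * h * Suc i))) =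
         4 ^ m / real ((2 * m) choose m) * (\<Sum>j<h. (cos (pi * (2 * real j + 1) / (4 * real h)))\<^sup>2 ^ m)"
proof -
  \<comment> \<open>The number of nodes is even so that x -> pi - x pairs node j with node l - 1 -
    j. Only h nodes remain, all in (0, pi/2), where Jordan's inequality applies.\<close>
  define l where "l = 2 * h"
  define x where "x = (\<lambda>j. pi * (2 * real j + 1) / (2 * real l))"
  define g where "g = (\<lambda>e. \<Sum>j<l. cos (2 * e * x j))"
  define B where "B = real ((2 * m) choose m)"
  have l: "l > 0" using h by (simp add: l_def)
  have B: "B > 0" by (simp add: B_def)
  have "(\<Sum>j<l. (2 * cos (x j)) ^ (2 * m)) = (\<Sum>k\<le>2*m. real ((2 * m) choose k) * g (real k - real m))"
    unfolding cos_double_power_expansion g_def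
    by (subst sum.swap) (simp add: sum_distrib_left algebra_simps)
  also have "\<dots> = B * g 0 + 2 * (\<Sum>e=1..m. real ((2 * m) choose (m + e)) * g (real e))"
    unfolding B_def by (rule sum_symmetric_binomial) (simp add: g_def)
  also have "g 0 = real l" by (simp add: g_def)
  \<comment> \<open>Only multiples of l survive the filter. The index range i < m is larger than
    necessary for covering them, but binomial coefficients beyond the end of the row are 0.\<close>
  also have "(\<Sum>e=1..m. real ((2 * m) choose (m + e)) * g (real e)) =
             (\<Sum>e\<in>(\<lambda>i. l * Suc i) ` {..<m}. real ((2 * m) choose (m + e)) * (real l * (-1) ^ (e div l)))"
  proof (rule sum.mono_neutral_cong)
    fix e assume e: "e \<in> {1..m} - (\<lambda>i. l * Suc i) ` {..<m}"
    have "\<not> l dvd e"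
    proof
      assume "l dvd e"
      then obtain i where i: "e = l * i" by auto
      with e have "i > 0" by (cases i) auto
      moreover have "i \<le> m" using i l e by (cases l) auto
      ultimately have "e = l * Suc (i - 1)" "i - 1 < m" using i by auto
      with e show False by blast
    qed
    then show "real ((2 * m) choose (m + e)) * g (real e) = 0"
      using sum_cos_odd_multiples[OF l, of e] by (simp add: g_def x_def)
  next
    fix e assume "e \<in> (\<lambda>i. l * Suc i) ` {..<m} - {1..m}"
    then have "e > m" using l by (auto simp del: mult_Suc_right)
    then show "real ((2 * m) choose (m + e)) * (real l * (-1) ^ (e div l)) = 0" by simp
  next
    fix e assume "e \<in> {1..m} \<inter> (\<lambda>i. l * Suc i) ` {..<m}"
    then have "l dvd e" by (auto simp del: mult_Suc_right)
    then show "real ((2 * m) choose (m + e)) * g (real e) = real ((2 * m) choose (m + e)) * (real l * (-1) ^ (e div l))"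
      using sum_cos_odd_multiples[OF l, of e] by (simp add: g_def x_def)
  qed auto
  also have "\<dots> = (\<Sum>i<m. real ((2 * m) choose (m + l * Suc i)) * (real l * (-1) ^ Suc i))"
    using l by (subst sum.reindex) (auto intro!: inj_onI sum.cong simp del: mult_Suc_right power_Suc)
  also have "\<dots> = B * real l * (\<Sum>i<m. (-1) ^ Suc i * cbin_ratio m (l * Suc i))"
    using B unfolding sum_distrib_left cbin_ratio_def B_def[symmetric]
    by (intro sum.cong) (auto simp del: mult_Suc_right power_Suc)
  finally have 1: "(\<Sum>j<l. (2 * cos (x j)) ^ (2 * m)) =
      B * real l * (1 + 2 * (\<Sum>i<m. (-1) ^ Suc i * cbin_ratio m (l * Suc i)))"
    by (simp add: algebra_simps)
  have "(\<Sum>j<l. (2 * cos (x j)) ^ (2 * m)) = 4 ^ m * (\<Sum>j<l. (cos (x j))\<^sup>2 ^ m)"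
    by (simp add: sum_distrib_left power_mult power_mult_distrib)
  also have "(\<Sum>j<l. (cos (x j))\<^sup>2 ^ m) = (\<Sum>j<h. (cos (x j))\<^sup>2 ^ m) + (\<Sum>j\<in>{h..<l}. (cos (x j))\<^sup>2 ^ m)"
    using sum.union_disjoint[of "{..<h}" "{h..<l}" "\<lambda>j. (cos (x j))\<^sup>2 ^ m"]
    by (simp add: l_def ivl_disj_int ivl_disj_un)
  also have "(\<Sum>j\<in>{h..<l}. (cos (x j))\<^sup>2 ^ m) = (\<Sum>j<h. (cos (x j))\<^sup>2 ^ m)"
  proof (rule sum.reindex_bij_witness[of _ "\<lambda>j. l - 1 - j" "\<lambda>j. l - 1 - j"])
    fix j assume j: "j \<in> {h..<l}"
    have "x (l - 1 - j) = pi - x j"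
      using j l by (simp add: x_def of_nat_diff field_simps)
    then show "(cos (x (l - 1 - j)))\<^sup>2 ^ m = (cos (x j))\<^sup>2 ^ m" by simp
  qed (auto simp: l_def)
  finally have "4 ^ m * (2 * (\<Sum>j<h. (cos (x j))\<^sup>2 ^ m)) =
      B * real l * (1 + 2 * (\<Sum>i<m. (-1) ^ Suc i * cbin_ratio m (l * Suc i)))"
    using 1 by (simp only: mult_2[symmetric])
  moreover have "x j = pi * (2 * real j + 1) / (4 * real h)" for j
    by (simp add: x_def l_def)
  ultimately show ?thesis
    using B unfolding B_def[symmetric] by (simp add: l_def field_simps del: mult_Suc_right power_Suc)
qed

section \<open>Gaussian limits of binomial ratios and of powers of the cosine\<close>

lemma cbin_ratio_0: "cbin_ratio m 0 = 1"
  by (simp add: cbin_ratio_def)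

lemma cbin_ratio_nonneg: "cbin_ratio m k \<ge> 0"
  by (simp add: cbin_ratio_def)

lemma cbin_ratio_eq_0: "k > m \<Longrightarrow> cbin_ratio m k = 0"
  by (simp add: cbin_ratio_def)

lemma cbin_ratio_Suc:
  assumes "k < m"
  shows "cbin_ratio m (Suc k) = cbin_ratio m k * ((real m - real k) / (real m + real k + 1))"
proof -
  have "Suc (m + k) * ((2 * m) choose (Suc (m + k))) = (2 * m - (m + k)) * ((2 * m) choose (m + k))"
    using binomial_absorb_comp binomial_absorption by (metis binomial_absorption)
  then have "real (Suc (m + k)) * real ((2 * m) choose (Suc (m + k))) = real (2 * m - (m + k)) * real ((2 * m) choose (m + k))"
    by (simp only: flip: of_nat_mult)
  also have "real (2 * m - (m + k)) = real m - real k"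
    using assms by (simp add: of_nat_diff)
  finally have "real ((2 * m) choose (Suc (m + k))) = real ((2 * m) choose (m + k)) * ((real m - real k) / (real m + real k + 1))"
    by (simp add: field_simps)
  then show ?thesis
    by (simp add: cbin_ratio_def)
qed

text \<open>Consecutive quotients are 1 - (2k+1)/(m+k+1), at most exp(-(2k+1)/(m+K)). Freezing the
  denominator at K lets the odd numbers in the exponents add up to k^2.\<close>

lemma cbin_ratio_le:
  assumes "k \<le> K" "K \<le> m" "m > 0"
  shows "cbin_ratio m k \<le> exp (- (real k)\<^sup>2 / (real m + real K))"
  using assms(1)
proof (induction k)
  case 0
  then show ?case by (simp add: cbin_ratio_0)
next
  case (Suc k)
  have "k < m" using Suc.prems assms by simp
  have "(real m - real k) / (real m + real k + 1) = 1 + - ((2 * real k + 1) / (real m + real k + 1))"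
    by (simp add: field_simps)
  also have "\<dots> \<le> exp (- ((2 * real k + 1) / (real m + real k + 1)))"
    by (rule exp_ge_add_one_self)
  also have "\<dots> \<le> exp (- ((2 * real k + 1) / (real m + real K)))"
    using Suc.prems assms by (auto intro!: divide_left_mono)
  finally have 1: "(real m - real k) / (real m + real k + 1) \<le> exp (- ((2 * real k + 1) / (real m + real K)))" .
  have "cbin_ratio m (Suc k) \<le> exp (- (real k)\<^sup>2 / (real m + real K)) * exp (- ((2 * real k + 1) / (real m + real K)))"
    unfolding cbin_ratio_Suc[OF \<open>k < m\<close>]
    using Suc assms 1 by (intro mult_mono) (auto intro!: cbin_ratio_nonneg)
  also have "\<dots> = exp (- (real (Suc k))\<^sup>2 / (real m + real K))"
    by (simp add: power2_eq_square field_simps add_divide_distrib[symmetric] flip: exp_add)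
  finally show ?case .
qed

text \<open>Here 1 + x <= exp x is applied to the reciprocal quotient 1 + (2k+1)/(m-k), again with
  the denominator frozen at its extreme value.\<close>

lemma cbin_ratio_ge:
  assumes "k \<le> K" "K \<le> m"
  shows "cbin_ratio m k \<ge> exp (- (real k)\<^sup>2 / (real m - real K + 1))"
  using assms(1)
proof (induction k)
  case 0
  then show ?case by (simp add: cbin_ratio_0)
next
  case (Suc k)
  have "k < m" using Suc.prems assms by simp
  have pos: "real m - real k > 0" "real m - real K + 1 > 0" "real m - real K + 1 \<le> real m - real k"
    using Suc.prems assms by auto
  have "exp (- ((2 * real k + 1) / (real m - real K + 1))) \<le> exp (- ((2 * real k + 1) / (real m - real k)))"
    using pos by (auto intro!: divide_left_mono)
  also have "\<dots> = 1 / exp ((2 * real k + 1) / (real m - real k))"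
    by (simp add: exp_minus field_simps)
  also have "\<dots> \<le> 1 / (1 + (2 * real k + 1) / (real m - real k))"
    using pos by (intro divide_left_mono exp_ge_add_one_self) (auto intro!: mult_pos_pos add_pos_nonneg)
  also have "\<dots> = (real m - real k) / (real m + real k + 1)"
    using pos by (simp add: field_simps)
  finally have 1: "exp (- ((2 * real k + 1) / (real m - real K + 1))) \<le> (real m - real k) / (real m + real k + 1)" .
  have "exp (- (real (Suc k))\<^sup>2 / (real m - real K + 1)) = exp (- (real k)\<^sup>2 / (real m - real K + 1)) * exp (- ((2 * real k + 1) / (real m - real K + 1)))"
    by (simp add: power2_eq_square field_simps add_divide_distrib[symmetric] flip: exp_add)
  also have "\<dots> \<le> cbin_ratio m (Suc k)"
    unfolding cbin_ratio_Suc[OF \<open>k < m\<close>]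
    using Suc assms 1 by (intro mult_mono) (auto intro!: cbin_ratio_nonneg)
  finally show ?case .
qed

text \<open>The prefactor of \<open>finite_theta_identity\<close> divided by sqrt m; its limit by
  Wallis's product is sqrt pi.\<close>

definition cbin_scaled :: "nat \<Rightarrow> real" where
  "cbin_scaled m = 4 ^ m / (sqrt (real m) * real ((2 * m) choose m))"

text \<open>The sequence is nonnegative and decreasing; the decrease is the arithmetic-geometric
  inequality 2 sqrt(m(m+1)) <= 2m + 1.\<close>

lemma cbin_scaled_tendsto:
  obtains L where "cbin_scaled \<longlonglongrightarrow> L"
proof -
  \<comment> \<open>Index 0 is left out: division by zero makes \<open>cbin_scaled 0\<close> equal
    to 0, which would break monotonicity.\<close>
  have "cbin_scaled (Suc (Suc k)) \<le> cbin_scaled (Suc k)" for k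
  proof -
    define m where "m = Suc k"
    have m: "m > 0" by (simp add: m_def)
    define C where "C = real ((2 * m) choose m)"
    have C: "C > 0" by (simp add: C_def)
    have "real ((2 * Suc m) choose Suc m) = C * (2 * (2 * real m + 1) / (real m + 1))"
    proof -
      have "real ((2 * Suc m) choose Suc m) = fact (Suc (Suc (2 * m))) / (fact (Suc m) * fact (Suc m))"
        by (subst binomial_fact) auto
      also have "\<dots> = ((2 * real m + 2) * (2 * real m + 1) / ((real m + 1) * (real m + 1))) * (fact (2 * m) / (fact m * fact m))"
        by (simp add: mult_ac add_ac)
      also have "fact (2 * m) / (fact m * fact m) = C"
        unfolding C_def by (subst binomial_fact) (auto simp: mult_2)
      also have "(2 * real m + 2) * (2 * real m + 1) / ((real m + 1) * (real m + 1)) = 2 * (2 * real m + 1) / (real m + 1)"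
        by (simp add: divide_simps) (simp add: algebra_simps)
      finally show ?thesis by simp
    qed
    then have e: "cbin_scaled (Suc m) = 4 ^ Suc m / (sqrt (real m + 1) * (C * (2 * (2 * real m + 1) / (real m + 1))))"
      by (simp add: cbin_scaled_def add.commute)
    have "sqrt (real m * (real m + 1)) \<le> (real m + (real m + 1)) / 2"
      by (rule arith_geo_mean_sqrt) auto
    then have "2 * (sqrt (real m) * sqrt (real m + 1)) \<le> 2 * real m + 1"
      by (simp add: real_sqrt_mult)
    then have "2 * (sqrt (real m) * sqrt (real m + 1)) * sqrt (real m + 1) \<le> (2 * real m + 1) * sqrt (real m + 1)"
      by (intro mult_right_mono) auto
    then have "2 * sqrt (real m) * (real m + 1) \<le> sqrt (real m + 1) * (2 * real m + 1)"
      by (simp add: mult_ac)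
    then have "2 * (real m + 1) / (sqrt (real m + 1) * (2 * real m + 1)) \<le> 1 / sqrt (real m)"
      using m by (simp add: divide_simps mult_ac)
    then have "4 ^ m / C * (2 * (real m + 1) / (sqrt (real m + 1) * (2 * real m + 1))) \<le> 4 ^ m / C * (1 / sqrt (real m))"
      using C by (intro mult_left_mono) auto
    also have "\<dots> = cbin_scaled m" by (simp add: cbin_scaled_def C_def)
    also have "4 ^ m / C * (2 * (real m + 1) / (sqrt (real m + 1) * (2 * real m + 1))) = cbin_scaled (Suc m)"
    proof -
      define M N where "M = real m + 1" and "N = 2 * real m + 1"
      have "M > 0" "N > 0" by (auto simp: M_def N_def)
      then show ?thesis
        unfolding e M_def[symmetric] N_def[symmetric] using C by (simp add: field_simps)
    qed
    finally show ?thesis by (simp add: m_def)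
  qed
  then have "decseq (\<lambda>k. cbin_scaled (Suc k))" by (intro decseq_SucI)
  moreover have "0 \<le> cbin_scaled (Suc k)" for k by (simp add: cbin_scaled_def)
  ultimately obtain L where "(\<lambda>k. cbin_scaled (Suc k)) \<longlonglongrightarrow> L"
    using decseq_convergent by blast
  then show ?thesis using that by (auto simp: filterlim_sequentially_Suc)
qed

lemma inverse_Suc_tendsto_0: "(\<lambda>k. c / real (Suc k)) \<longlonglongrightarrow> 0"
  using tendsto_mult[OF tendsto_const[of c] LIMSEQ_inverse_real_of_nat]
  by (simp add: divide_inverse)

text \<open>With X = k + 1, the row parameter is (bX)^2 and the offset dX, so offset^2 / parameter
  is constantly (d/b)^2. The two Gaussian bounds, taken with K equal to the offset, differ from it
  by O(1/X) in the denominator.\<close>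

lemma cbin_ratio_tendsto:
  assumes b: "b > 0"
  shows "(\<lambda>k. cbin_ratio ((b * Suc k)\<^sup>2) (d * Suc k)) \<longlonglongrightarrow> exp (- (real d / real b)\<^sup>2)"
proof (rule tendsto_sandwich)
  define X where "X = (\<lambda>k. real (Suc k))"
  have X: "X k > 0" for k by (simp add: X_def)
  have e: "real (d * Suc k) = real d * X k" "real ((b * Suc k)\<^sup>2) = (real b)\<^sup>2 * (X k)\<^sup>2" for k
    by (simp_all add: X_def power_mult_distrib del: of_nat_Suc mult_Suc_right)
  have ev: "\<forall>\<^sub>F k in sequentially. d * Suc k \<le> (b * Suc k)\<^sup>2"
    using eventually_ge_at_top[of d]
  proof eventually_elim
    case (elim k)
    have "d * Suc k \<le> Suc k * Suc k" using elim by (intro mult_right_mono) auto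
    also have "Suc k \<le> b * Suc k" using b by (cases b) auto
    then have "Suc k * Suc k \<le> (b * Suc k) * (b * Suc k)" by (intro mult_mono) auto
    finally show ?case by (simp add: power2_eq_square)
  qed
  show "\<forall>\<^sub>F k in sequentially. cbin_ratio ((b * Suc k)\<^sup>2) (d * Suc k) \<le>
          exp (- (real d)\<^sup>2 / ((real b)\<^sup>2 + real d / real (Suc k)))"
    using ev
  proof eventually_elim
    case (elim k)
    have "cbin_ratio ((b * Suc k)\<^sup>2) (d * Suc k) \<le> exp (- (real (d * Suc k))\<^sup>2 / (real ((b * Suc k)\<^sup>2) + real (d * Suc k)))"
      using elim b by (intro cbin_ratio_le) auto
    also have "- (real (d * Suc k))\<^sup>2 / (real ((b * Suc k)\<^sup>2) + real (d * Suc k)) =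
               - ((real d)\<^sup>2 * (X k)\<^sup>2) / (((real b)\<^sup>2 + real d / X k) * (X k)\<^sup>2)"
      unfolding e using X[of k]
      by (simp add: power_mult_distrib distrib_right power2_eq_square)
    also have "\<dots> = - (real d)\<^sup>2 / ((real b)\<^sup>2 + real d / X k)"
      using X[of k] by simp
    finally show ?case by (simp only: X_def)
  qed
  show "\<forall>\<^sub>F k in sequentially. exp (- (real d)\<^sup>2 / ((real b)\<^sup>2 - real d / real (Suc k) + 1 / real (Suc k) * (1 / real (Suc k)))) \<le>
          cbin_ratio ((b * Suc k)\<^sup>2) (d * Suc k)"
    using ev
  proof eventually_elim
    case (elim k)
    have "exp (- (real (d * Suc k))\<^sup>2 / (real ((b * Suc k)\<^sup>2) - real (d * Suc k) + 1)) \<le> cbin_ratio ((b * Suc k)\<^sup>2) (d * Suc k)"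
      using elim b by (intro cbin_ratio_ge) auto
    also have "- (real (d * Suc k))\<^sup>2 / (real ((b * Suc k)\<^sup>2) - real (d * Suc k) + 1) =
               - ((real d)\<^sup>2 * (X k)\<^sup>2) / (((real b)\<^sup>2 - real d / X k + 1 / X k * (1 / X k)) * (X k)\<^sup>2)"
      unfolding e using X[of k]
      by (simp add: power_mult_distrib distrib_right left_diff_distrib power2_eq_square)
    also have "\<dots> = - (real d)\<^sup>2 / ((real b)\<^sup>2 - real d / X k + 1 / X k * (1 / X k))"
      using X[of k] by simp
    finally show ?case by (simp only: X_def)
  qed
  have "(\<lambda>k. exp (- (real d)\<^sup>2 / ((real b)\<^sup>2 + real d / real (Suc k)))) \<longlonglongrightarrow> exp (- (real d)\<^sup>2 / ((real b)\<^sup>2 + 0))"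
    using b by (intro tendsto_intros inverse_Suc_tendsto_0) auto
  then show "(\<lambda>k. exp (- (real d)\<^sup>2 / ((real b)\<^sup>2 + real d / real (Suc k)))) \<longlonglongrightarrow> exp (- (real d / real b)\<^sup>2)"
    by (simp add: power_divide)
  have "(\<lambda>k. exp (- (real d)\<^sup>2 / ((real b)\<^sup>2 - real d / real (Suc k) + 1 / real (Suc k) * (1 / real (Suc k))))) \<longlonglongrightarrow>
      exp (- (real d)\<^sup>2 / ((real b)\<^sup>2 - 0 + 0 * 0))"
    using b by (intro tendsto_intros inverse_Suc_tendsto_0) auto
  then show "(\<lambda>k. exp (- (real d)\<^sup>2 / ((real b)\<^sup>2 - real d / real (Suc k) + 1 / real (Suc k) * (1 / real (Suc k))))) \<longlonglongrightarrow> exp (- (real d / real b)\<^sup>2)"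
    by (simp add: power_divide)
qed

lemma cos_square_power_le: "(cos y)\<^sup>2 ^ m \<le> exp (- (real m * (sin y)\<^sup>2))" for y :: real
proof -
  have "(cos y)\<^sup>2 = 1 + - (sin y)\<^sup>2" by (simp add: cos_squared_eq)
  also have "\<dots> \<le> exp (- (sin y)\<^sup>2)" by (rule exp_ge_add_one_self)
  finally have "(cos y)\<^sup>2 ^ m \<le> exp (- (sin y)\<^sup>2) ^ m" by (intro power_mono) auto
  then show ?thesis by (simp flip: exp_of_nat_mult)
qed

lemma cos_square_power_ge:
  fixes y :: real
  assumes "cos y \<noteq> 0"
  shows "exp (- (real m * (sin y)\<^sup>2 / (cos y)\<^sup>2)) \<le> (cos y)\<^sup>2 ^ m"
proof -
  have "1 / (cos y)\<^sup>2 = 1 + (sin y)\<^sup>2 / (cos y)\<^sup>2"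
    using assms by (simp add: field_simps)
  also have "\<dots> \<le> exp ((sin y)\<^sup>2 / (cos y)\<^sup>2)" by (rule exp_ge_add_one_self)
  finally have "exp (- ((sin y)\<^sup>2 / (cos y)\<^sup>2)) \<le> (cos y)\<^sup>2"
    using assms by (simp add: exp_minus field_simps)
  then have "exp (- ((sin y)\<^sup>2 / (cos y)\<^sup>2)) ^ m \<le> (cos y)\<^sup>2 ^ m" by (intro power_mono) auto
  then show ?thesis by (simp flip: exp_of_nat_mult)
qed

lemma cos_square_power_tendsto:
  fixes c :: real
  assumes c: "c > 0"
  shows "(\<lambda>k. (cos (c / real (Suc k)))\<^sup>2 ^ ((b * Suc k)\<^sup>2)) \<longlonglongrightarrow> exp (- (real b * c)\<^sup>2)"
proof (rule tendsto_sandwich)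
  define y where "y = (\<lambda>k. c / real (Suc k))"
  have y0: "y \<longlonglongrightarrow> 0" unfolding y_def by (rule inverse_Suc_tendsto_0)
  have yne: "y k \<noteq> 0" for k using c by (simp add: y_def)
  have "((\<lambda>h::real. (sin (0 + h) - sin 0) / h) \<longlongrightarrow> cos 0) (at 0)"
    using DERIV_sin[of 0] unfolding DERIV_def .
  then have "((\<lambda>h::real. sin h / h) \<longlongrightarrow> 1) (at 0)" by simp
  moreover have "filterlim y (at 0) sequentially"
    using y0 yne by (auto simp: filterlim_at)
  ultimately have s: "(\<lambda>k. sin (y k) / y k) \<longlonglongrightarrow> 1"
    by (rule filterlim_compose)
  have eq: "real ((b * Suc k)\<^sup>2) * (sin (y k))\<^sup>2 = (real b * c)\<^sup>2 * (sin (y k) / y k)\<^sup>2" for k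
  proof -
    have "real (b * Suc k) = real b * c / y k" using c by (simp add: y_def del: of_nat_Suc mult_Suc_right)
    then have "real ((b * Suc k)\<^sup>2) = (real b * c / y k)\<^sup>2"
      by (simp only: of_nat_power)
    then show ?thesis
      by (simp only: power_divide power_mult_distrib) simp
  qed
  show "\<forall>\<^sub>F k in sequentially. (cos (c / real (Suc k)))\<^sup>2 ^ ((b * Suc k)\<^sup>2) \<le> exp (- ((real b * c)\<^sup>2 * (sin (y k) / y k)\<^sup>2))"
    unfolding eq[symmetric] by (intro always_eventually allI) (simp only: y_def cos_square_power_le)
  have cy: "(\<lambda>k. cos (y k)) \<longlonglongrightarrow> cos 0" by (intro tendsto_intros y0)
  then have "\<forall>\<^sub>F k in sequentially. cos (y k) \<noteq> 0"
    by (rule tendsto_imp_eventually_ne) auto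
  then show "\<forall>\<^sub>F k in sequentially. exp (- ((real b * c)\<^sup>2 * (sin (y k) / y k)\<^sup>2 / (cos (y k))\<^sup>2)) \<le> (cos (c / real (Suc k)))\<^sup>2 ^ ((b * Suc k)\<^sup>2)"
  proof eventually_elim
    case (elim k)
    show ?case unfolding eq[symmetric] using cos_square_power_ge[OF elim, of "(b * Suc k)\<^sup>2"]
      by (simp only: y_def)
  qed
  have "(\<lambda>k. exp (- ((real b * c)\<^sup>2 * (sin (y k) / y k)\<^sup>2))) \<longlonglongrightarrow> exp (- ((real b * c)\<^sup>2 * 1\<^sup>2))"
    by (intro tendsto_intros s)
  then show "(\<lambda>k. exp (- ((real b * c)\<^sup>2 * (sin (y k) / y k)\<^sup>2))) \<longlonglongrightarrow> exp (- (real b * c)\<^sup>2)" by simp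
  have "(\<lambda>k. exp (- ((real b * c)\<^sup>2 * (sin (y k) / y k)\<^sup>2 / (cos (y k))\<^sup>2))) \<longlonglongrightarrow> exp (- ((real b * c)\<^sup>2 * 1\<^sup>2 / (cos 0)\<^sup>2))"
    by (intro tendsto_intros s cy) auto
  then show "(\<lambda>k. exp (- ((real b * c)\<^sup>2 * (sin (y k) / y k)\<^sup>2 / (cos (y k))\<^sup>2))) \<longlonglongrightarrow> exp (- (real b * c)\<^sup>2)" by simp
qed

section \<open>Passage to the limit in the finite identity\<close>

text \<open>For Tannery's theorem: a nonzero summand has offset K at most m, so m + K <= 2m and
  \<open>cbin_ratio_le\<close> gives exp(-K^2/(2m)), whose exponent is independent of k. The finite
  sums contain every nonzero term, so they equal the infinite sums of the same terms.\<close>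

lemma theta_side_tendsto:
  assumes a: "a > 0" and b: "b > 0"
  defines "q \<equiv> exp (- (2 * real a / real b)\<^sup>2)"
  shows "(\<lambda>k. \<Sum>i<(b * Suc k)\<^sup>2. (-1) ^ Suc i * cbin_ratio ((b * Suc k)\<^sup>2) (2 * (a * Suc k) * Suc i))
           \<longlonglongrightarrow> (\<Sum>i. (-1) ^ Suc i * q ^ (Suc i)\<^sup>2)"
proof -
  define m where "m = (\<lambda>k. (b * Suc k)\<^sup>2)"
  define f where "f = (\<lambda>i k. (-1) ^ Suc i * cbin_ratio (m k) (2 * (a * Suc k) * Suc i))"
  have "(\<lambda>k. \<Sum>i. f i k) \<longlonglongrightarrow> (\<Sum>i. (-1) ^ Suc i * q ^ (Suc i)\<^sup>2)"
  proof (rule tannerys_theorem[THEN conjunct2, THEN conjunct2])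
    fix i
    have "(\<lambda>k. (-1) ^ Suc i * cbin_ratio (m k) ((2 * a * Suc i) * Suc k)) \<longlonglongrightarrow> (-1) ^ Suc i * exp (- (real (2 * a * Suc i) / real b)\<^sup>2)"
      unfolding m_def by (intro tendsto_intros cbin_ratio_tendsto b)
    also have "exp (- (real (2 * a * Suc i) / real b)\<^sup>2) = q ^ (Suc i)\<^sup>2"
      unfolding q_def exp_of_nat_mult[symmetric] by (simp add: power_divide power_mult_distrib del: of_nat_Suc mult_Suc_right)
    also have "(\<lambda>k. (-1) ^ Suc i * cbin_ratio (m k) ((2 * a * Suc i) * Suc k)) = (\<lambda>k. f i k)"
      unfolding f_def by (simp only: mult_ac)
    finally show "(\<lambda>k. f i k) \<longlonglongrightarrow> (-1) ^ Suc i * q ^ (Suc i)\<^sup>2" .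
  next
    define x where "x = exp (- ((2 * real a / real b)\<^sup>2 / 2))"
    have "norm (f i k) \<le> x ^ Suc i" for i k
    proof (cases "2 * (a * Suc k) * Suc i \<le> m k")
      case False
      then show ?thesis by (simp add: f_def cbin_ratio_eq_0 x_def)
    next
      case True
      define K where "K = 2 * (a * Suc k) * Suc i"
      have "m k > 0" using b by (simp add: m_def)
      have e: "real K = 2 * real a * real (Suc k) * real (Suc i)" "real (m k) = (real b)\<^sup>2 * (real (Suc k))\<^sup>2"
        unfolding K_def m_def of_nat_mult of_nat_power by (simp_all only: power_mult_distrib of_nat_numeral mult_ac)
      have "norm (f i k) = cbin_ratio (m k) K"
        by (simp add: f_def abs_mult cbin_ratio_nonneg K_def)
      also have "\<dots> \<le> exp (- (real K)\<^sup>2 / (real (m k) + real K))"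
        using True b \<open>m k > 0\<close> by (intro cbin_ratio_le) (auto simp: K_def)
      also have "\<dots> \<le> exp (- ((real K)\<^sup>2 / (2 * real (m k))))"
        using True \<open>m k > 0\<close> unfolding K_def[symmetric] by (auto intro!: divide_left_mono mult_pos_pos)
      also have "(real K)\<^sup>2 / (2 * real (m k)) = (2 * real a / real b)\<^sup>2 / 2 * (real (Suc i))\<^sup>2"
        unfolding e using b by (simp add: power_mult_distrib power_divide del: of_nat_Suc)
      also have "exp (- \<dots>) \<le> exp (- ((2 * real a / real b)\<^sup>2 / 2 * real (Suc i)))"
        using self_le_power[of "real (Suc i)" 2] by (auto intro!: mult_left_mono simp del: of_nat_Suc)
      also have "\<dots> = x ^ Suc i"
        unfolding x_def exp_of_nat_mult[symmetric] by (simp del: of_nat_Suc mult_Suc_right)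
      finally show ?thesis .
    qed
    then show "\<forall>\<^sub>F (i, k) in at_top \<times>\<^sub>F sequentially. norm (f i k) \<le> x ^ Suc i"
      by (intro always_eventually) auto
    have "x < 1" using a b by (simp add: x_def)
    then show "summable (\<lambda>i. x ^ Suc i)"
      by (subst summable_Suc_iff) (auto simp: x_def summable_geometric)
  qed auto
  also have "(\<lambda>k. \<Sum>i. f i k) = (\<lambda>k. \<Sum>i<m k. f i k)"
  proof
    fix k
    show "(\<Sum>i. f i k) = (\<Sum>i<m k. f i k)"
    proof (rule suminf_finite)
      fix i assume "i \<notin> {..<m k}"
      then have "m k < Suc i" by auto
      also have "Suc i \<le> 2 * (a * Suc k) * Suc i" using a by (cases a) auto
      finally show "f i k = 0" by (simp add: f_def cbin_ratio_eq_0 del: mult_Suc_right)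
    qed auto
  qed
  finally show ?thesis by (simp only: f_def m_def)
qed

text \<open>Since the angles lie in [0, pi/2], Jordan's inequality bounds each sine below by
  (2j+1)/(2h). As m/h^2 = (b/a)^2 is constant along the sequence, the resulting Gaussian majorant
  does not depend on k.\<close>

lemma dual_side_tendsto:
  assumes a: "a > 0" and b: "b > 0"
  shows "(\<lambda>k. \<Sum>j<a * Suc k. (cos (pi * (2 * real j + 1) / (4 * real (a * Suc k))))\<^sup>2 ^ ((b * Suc k)\<^sup>2))
           \<longlonglongrightarrow> (\<Sum>j. exp (- (real b * (pi * (2 * real j + 1) / (4 * real a)))\<^sup>2))"
proof -
  define m where "m = (\<lambda>k. (b * Suc k)\<^sup>2)"
  define g where "g = (\<lambda>j k. (cos (pi * (2 * real j + 1) / (4 * real (a * Suc k))))\<^sup>2 ^ m k)"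
  define f where "f = (\<lambda>j k. if j < a * Suc k then g j k else 0)"
  have "(\<lambda>k. \<Sum>j. f j k) \<longlonglongrightarrow> (\<Sum>j. exp (- (real b * (pi * (2 * real j + 1) / (4 * real a)))\<^sup>2))"
  proof (rule tannerys_theorem[THEN conjunct2, THEN conjunct2])
    fix j
    have "(\<lambda>k. (cos (pi * (2 * real j + 1) / (4 * real a) / real (Suc k)))\<^sup>2 ^ m k)
             \<longlonglongrightarrow> exp (- (real b * (pi * (2 * real j + 1) / (4 * real a)))\<^sup>2)"
      unfolding m_def using a by (intro cos_square_power_tendsto divide_pos_pos mult_pos_pos) auto
    moreover have "\<forall>\<^sub>F k in sequentially. (cos (pi * (2 * real j + 1) / (4 * real a) / real (Suc k)))\<^sup>2 ^ m k = f j k"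
      using eventually_ge_at_top[of j]
    proof eventually_elim
      case (elim k)
      have "j < 1 * Suc k" using elim by simp
      also have "\<dots> \<le> a * Suc k" using a by (intro mult_right_mono) auto
      finally show ?case by (simp add: f_def g_def mult.assoc del: of_nat_Suc mult_Suc_right)
    qed
    ultimately show "(\<lambda>k. f j k) \<longlonglongrightarrow> exp (- (real b * (pi * (2 * real j + 1) / (4 * real a)))\<^sup>2)"
      by (rule Lim_transform_eventually)
  next
    define x where "x = exp (- (real b / (2 * real a))\<^sup>2)"
    have "norm (f j k) \<le> x ^ j" for j k
    proof (cases "j < a * Suc k")
      case False
      then show ?thesis by (simp add: f_def x_def)
    next
      case True
      define h where "h = a * Suc k"
      define y where "y = pi * (2 * real j + 1) / (4 * real h)"
      have h: "h > 0" using a by (simp add: h_def)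
      have "real (2 * j + 1) \<le> real (2 * h)"
        using True unfolding h_def[symmetric] of_nat_le_iff by linarith
      then have y: "0 \<le> y" "y \<le> pi / 2"
        using h mult_left_mono[of "2 * real j + 1" "2 * real h" "pi"] by (auto simp: y_def field_simps)
      have "2 * y / pi = (2 * real j + 1) / (2 * real h)"
        using h by (simp add: y_def field_simps)
      then have s: "(2 * real j + 1) / (2 * real h) \<le> sin y"
        using jordan_inequality[OF y] by simp
      have "norm (f j k) = (cos y)\<^sup>2 ^ m k"
        using True by (simp add: f_def g_def y_def h_def)
      also have "\<dots> \<le> exp (- (real (m k) * (sin y)\<^sup>2))"
        by (rule cos_square_power_le)
      also have "\<dots> \<le> exp (- (real (m k) * ((2 * real j + 1) / (2 * real h))\<^sup>2))"
        using s h by (auto intro!: mult_left_mono power_mono)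
      also have "real (m k) * ((2 * real j + 1) / (2 * real h))\<^sup>2 = (real b / (2 * real a))\<^sup>2 * (2 * real j + 1)\<^sup>2"
        using a by (simp add: m_def h_def power_mult_distrib power_divide field_simps del: of_nat_Suc mult_Suc_right)
      also have "exp (- \<dots>) \<le> exp (- ((real b / (2 * real a))\<^sup>2 * real j))"
        using self_le_power[of "2 * real j + 1" 2] by (auto intro!: mult_left_mono simp del: of_nat_Suc mult_Suc_right)
      also have "\<dots> = x ^ j"
        unfolding x_def exp_of_nat_mult[symmetric] by (simp del: of_nat_Suc mult_Suc_right)
      finally show ?thesis .
    qed
    then show "\<forall>\<^sub>F (j, k) in at_top \<times>\<^sub>F sequentially. norm (f j k) \<le> x ^ j"
      by (intro always_eventually) auto
    have "x < 1" using a b by (simp add: x_def)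
    then show "summable (\<lambda>i. x ^ i)"
      by (auto simp: x_def summable_geometric)
  qed auto
  also have "(\<lambda>k. \<Sum>j. f j k) = (\<lambda>k. \<Sum>j<a * Suc k. g j k)"
  proof
    fix k
    have "(\<Sum>j. f j k) = (\<Sum>j<a * Suc k. f j k)"
      by (rule suminf_finite) (auto simp: f_def)
    then show "(\<Sum>j. f j k) = (\<Sum>j<a * Suc k. g j k)" by (simp add: f_def)
  qed
  finally show ?thesis by (simp only: g_def m_def)
qed

text \<open>The node count h = aX and sqrt m = bX must both be integers with fixed ratio, which is
  why the argument is the square of a rational here. The constant is the limit of
  \<open>cbin_scaled\<close> along squares, hence the same for all a and b.\<close>

lemma theta_inversion_rational:
  obtains L :: real where "L > 0"
    "\<And>a b :: nat. a > 0 \<Longrightarrow> b > 0 \<Longrightarrow>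
       real a / real b * (1 / over_gf (exp (- (2 * real a / real b)\<^sup>2))) =
         L * (\<Sum>j. exp (- (real b * (pi * (2 * real j + 1) / (4 * real a)))\<^sup>2))"
proof -
  obtain L where L: "cbin_scaled \<longlonglongrightarrow> L" using cbin_scaled_tendsto .
  have main: "real a / real b * (1 / over_gf (exp (- (2 * real a / real b)\<^sup>2))) =
         L * (\<Sum>j. exp (- (real b * (pi * (2 * real j + 1) / (4 * real a)))\<^sup>2))"
    if a: "a > 0" and b: "b > 0" for a b :: nat
  proof -
    define q where "q = exp (- (2 * real a / real b)\<^sup>2)"
    have q: "norm q < 1" "q > 0" using a b by (auto simp: q_def)
    define S where "S = (\<lambda>k. \<Sum>i<(b * Suc k)\<^sup>2. (-1) ^ Suc i * cbin_ratio ((b * Suc k)\<^sup>2) (2 * (a * Suc k) * Suc i))"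
    define Z where "Z = (\<lambda>k. \<Sum>j<a * Suc k. (cos (pi * (2 * real j + 1) / (4 * real (a * Suc k))))\<^sup>2 ^ ((b * Suc k)\<^sup>2))"
    have S: "S \<longlonglongrightarrow> (\<Sum>i. (-1) ^ Suc i * q ^ (Suc i)\<^sup>2)"
      unfolding S_def q_def using theta_side_tendsto[OF a b] .
    have Z: "Z \<longlonglongrightarrow> (\<Sum>j. exp (- (real b * (pi * (2 * real j + 1) / (4 * real a)))\<^sup>2))"
      unfolding Z_def using dual_side_tendsto[OF a b] .
    have "summable (\<lambda>i. (-1) ^ Suc i * q ^ (Suc i)\<^sup>2)"
    proof (rule summable_comparison_test')
      show "summable (\<lambda>i. q ^ i)" using q by (intro summable_geometric)
      have "q ^ (Suc n)\<^sup>2 \<le> q ^ n" for n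
        using q by (intro power_decreasing) (auto simp: power2_eq_square)
      then show "norm ((-1) ^ Suc n * q ^ (Suc n)\<^sup>2) \<le> q ^ n" for n
        using q by (simp add: abs_mult)
    qed
    then have "(\<lambda>n. 1 + 2 * (\<Sum>s<n. (-1) ^ Suc s * q ^ (Suc s)\<^sup>2)) \<longlonglongrightarrow> 1 + 2 * (\<Sum>i. (-1) ^ Suc i * q ^ (Suc i)\<^sup>2)"
      by (intro tendsto_intros summable_LIMSEQ)
    then have th: "1 + 2 * (\<Sum>i. (-1) ^ Suc i * q ^ (Suc i)\<^sup>2) = 1 / over_gf q"
      using gauss_identity[OF q(1)] LIMSEQ_unique by blast
    have id: "real a / real b * (1 + 2 * S k) = cbin_scaled ((b * Suc k)\<^sup>2) * Z k" for k
    proof -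
      define C where "C = real ((2 * (b * Suc k)\<^sup>2) choose ((b * Suc k)\<^sup>2))"
      have "real (a * Suc k) * (1 + 2 * S k) = 4 ^ ((b * Suc k)\<^sup>2) / C * Z k"
        unfolding S_def Z_def C_def using a b by (intro finite_theta_identity) auto
      then have "real (a * Suc k) * (1 + 2 * S k) / real (b * Suc k) = 4 ^ ((b * Suc k)\<^sup>2) / C * Z k / real (b * Suc k)"
        by simp
      moreover have "real (a * Suc k) * (1 + 2 * S k) / real (b * Suc k) = real a / real b * (1 + 2 * S k)"
        by (simp del: of_nat_Suc mult_Suc_right)
      moreover have "sqrt (real ((b * Suc k)\<^sup>2)) = real (b * Suc k)"
        by (simp del: of_nat_Suc of_nat_mult mult_Suc_right)
      ultimately show ?thesis
        unfolding cbin_scaled_def C_def[symmetric] by (simp del: of_nat_Suc of_nat_mult mult_Suc_right add: mult_ac)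
    qed
    have "filterlim (\<lambda>k. (b * Suc k)\<^sup>2) at_top sequentially"
    proof (rule filterlim_at_top_mono[OF filterlim_ident always_eventually], rule allI)
      fix k
      have "k \<le> b * Suc k" using b by (cases b) auto
      also have "\<dots> \<le> (b * Suc k)\<^sup>2" by (simp add: power2_eq_square)
      finally show "k \<le> (b * Suc k)\<^sup>2" .
    qed
    then have "(\<lambda>k. cbin_scaled ((b * Suc k)\<^sup>2)) \<longlonglongrightarrow> L"
      using L by (rule filterlim_compose[rotated])
    then have "(\<lambda>k. cbin_scaled ((b * Suc k)\<^sup>2) * Z k) \<longlonglongrightarrow> L * (\<Sum>j. exp (- (real b * (pi * (2 * real j + 1) / (4 * real a)))\<^sup>2))"
      by (intro tendsto_mult Z)
    moreover have "(\<lambda>k. real a / real b * (1 + 2 * S k)) \<longlonglongrightarrow> real a / real b * (1 + 2 * (\<Sum>i. (-1) ^ Suc i * q ^ (Suc i)\<^sup>2))"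
      by (intro tendsto_intros S)
    ultimately show ?thesis
      unfolding id th q_def[symmetric] using LIMSEQ_unique by blast
  qed
  have "L \<ge> 0"
    by (rule LIMSEQ_le_const[OF L]) (auto simp: cbin_scaled_def)
  \<comment> \<open>Positivity comes from the identity itself: L = 0 would make
    \<open>1 / over_gf (exp (- 4))\<close> vanish, while \<open>over_gf\<close> is at least 1
    there.\<close>
  moreover have "L \<noteq> 0"
    using main[of 1 1] over_gf_real_ge_1[of "exp (- 4 :: real)"] by auto
  ultimately show ?thesis using that[OF _ main] by simp
qed

section \<open>Analytic continuation of the inversion formula\<close>

text \<open>Triangular numbers enter through (2j+1)^2 = 1 + 8 \<open>tri j\<close>, which factors
  the dual theta series as its leading exponential times a power series with constant term
  1.\<close>

definition tri :: "nat \<Rightarrow> nat" where "tri j = j * (j + 1) div 2"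

lemma tri_Suc: "tri (Suc j) = tri j + Suc j"
proof -
  have "Suc j * (Suc j + 1) = j * (j + 1) + 2 * Suc j" by simp
  then show ?thesis unfolding tri_def by (simp only:) simp
qed

lemma tri_0 [simp]: "tri 0 = 0"
  by (simp add: tri_def)

lemma strict_mono_tri: "strict_mono tri"
  by (rule strict_monoI_Suc) (simp add: tri_Suc)

lemma le_tri: "j \<le> tri j"
  by (induction j) (auto simp: tri_Suc)

lemma square_odd_tri: "(2 * real j + 1)\<^sup>2 = 1 + 8 * real (tri j)"
  by (induction j) (auto simp: tri_Suc power2_eq_square algebra_simps)

definition tri_gf :: "complex \<Rightarrow> complex" where
  "tri_gf x = (\<Sum>j. x ^ tri j)"

lemma summable_norm_tri:
  assumes "norm (x :: complex) < 1"
  shows "summable (\<lambda>j. norm (x ^ tri j))"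
proof (rule summable_comparison_test')
  show "summable (\<lambda>j. norm x ^ j)" using assms by (intro summable_geometric) auto
  show "norm (norm (x ^ tri n)) \<le> norm x ^ n" for n
    using assms by (auto simp: norm_power intro!: power_decreasing le_tri)
qed

lemma norm_tri_gf_minus_1:
  assumes "norm x < 1"
  shows "norm (tri_gf x - 1) \<le> norm x / (1 - norm x)"
proof -
  have s: "summable (\<lambda>j. norm (x ^ tri j))" by (rule summable_norm_tri[OF assms])
  have "tri_gf x = 1 + (\<Sum>j. x ^ tri (Suc j))"
    unfolding tri_gf_def using suminf_split_head[OF summable_norm_cancel[OF s]] by simp
  then have "norm (tri_gf x - 1) = norm (\<Sum>j. x ^ tri (Suc j))" by simp
  also have "\<dots> \<le> (\<Sum>j. norm (x ^ tri (Suc j)))"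
    using s by (intro summable_norm) (subst summable_Suc_iff)
  also have "\<dots> \<le> (\<Sum>j. norm x * norm x ^ j)"
  proof (rule suminf_le)
    show "norm (x ^ tri (Suc n)) \<le> norm x * norm x ^ n" for n
      unfolding norm_power power_Suc[symmetric] using assms
      by (intro power_decreasing le_tri) auto
    show "summable (\<lambda>j. norm (x ^ tri (Suc j)))" using s by (subst summable_Suc_iff)
    show "summable (\<lambda>j. norm x * norm x ^ j)" using assms by (intro summable_mult summable_geometric) auto
  qed
  also have "\<dots> = norm x / (1 - norm x)"
    using assms by (simp add: suminf_mult suminf_geometric summable_geometric)
  finally show ?thesis .
qed

lemma tri_gf_holomorphic: "tri_gf holomorphic_on ball 0 1"
proof (rule power_series_holomorphic)
  fix w :: complex assume "w \<in> ball 0 1"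
  then have "norm w < 1" by simp
  have "(\<lambda>j. w ^ tri j) sums tri_gf w"
    unfolding tri_gf_def by (rule summable_sums[OF summable_norm_cancel[OF summable_norm_tri[OF \<open>norm w < 1\<close>]]])
  then have "(\<lambda>j. (if tri j \<in> range tri then 1 else 0) * w ^ tri j) sums tri_gf w" by simp
  then show "(\<lambda>n. (if n \<in> range tri then 1 else 0) * (w - 0) ^ n) sums tri_gf w"
    by (subst (asm) sums_mono_reindex[OF strict_mono_tri]) auto
qed

lemma over_gf_holomorphic: "(over_gf :: complex \<Rightarrow> complex) holomorphic_on ball 0 1"
proof (rule power_series_holomorphic)
  fix w :: complex assume "w \<in> ball 0 1"
  then show "(\<lambda>n. of_nat (overp n) * (w - 0) ^ n) sums over_gf w"
    using overp_summable(2)[of w] by (simp add: over_gf_def summable_sums)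
qed

lemma over_gf_of_real:
  assumes "norm (r :: real) < 1"
  shows "over_gf (complex_of_real r) = of_real (over_gf r)"
proof -
  have "(\<lambda>n. of_real (real (overp n) * r ^ n)) sums complex_of_real (over_gf r)"
    unfolding over_gf_def of_nat_id
    by (intro sums_of_real summable_sums) (use overp_summable(2)[OF assms] in simp)
  then show ?thesis by (simp add: over_gf_def sums_iff)
qed

lemma Re_inverse_pos: "Re t > 0 \<Longrightarrow> Re (of_real c / t) = c * Re t / (norm t)\<^sup>2"
  by (simp add: Re_divide cmod_power2)

text \<open>Both sides are holomorphic on the right half-plane and agree on a set with an
  accumulation point there. Stating the formula as a product equal to 1 avoids presupposing that
  \<open>tri_gf\<close> has no zeros.\<close>

lemma theta_inversion:
  obtains L :: real where "L > 0"
    "\<And>t. Re t > 0 \<Longrightarrow>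
       over_gf (exp (- t)) * (2 * of_real L / csqrt t) * exp (- (of_real (pi\<^sup>2 / 4) / t)) *
         tri_gf (exp (- 8 * (of_real (pi\<^sup>2 / 4) / t))) = 1"
proof -
  obtain L :: real where L: "L > 0" and inv: "\<And>a b :: nat. a > 0 \<Longrightarrow> b > 0 \<Longrightarrow>
       real a / real b * (1 / over_gf (exp (- (2 * real a / real b)\<^sup>2))) =
         L * (\<Sum>j. exp (- (real b * (pi * (2 * real j + 1) / (4 * real a)))\<^sup>2))"
    using theta_inversion_rational by metis
  define F where "F = (\<lambda>t. over_gf (exp (- t)) * (2 * of_real L / csqrt t) * exp (- (of_real (pi\<^sup>2 / 4) / t)) *
         tri_gf (exp (- 8 * (of_real (pi\<^sup>2 / 4) / t))) - 1)"
  define S where "S = {t. Re t > 0}"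
  have nz: "t \<noteq> 0" "t \<notin> \<real>\<^sub>\<le>\<^sub>0" if "t \<in> S" for t
    using that by (auto simp: S_def complex_nonpos_Reals_iff)
  have g1: "(\<lambda>t. over_gf (exp (- t)) :: complex) holomorphic_on S"
    by (rule holomorphic_on_compose_gen[OF _ over_gf_holomorphic, unfolded o_def])
       (auto intro!: holomorphic_intros simp: S_def norm_exp_eq_Re)
  have g2: "(\<lambda>t. tri_gf (exp (- 8 * (of_real (pi\<^sup>2 / 4) / t)))) holomorphic_on S"
  proof (rule holomorphic_on_compose_gen[OF _ tri_gf_holomorphic, unfolded o_def])
    show "(\<lambda>t. exp (- 8 * (of_real (pi\<^sup>2 / 4) / t))) holomorphic_on S"
      using nz by (auto intro!: holomorphic_intros)
    show "(\<lambda>t. exp (- 8 * (of_real (pi\<^sup>2 / 4) / t))) ` S \<subseteq> ball 0 1"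
    proof safe
      fix t assume "t \<in> S"
      then have "Re (of_real (pi\<^sup>2 / 4) / t) > 0"
        using nz[of t] by (subst Re_inverse_pos) (auto simp: S_def)
      moreover have "Re (- 8 * z) = - 8 * Re z" for z by simp
      ultimately have "Re (- 8 * (of_real (pi\<^sup>2 / 4) / t)) < 0" by (simp only:)
      then show "exp (- 8 * (of_real (pi\<^sup>2 / 4) / t)) \<in> ball 0 1"
        by (simp only: mem_ball_0 norm_exp_eq_Re exp_less_one_iff)
    qed
  qed
  have hol: "F holomorphic_on S"
    unfolding F_def by (intro holomorphic_intros g1 g2) (use nz in auto)
  \<comment> \<open>The choice a = n + 2, b = n + 1 gives points different from their limit 4, and 4
    is interior to the half-plane.\<close>
  define u where "u = (\<lambda>n. (2 * real (Suc (Suc n)) / real (Suc n))\<^sup>2)"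
  have Fu: "F (of_real (u n)) = 0" for n
  proof -
    define a b where "a = Suc (Suc n)" and "b = Suc n"
    define s where "s = 2 * real a / real b"
    have s: "s > 0" "u n = s\<^sup>2" by (auto simp: s_def a_def b_def u_def)
    define y where "y = pi\<^sup>2 / 4 / s\<^sup>2"
    have y: "y > 0" using s by (simp add: y_def)
    have e: "- (real b * (pi * (2 * real j + 1) / (4 * real a)))\<^sup>2 = - y + real (tri j) * (- 8 * y)" for j
    proof -
      have "real b * (pi * (2 * real j + 1) / (4 * real a)) = (2 * real j + 1) * (pi / 2 / s)"
        by (simp add: s_def a_def b_def)
      then have "(real b * (pi * (2 * real j + 1) / (4 * real a)))\<^sup>2 = (1 + 8 * real (tri j)) * y"
        by (simp add: power_mult_distrib square_odd_tri y_def power_divide)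
      then show ?thesis by (simp add: algebra_simps)
    qed
    have sm: "summable (\<lambda>j. norm (complex_of_real (exp (- 8 * y)) ^ tri j))"
      by (rule summable_norm_tri) (use y in simp)
    have S: "(\<lambda>j. complex_of_real (exp (- 8 * y) ^ tri j)) sums tri_gf (of_real (exp (- 8 * y)))"
      unfolding tri_gf_def of_real_power by (rule summable_sums[OF summable_norm_cancel[OF sm]])
    from sums_Im[OF S] have im: "tri_gf (of_real (exp (- 8 * y))) \<in> \<real>"
      unfolding Im_complex_of_real complex_is_Real_iff by (rule sums_unique2[OF _ sums_zero])
    from sums_Re[OF S] have "(\<lambda>j. exp (- 8 * y) ^ tri j) sums Re (tri_gf (of_real (exp (- 8 * y))))"
      by (simp only: Re_complex_of_real)
    then have T: "(\<Sum>j. exp (- 8 * y) ^ tri j) = Re (tri_gf (of_real (exp (- 8 * y))))"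
      and sm': "summable (\<lambda>j. exp (- 8 * y) ^ tri j)"
      by (auto simp: sums_iff)
    have "s / 2 * (1 / over_gf (exp (- s\<^sup>2))) = L * (\<Sum>j. exp (- y) * exp (- 8 * y) ^ tri j)"
      using inv[of a b] unfolding e exp_add exp_of_nat_mult s_def[symmetric]
      by (simp add: s_def a_def b_def del: of_nat_Suc)
    also have "\<dots> = L * (exp (- y) * Re (tri_gf (of_real (exp (- 8 * y)))))"
      using suminf_mult[OF sm'] T by simp
    finally have *: "over_gf (exp (- s\<^sup>2)) * (2 * L / s) * exp (- y) * Re (tri_gf (of_real (exp (- 8 * y)))) = 1"
      using s over_gf_nonzero[of "exp (- s\<^sup>2)"] by (simp add: field_simps)
    have "csqrt (of_real (u n)) = of_real s"
      unfolding s(2) using s(1) csqrt_of_real_nonneg[of "s\<^sup>2"] by simp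
    moreover have "of_real (pi\<^sup>2 / 4) / complex_of_real (u n) = of_real y"
      by (simp add: y_def s(2))
    moreover have "exp (- complex_of_real (u n)) = of_real (exp (- s\<^sup>2))"
      by (simp add: s(2) exp_of_real[symmetric])
    moreover have "over_gf (complex_of_real (exp (- s\<^sup>2))) = of_real (over_gf (exp (- s\<^sup>2)))"
      using s by (intro over_gf_of_real) auto
    moreover have "tri_gf (exp (- 8 * complex_of_real y)) = of_real (Re (tri_gf (of_real (exp (- 8 * y)))))"
      using im by (simp add: exp_of_real[symmetric])
    moreover have "exp (- complex_of_real y) = of_real (exp (- y))"
      by (simp add: exp_of_real[symmetric])
    ultimately have "F (of_real (u n)) = of_real (over_gf (exp (- s\<^sup>2)) * (2 * L / s) * exp (- y) * Re (tri_gf (of_real (exp (- 8 * y))))) - 1"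
      unfolding F_def by (simp only: of_real_mult of_real_divide of_real_numeral)
    then show ?thesis by (simp only: *) simp
  qed
  have ulim: "(\<lambda>n. complex_of_real (u n)) \<longlonglongrightarrow> of_real 4"
  proof (rule tendsto_of_real)
    have "(\<lambda>n. (2 + 2 / real (Suc n))\<^sup>2) \<longlonglongrightarrow> (2 + 0)\<^sup>2"
      by (intro tendsto_intros inverse_Suc_tendsto_0)
    moreover have "(2 + 2 / real (Suc n))\<^sup>2 = u n" for n
      by (simp add: u_def field_simps)
    ultimately show "u \<longlonglongrightarrow> 4" by simp
  qed
  have ult: "u n > 4" for n
  proof -
    have "2\<^sup>2 < u n" unfolding u_def by (rule power_strict_mono) (auto simp: field_simps)
    then show ?thesis by simp
  qed
  have "F t = 0" if "t \<in> S" for t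
  proof (rule analytic_continuation[OF hol])
    show "open S" unfolding S_def by (rule open_halfspace_Re_gt)
    show "connected S" unfolding S_def by (intro convex_connected convex_halfspace_Re_gt)
    show "range (\<lambda>n. complex_of_real (u n)) \<subseteq> S" using ult by (auto simp: S_def intro: order_less_trans[of 0 4])
    show "of_real 4 \<in> S" by (simp add: S_def)
    show "of_real 4 islimpt range (\<lambda>n. complex_of_real (u n))"
      unfolding islimpt_sequential
    proof (intro exI[of _ "\<lambda>n. complex_of_real (u n)"] conjI allI)
      show "complex_of_real (u n) \<in> range (\<lambda>n. complex_of_real (u n)) - {of_real 4}" for n
        using ult[of n] by (auto simp: of_real_eq_iff simp del: of_real_numeral)
    qed (rule ulim)
  qed (use Fu that in auto)
  then show ?thesis
    by (intro that[OF L]) (simp add: F_def S_def)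
qed

section \<open>Kummer's function\<close>

text \<open>The reciprocal of the rising factorial (3/2)(5/2)...(j + 1/2).\<close>

definition kcoeff :: "nat \<Rightarrow> real" where
  "kcoeff j = 4 ^ j * fact j / fact (2 * j + 1)"

lemma kcoeff_0 [simp]: "kcoeff 0 = 1"
  by (simp add: kcoeff_def)

lemma kcoeff_Suc: "kcoeff (Suc j) = kcoeff j * (2 / (2 * real j + 3))"
proof -
  have "fact (2 * Suc j + 1) = (2 * real j + 3) * ((2 * real j + 2) * fact (2 * j + 1))"
    by (simp add: algebra_simps)
  then have "kcoeff (Suc j) = (4 * (real j + 1)) * (4 ^ j * fact j) / ((2 * real j + 3) * ((2 * real j + 2) * fact (2 * j + 1)))"
    unfolding kcoeff_def by (simp only: power_Suc fact_Suc of_nat_Suc mult_ac add_ac)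
  also have "\<dots> = kcoeff j * (2 / (2 * real j + 3))"
  proof -
    have "(4 * (x + 1)) * A / ((2 * x + 3) * ((2 * x + 2) * B)) = A / B * (2 / (2 * x + 3))"
      if "x \<ge> 0" "B > 0" for x A B :: real
      using that by (simp add: divide_simps)
    from this[of "real j" "fact (2 * j + 1)" "4 ^ j * fact j"] show ?thesis unfolding kcoeff_def by simp
  qed
  finally show ?thesis .
qed

lemma kcoeff_pos: "kcoeff j > 0"
  by (simp add: kcoeff_def)

lemma kcoeff_le: "kcoeff j \<le> 1 / fact j"
proof (induction j)
  case (Suc j)
  have "kcoeff (Suc j) \<le> 1 / fact j * (1 / (real j + 1))"
    unfolding kcoeff_Suc using Suc kcoeff_pos[of j]
    by (intro mult_mono) (auto simp: field_simps)
  then show ?case by (simp add: field_simps)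
qed simp

text \<open>This is Kummer's function \<open>M(1, 3/2, y)\<close>.\<close>

definition kummer :: "complex \<Rightarrow> complex" where
  "kummer y = (\<Sum>j. of_real (kcoeff j) * y ^ j)"

lemma kummer_summable_norm: "summable (\<lambda>j. norm (of_real (kcoeff j) * y ^ j))" for y :: complex
proof (rule summable_comparison_test')
  show "summable (\<lambda>j. norm y ^ j / fact j)"
    using summable_exp_generic[of "norm y"] by (simp add: divide_inverse mult.commute)
  show "norm (norm (of_real (kcoeff n) * y ^ n)) \<le> norm y ^ n / fact n" for n
    using mult_right_mono[OF kcoeff_le[of n], of "norm y ^ n"] kcoeff_pos[of n]
    by (simp add: norm_mult norm_power)
qed

lemma kummer_sums: "(\<lambda>j. of_real (kcoeff j) * y ^ j) sums kummer y"
  unfolding kummer_def by (rule summable_sums[OF summable_norm_cancel[OF kummer_summable_norm]])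

lemma norm_kummer_le: "norm (kummer y) \<le> exp (norm y)"
proof -
  have "norm (kummer y) \<le> (\<Sum>j. norm (of_real (kcoeff j) * y ^ j))"
    unfolding kummer_def by (rule summable_norm[OF kummer_summable_norm])
  also have "\<dots> \<le> (\<Sum>j. norm y ^ j /\<^sub>R fact j)"
  proof (rule suminf_le[OF _ kummer_summable_norm summable_exp_generic])
    show "norm (of_real (kcoeff n) * y ^ n) \<le> norm y ^ n /\<^sub>R fact n" for n
      using mult_right_mono[OF kcoeff_le[of n], of "norm y ^ n"] kcoeff_pos[of n]
      by (simp add: norm_mult norm_power divide_inverse)
  qed
  also have "\<dots> = exp (norm y)" by (simp add: exp_def)
  finally show ?thesis .
qed

text \<open>The recursion (2j+3) c(j+1) = 2 c(j) of the coefficients, read on power series, is this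
  first-order differential equation; the inhomogeneity 1 is the constant coefficient.\<close>

lemma kummer_derivative:
  obtains D where "(kummer has_field_derivative D) (at y)" "2 * y * D + kummer y = 2 * y * kummer y + 1"
proof -
  define c where "c = (\<lambda>j. complex_of_real (kcoeff j))"
  have sm: "summable (\<lambda>j. c j * x ^ j)" for x
    using kummer_sums[of x] by (auto simp: c_def sums_iff)
  have 1: "((\<lambda>x. \<Sum>n. c n * x ^ n) has_field_derivative (\<Sum>n. diffs c n * y ^ n)) (at y)"
    by (rule termdiffs_strong_converges_everywhere[OF sm])
  have dsm: "summable (\<lambda>n. diffs c n * y ^ n)"
    by (rule termdiff_converges_all[OF sm])
  define D where "D = (\<Sum>n. diffs c n * y ^ n)"
  have D: "(\<lambda>n. diffs c n * y ^ n) sums D" unfolding D_def by (rule summable_sums[OF dsm])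
  have K: "(\<lambda>j. c j * y ^ j) sums kummer y"
    using kummer_sums[of y] by (simp add: c_def)
  have "(\<lambda>n. 2 * y * (diffs c n * y ^ n) + c (Suc n) * y ^ Suc n) sums (2 * y * D + (kummer y - c 0 * y ^ 0))"
    by (intro sums_add sums_mult D) (subst sums_Suc_iff, simp add: K)
  also have "(\<lambda>n. 2 * y * (diffs c n * y ^ n) + c (Suc n) * y ^ Suc n) = (\<lambda>n. 2 * y * (c n * y ^ n))"
  proof
    fix n
    have "(2 * of_nat (Suc n) + 1) * c (Suc n) = of_real ((2 * real (Suc n) + 1) * kcoeff (Suc n))"
      by (simp add: c_def)
    also have "(2 * real (Suc n) + 1) * kcoeff (Suc n) = 2 * kcoeff n"
      using add_pos_nonneg[of 3 "2 * real n"] by (simp add: kcoeff_Suc divide_simps)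
    finally have "(2 * of_nat (Suc n) + 1) * c (Suc n) = 2 * c n" by (simp add: c_def)
    moreover have "2 * y * (diffs c n * y ^ n) + c (Suc n) * y ^ Suc n = ((2 * of_nat (Suc n) + 1) * c (Suc n)) * (y * y ^ n)"
      by (simp add: diffs_def algebra_simps)
    ultimately show "2 * y * (diffs c n * y ^ n) + c (Suc n) * y ^ Suc n = 2 * y * (c n * y ^ n)" by simp
  qed
  finally have "(\<lambda>n. 2 * y * (c n * y ^ n)) sums (2 * y * D + (kummer y - 1))" by (simp add: c_def)
  moreover have "(\<lambda>n. 2 * y * (c n * y ^ n)) sums (2 * y * kummer y)"
    using K by (rule sums_mult)
  ultimately have "2 * y * D + (kummer y - 1) = 2 * y * kummer y" by (rule sums_unique2)
  moreover have "(kummer has_field_derivative D) (at y)"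
  proof -
    have "kummer = (\<lambda>x. \<Sum>n. c n * x ^ n)" by (rule ext) (simp only: kummer_def c_def)
    then show ?thesis using 1 unfolding D_def by (simp only:)
  qed
  ultimately show ?thesis by (intro that) (auto simp: algebra_simps)
qed

section \<open>Asymptotics of Kummer's function in a half-plane\<close>

text \<open>\<open>csqrt y * exp (- y)\<close> is the integrating factor of the equation in
  \<open>kummer_derivative\<close>. The function is the integral of exp(-s^2) from 0 to sqrt y, so a
  constant limit with exponentially small error is to be expected.\<close>

definition kred :: "complex \<Rightarrow> complex" where
  "kred y = csqrt y * exp (- y) * kummer y"

lemma kred_derivative:
  assumes "Re y > 0"
  shows "(kred has_field_derivative exp (- y) / (2 * csqrt y)) (at y)"
proof -
  obtain D where D: "(kummer has_field_derivative D) (at y)" "2 * y * D + kummer y = 2 * y * kummer y + 1"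
    by (rule kummer_derivative)
  have nz: "y \<noteq> 0" "y \<notin> \<real>\<^sub>\<le>\<^sub>0" using assms by (auto simp: complex_nonpos_Reals_iff)
  have s: "csqrt y \<noteq> 0" "csqrt y * csqrt y = y" using nz by (auto simp flip: power2_eq_square)
  have e: "((\<lambda>y. exp (- y)) has_field_derivative - exp (- y)) (at y)"
    by (auto intro!: derivative_eq_intros)
  note DERIV_mult'[OF DERIV_mult'[OF has_field_derivative_csqrt[OF nz(2)] e] D(1)]
  moreover have "csqrt y * exp (- y) * D + (csqrt y * - exp (- y) + inverse (2 * csqrt y) * exp (- y)) * kummer y
       = exp (- y) / (2 * csqrt y) * (kummer y - 2 * (csqrt y * csqrt y) * kummer y + 2 * (csqrt y * csqrt y) * D)"
    using s(1) by (simp add: field_simps)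
  moreover have "kummer y - 2 * (csqrt y * csqrt y) * kummer y + 2 * (csqrt y * csqrt y) * D = 1"
    using D(2) unfolding s(2) by (simp add: algebra_simps)
  ultimately show ?thesis by (simp add: kred_def[abs_def])
qed

lemma kred_diff_bound:
  assumes "\<rho> \<ge> 1" "Re x \<ge> \<rho>" "Re y \<ge> \<rho>"
  shows "norm (kred x - kred y) \<le> exp (- \<rho>) / 2 * norm (x - y)"
proof (rule field_differentiable_bound)
  show "convex {z. Re z \<ge> \<rho>}" by (rule convex_halfspace_Re_ge)
  fix z assume z: "z \<in> {z. Re z \<ge> \<rho>}"
  then show "(kred has_field_derivative exp (- z) / (2 * csqrt z)) (at z within {z. Re z \<ge> \<rho>})"
    using assms by (intro has_field_derivative_at_within[OF kred_derivative]) auto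
  have "1 \<le> norm z" using z assms complex_Re_le_cmod[of z] by auto
  then have "1 \<le> norm (csqrt z)" by simp
  then show "norm (exp (- z) / (2 * csqrt z)) \<le> exp (- \<rho>) / 2"
    using z frac_le[of "exp (- \<rho>)" "exp (- Re z)" "2 * 1" "2 * norm (csqrt z)"]
    by (simp add: norm_divide norm_mult norm_exp_eq_Re)
qed (use assms in auto)

text \<open>\<open>kred\<close> tends to a constant C along horizontal lines with error at most
  exp(-Re y), whatever Im y is. Multiplying back by exp y / csqrt y, whose modulus is at most exp(Re
  y), leaves an error of at most 1.\<close>

lemma kummer_asymptotics:
  obtains c :: real where "c > 0"
    "\<And>y. Re y \<ge> 1 \<Longrightarrow> norm (kummer y - of_real c * exp y / csqrt y) \<le> 1"
proof -
  have e1: "exp (- 1 :: real) \<le> 1 / 2"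
    using exp_ge_add_one_self[of 1] by (simp add: exp_minus field_simps)
  have ek: "exp (- 1 :: real) ^ k = exp (- real k)" for k
    using exp_of_nat_mult[of k "- 1 :: real"] by simp
  have step: "norm (kred (y + of_nat (Suc k)) - kred (y + of_nat k)) \<le> exp (- Re y) * (1 / 2) ^ Suc k"
    if "Re y \<ge> 1" for y k
  proof -
    have "norm (kred (y + of_nat (Suc k)) - kred (y + of_nat k)) \<le> exp (- (Re y + real k)) / 2 * norm ((y + of_nat (Suc k)) - (y + of_nat k))"
      using that by (intro kred_diff_bound) auto
    also have "\<dots> = exp (- Re y) * exp (- 1) ^ k / 2"
      unfolding ek by (simp flip: exp_add)
    also have "\<dots> \<le> exp (- Re y) * (1 / 2) ^ k / 2"
      using e1 by (intro divide_right_mono mult_left_mono power_mono) auto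
    finally show ?thesis by simp
  qed
  have lim: "\<exists>l. (\<lambda>k. kred (y + of_nat k)) \<longlonglongrightarrow> l \<and> norm (l - kred y) \<le> exp (- Re y)"
    if y: "Re y \<ge> 1" for y
  proof -
    define d where "d = (\<lambda>k. kred (y + of_nat (Suc k)) - kred (y + of_nat k))"
    have gs: "(\<lambda>k. exp (- Re y) * (1 / 2 :: real) ^ Suc k) sums (exp (- Re y) * 1)"
      by (intro sums_mult power_half_series)
    have sm: "summable (\<lambda>k. norm (d k))"
      by (rule summable_comparison_test'[OF sums_summable[OF gs]]) (use step[OF y] in \<open>auto simp: d_def\<close>)
    have "(\<lambda>n. \<Sum>k<n. d k) \<longlonglongrightarrow> suminf d"
      using summable_LIMSEQ[OF summable_norm_cancel[OF sm]] .
    also have "(\<lambda>n. \<Sum>k<n. d k) = (\<lambda>n. kred (y + of_nat n) - kred y)"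
      unfolding d_def using sum_lessThan_telescope[of "\<lambda>k. kred (y + of_nat k)"] by simp
    finally have "(\<lambda>n. kred (y + of_nat n) - kred y + kred y) \<longlonglongrightarrow> suminf d + kred y"
      by (intro tendsto_intros)
    moreover have "norm (suminf d) \<le> exp (- Re y)"
    proof -
      have "norm (suminf d) \<le> (\<Sum>k. norm (d k))" by (rule summable_norm[OF sm])
      also have "\<dots> \<le> (\<Sum>k. exp (- Re y) * (1 / 2 :: real) ^ Suc k)"
        by (rule suminf_le[OF _ sm sums_summable[OF gs]]) (use step[OF y] in \<open>auto simp: d_def\<close>)
      finally show ?thesis using sums_unique[OF gs] by simp
    qed
    ultimately show ?thesis by (intro exI[of _ "suminf d + kred y"]) simp
  qed
  obtain C where C: "(\<lambda>k. kred (1 + of_nat k)) \<longlonglongrightarrow> C" "norm (C - kred 1) \<le> exp (- 1)"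
    using lim[of 1] by auto
  \<comment> \<open>The limit along y + k is the same for every y: \<open>kred\<close> varies so
    little far to the right that its values at y + k and 1 + k merge.\<close>
  have Cy: "norm (C - kred y) \<le> exp (- Re y)" if y: "Re y \<ge> 1" for y
  proof -
    obtain l where l: "(\<lambda>k. kred (y + of_nat k)) \<longlonglongrightarrow> l" "norm (l - kred y) \<le> exp (- Re y)"
      using lim[OF y] by auto
    have "(\<lambda>k. kred (y + of_nat k) - kred (1 + of_nat k)) \<longlonglongrightarrow> 0"
    proof (rule Lim_null_comparison[OF always_eventually])
      show "\<forall>k. norm (kred (y + of_nat k) - kred (1 + of_nat k)) \<le> (1 / 2) ^ k * norm (y - 1)"
      proof
        fix k
        have "norm (kred (y + of_nat k) - kred (1 + of_nat k)) \<le> exp (- (1 + real k)) / 2 * norm ((y + of_nat k) - (1 + of_nat k))"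
          using y by (intro kred_diff_bound) auto
        also have "exp (- (1 + real k)) / 2 \<le> exp (- 1) ^ k"
          unfolding ek using exp_gt_zero[of "- real k"] exp_le_cancel_iff[of "- (1 + real k)" "- real k"] by linarith
        also have "exp (- 1 :: real) ^ k \<le> (1 / 2) ^ k"
          using e1 by (intro power_mono) auto
        finally show "norm (kred (y + of_nat k) - kred (1 + of_nat k)) \<le> (1 / 2) ^ k * norm (y - 1)"
          by (simp add: mult_right_mono)
      qed
      have "(\<lambda>k. (1 / 2 :: real) ^ k * norm (y - 1)) \<longlonglongrightarrow> 0 * norm (y - 1)"
        by (intro tendsto_intros LIMSEQ_power_zero) auto
      then show "(\<lambda>k. (1 / 2 :: real) ^ k * norm (y - 1)) \<longlonglongrightarrow> 0" by simp
    qed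
    moreover have "(\<lambda>k. kred (y + of_nat k) - kred (1 + of_nat k)) \<longlonglongrightarrow> l - C"
      by (intro tendsto_intros l C)
    ultimately have "l = C" using LIMSEQ_unique by fastforce
    then show ?thesis using l by simp
  qed
  have kr: "kummer (of_real x) \<in> \<real>" for x
  proof -
    have "(\<lambda>j. of_real (kcoeff j * x ^ j)) sums kummer (of_real x)"
      using kummer_sums[of "of_real x"] by simp
    from sums_Im[OF this] show ?thesis by (simp add: complex_is_Real_iff sums_iff)
  qed
  have "kred (1 + of_nat k) \<in> \<real>" for k
  proof -
    have "1 + of_nat k = complex_of_real (1 + real k)" by simp
    moreover have "exp (- complex_of_real (1 + real k)) = of_real (exp (- (1 + real k)))"
      by (simp only: of_real_minus[symmetric] exp_of_real)
    moreover have "csqrt (complex_of_real (1 + real k)) = of_real (sqrt (1 + real k))"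
      by (subst csqrt_of_real_nonneg) auto
    ultimately show ?thesis unfolding kred_def using kr[of "1 + real k"]
      by (simp only: Reals_mult Reals_of_real)
  qed
  then have CR: "C \<in> \<real>"
    using C(1) by (intro Lim_in_closed_set[OF closed_complex_Reals]) auto
  define c where "c = Re C"
  have Cc: "C = of_real c" using CR by (simp add: c_def)
  \<comment> \<open>The first two coefficients 1 + 2/3 suffice: \<open>kred 1\<close> is then at
    least (5/3) exp(-1), and C differs from it by at most exp(-1), so C remains positive.\<close>
  have "Re (kummer 1) \<ge> 5 / 3"
  proof -
    have "(\<lambda>j. Re (of_real (kcoeff j) * 1 ^ j)) sums Re (kummer 1)"
      using kummer_sums[of 1] by (rule sums_Re)
    then have s: "kcoeff sums Re (kummer 1)" by simp
    have "(\<Sum>j<2. kcoeff j) \<le> suminf kcoeff"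
      using s kcoeff_pos by (intro sum_le_suminf) (auto simp: sums_iff less_imp_le)
    moreover have "(\<Sum>j<2. kcoeff j) = 5 / 3"
      using kcoeff_Suc[of 0] by (simp add: numeral_2_eq_2)
    ultimately show ?thesis using s by (simp add: sums_iff)
  qed
  then have "exp (- 1) * (5 / 3) \<le> exp (- 1) * Re (kummer 1)" by (intro mult_left_mono) auto
  also have "\<dots> = Re (kred 1)"
  proof -
    have "exp (- 1 :: complex) = of_real (exp (- 1))" by (simp add: exp_of_real[symmetric])
    then show ?thesis unfolding kred_def by (simp only: csqrt_1) simp
  qed
  finally have "Re (kred 1) \<ge> exp (- 1) * (5 / 3)" .
  moreover have "\<bar>c - Re (kred 1)\<bar> \<le> exp (- 1)"
    using C(2) abs_Re_le_cmod[of "C - kred 1"] by (simp add: Cc)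
  ultimately have "c \<ge> exp (- 1) * (2 / 3)" by (simp add: algebra_simps)
  then have "c > 0" by (smt (verit) exp_gt_zero mult_pos_pos divide_pos_pos)
  moreover have "norm (kummer y - of_real c * exp y / csqrt y) \<le> 1" if y: "Re y \<ge> 1" for y
  proof -
    have "y \<noteq> 0" using y by auto
    have "1 \<le> norm y" using y complex_Re_le_cmod[of y] by auto
    then have n1: "1 \<le> norm (csqrt y)" by simp
    have "kummer y - of_real c * exp y / csqrt y = exp y / csqrt y * (kred y - C)"
      using \<open>y \<noteq> 0\<close> by (simp add: kred_def Cc field_simps exp_minus)
    then have "norm (kummer y - of_real c * exp y / csqrt y) = exp (Re y) / norm (csqrt y) * norm (C - kred y)"
      by (simp add: norm_mult norm_divide norm_exp_eq_Re norm_minus_commute)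
    also have "\<dots> \<le> exp (Re y) / 1 * exp (- Re y)"
      using n1 by (intro mult_mono frac_le Cy y) auto
    also have "\<dots> = 1" by (simp add: exp_minus)
    finally show ?thesis .
  qed
  ultimately show ?thesis by (rule that)
qed

section \<open>The main term\<close>

text \<open>Chosen so that \<open>mcoeff j\<close> times j!/t^(j+1) is the term of index j + 1 of
  Kummer's series at pi^2/(4t). The equivalent form \<open>mcoeff_eq\<close> shows the Taylor
  coefficients of the derivative of sinh(pi sqrt x)/(pi sqrt x).\<close>

definition mcoeff :: "nat \<Rightarrow> real" where
  "mcoeff j = kcoeff (Suc j) * (pi\<^sup>2 / 4) ^ Suc j / fact j"

definition main_term :: "nat \<Rightarrow> real" where
  "main_term n = (\<Sum>j. mcoeff j * real n ^ j)"

lemma mcoeff_nonneg: "mcoeff j \<ge> 0"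
  using kcoeff_pos[of "Suc j"] by (simp add: mcoeff_def)

lemma mcoeff_eq: "mcoeff j = real (Suc j) * pi ^ (2 * Suc j) / fact (2 * Suc j + 1)"
proof -
  have "mcoeff j = (4 ^ Suc j * (pi\<^sup>2 / 4) ^ Suc j) * (fact (Suc j) / fact j) / fact (2 * Suc j + 1)"
    by (simp add: mcoeff_def kcoeff_def)
  also have "4 ^ Suc j * (pi\<^sup>2 / 4) ^ Suc j = pi ^ (2 * Suc j)"
    by (simp only: power_mult_distrib[symmetric] power_mult) simp
  also have "fact (Suc j) / fact j = real (Suc j)" by simp
  finally show ?thesis by simp
qed

text \<open>Termwise, 1/(2j)! - 1/(2j+1)! = 2j/(2j+1)!. The factor j kills the constant term, which
  allows the index shift in \<open>main_term_sums\<close>.\<close>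

lemma cosh_minus_sinh_sums:
  fixes z :: real
  assumes "z \<noteq> 0"
  shows "(\<lambda>j. 2 * real j * z ^ (2 * j) / fact (2 * j + 1)) sums (cosh z - sinh z / z)"
proof -
  have "(\<lambda>j. if even (2 * j) then z ^ (2 * j) /\<^sub>R fact (2 * j) else 0) sums cosh z"
    by (subst sums_mono_reindex[of "\<lambda>j. 2 * j" "\<lambda>n. if even n then z ^ n /\<^sub>R fact n else 0"])
       (auto simp: strict_mono_def cosh_converges elim!: evenE)
  then have c: "(\<lambda>j. z ^ (2 * j) / fact (2 * j)) sums cosh z" by (simp add: divide_inverse mult.commute)
  have "(\<lambda>j. if even (2 * j + 1) then 0 else z ^ (2 * j + 1) /\<^sub>R fact (2 * j + 1)) sums sinh z"
    by (subst sums_mono_reindex[of "\<lambda>j. 2 * j + 1" "\<lambda>n. if even n then 0 else z ^ n /\<^sub>R fact n"])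
       (auto simp: strict_mono_def sinh_converges elim!: oddE)
  then have "(\<lambda>j. z ^ (2 * j + 1) /\<^sub>R fact (2 * j + 1)) sums sinh z" by simp
  then have "(\<lambda>j. z ^ (2 * j + 1) /\<^sub>R fact (2 * j + 1) / z) sums (sinh z / z)" by (rule sums_divide)
  also have "(\<lambda>j. z ^ (2 * j + 1) /\<^sub>R fact (2 * j + 1) / z) = (\<lambda>j. z ^ (2 * j) / fact (2 * j + 1))"
    using assms by (auto simp: divide_inverse mult_ac)
  finally have "(\<lambda>j. z ^ (2 * j) / fact (2 * j) - z ^ (2 * j) / fact (2 * j + 1)) sums (cosh z - sinh z / z)"
    by (intro sums_diff c)
  also have "(\<lambda>j. z ^ (2 * j) / fact (2 * j) - z ^ (2 * j) / fact (2 * j + 1)) = (\<lambda>j. 2 * real j * z ^ (2 * j) / fact (2 * j + 1))"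
  proof
    fix j
    have "fact (2 * j + 1) = (2 * real j + 1) * fact (2 * j)" by simp
    then have "z ^ (2 * j) / fact (2 * j) = (2 * real j + 1) * z ^ (2 * j) / fact (2 * j + 1)"
      by (simp only:) simp
    then show "z ^ (2 * j) / fact (2 * j) - z ^ (2 * j) / fact (2 * j + 1) = 2 * real j * z ^ (2 * j) / fact (2 * j + 1)"
      by (simp only:) (simp add: diff_divide_distrib[symmetric] left_diff_distrib distrib_right del: fact_Suc)
  qed
  finally show ?thesis .
qed

lemma main_term_sums:
  assumes "n > 0"
  shows "(\<lambda>j. mcoeff j * real n ^ j) sums
           ((cosh (pi * sqrt (real n)) - sinh (pi * sqrt (real n)) / (pi * sqrt (real n))) / (2 * real n))"
proof -
  define z where "z = pi * sqrt (real n)"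
  have z: "z \<noteq> 0" "z\<^sup>2 = pi\<^sup>2 * real n" using assms by (auto simp: z_def power_mult_distrib)
  have "(\<lambda>j. 2 * real (Suc j) * z ^ (2 * Suc j) / fact (2 * Suc j + 1)) sums (cosh z - sinh z / z)"
    using cosh_minus_sinh_sums[OF z(1)] by (subst sums_Suc_iff) simp
  then have "(\<lambda>j. 2 * real (Suc j) * z ^ (2 * Suc j) / fact (2 * Suc j + 1) / (2 * real n)) sums ((cosh z - sinh z / z) / (2 * real n))"
    by (rule sums_divide)
  also have "(\<lambda>j. 2 * real (Suc j) * z ^ (2 * Suc j) / fact (2 * Suc j + 1) / (2 * real n)) = (\<lambda>j. mcoeff j * real n ^ j)"
  proof
    fix j
    have "z ^ (2 * Suc j) = (z\<^sup>2) ^ Suc j" by (rule power_mult)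
    also have "\<dots> = (pi\<^sup>2) ^ Suc j * real n ^ Suc j" by (simp only: z(2) power_mult_distrib)
    also have "(pi\<^sup>2) ^ Suc j = pi ^ (2 * Suc j)" by (rule power_mult[symmetric])
    finally have "z ^ (2 * Suc j) = pi ^ (2 * Suc j) * (real n * real n ^ j)" by simp
    then show "2 * real (Suc j) * z ^ (2 * Suc j) / fact (2 * Suc j + 1) / (2 * real n) = mcoeff j * real n ^ j"
      unfolding mcoeff_eq using assms by (simp del: fact_Suc power_Suc mult_Suc_right of_nat_Suc)
  qed
  finally show ?thesis by (simp add: z_def)
qed

lemma main_term_eq:
  assumes "n > 0"
  shows "main_term n = (cosh (pi * sqrt (real n)) - sinh (pi * sqrt (real n)) / (pi * sqrt (real n))) / (2 * real n)"
  using main_term_sums[OF assms] by (simp add: main_term_def sums_iff)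

lemma main_term_summable: "summable (\<lambda>j. mcoeff j * real n ^ j)"
proof (cases "n = 0")
  case True
  then show ?thesis using summable_finite[of "{0}" "\<lambda>j. mcoeff j * real n ^ j"] by (auto simp: power_0_left)
next
  case False
  then show ?thesis using main_term_sums[of n] by (simp add: sums_iff)
qed

lemma main_term_nonneg: "main_term n \<ge> 0"
  unfolding main_term_def by (intro suminf_nonneg main_term_summable) (simp add: mcoeff_nonneg)

lemma main_term_le:
  assumes "n > 0"
  shows "main_term n \<le> exp (pi * sqrt (real n))"
proof -
  define z where "z = pi * sqrt (real n)"
  have "z > 0" using assms by (simp add: z_def)
  have "main_term n \<le> cosh z / (2 * real n)"
    unfolding main_term_eq[OF assms] z_def[symmetric]
    using \<open>z > 0\<close> by (intro divide_right_mono) auto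
  also have "\<dots> \<le> cosh z / 1"
    using assms by (intro divide_left_mono) auto
  also have "\<dots> \<le> exp z"
    using \<open>z > 0\<close> by (simp add: cosh_def)
  finally show ?thesis by (simp add: z_def)
qed

lemma main_gf_summable:
  assumes s: "s > 0"
  shows "summable (\<lambda>n. main_term n * exp (- s) ^ n)"
proof (rule summable_comparison_test'[of _ 1])
  show "summable (\<lambda>n. exp (pi\<^sup>2 / (2 * s)) * exp (- (s / 2)) ^ n)"
    using s by (intro summable_mult summable_geometric) auto
  fix n :: nat assume n: "n \<ge> 1"
  \<comment> \<open>Completing the square gives pi sqrt n <= pi^2/(2s) + sn/2, so half of the decay
    exp(-sn) is left for a geometric majorant.\<close>
  have "0 \<le> (pi - s * sqrt (real n))\<^sup>2" by simp
  also have "\<dots> = pi\<^sup>2 + s\<^sup>2 * real n - 2 * s * (pi * sqrt (real n))"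
    by (simp add: power2_diff power_mult_distrib)
  finally have "pi * sqrt (real n) \<le> pi\<^sup>2 / (2 * s) + s / 2 * real n"
    using s by (simp add: field_simps power2_eq_square)
  then have "exp (pi * sqrt (real n)) \<le> exp (pi\<^sup>2 / (2 * s)) * exp (s / 2 * real n)"
    by (simp flip: exp_add)
  then have "main_term n * exp (- s * real n) \<le> exp (pi\<^sup>2 / (2 * s)) * exp (s / 2 * real n) * exp (- s * real n)"
    using main_term_le[of n] n by (intro mult_right_mono) auto
  also have "\<dots> = exp (pi\<^sup>2 / (2 * s)) * exp (- (s / 2) * real n)"
    by (simp flip: exp_add add: algebra_simps)
  finally show "norm (main_term n * exp (- s) ^ n) \<le> exp (pi\<^sup>2 / (2 * s)) * exp (- (s / 2)) ^ n"
    using main_term_nonneg[of n] by (simp add: mult.commute flip: exp_of_nat_mult)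
qed

lemma summable_power_times_geometric:
  fixes x :: complex
  assumes "norm x < 1"
  shows "summable (\<lambda>n. of_nat n ^ i * x ^ n)"
  using assms
proof (induction i arbitrary: x)
  case 0
  then show ?case by (simp add: summable_geometric)
next
  case (Suc i)
  have "summable (\<lambda>n. diffs (\<lambda>n. of_nat n ^ i) n * x ^ n)"
    by (rule termdiff_converges[of _ 1]) (use Suc in auto)
  then have "summable (\<lambda>n. x * (diffs (\<lambda>n. of_nat n ^ i) n * x ^ n))" by (rule summable_mult)
  also have "(\<lambda>n. x * (diffs (\<lambda>n. of_nat n ^ i) n * x ^ n)) = (\<lambda>n. of_nat (Suc n) ^ Suc i * x ^ Suc n)"
    by (auto simp: diffs_def)
  finally show ?case by (subst (asm) summable_Suc_iff)
qed

section \<open>Polylogarithms of nonpositive order near t = 0\<close>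

text \<open>The polylogarithm of order -i at exp(-t). Because 0^0 = 1, the case i = 0 is the full
  geometric series including its constant term.\<close>

definition plog :: "nat \<Rightarrow> complex \<Rightarrow> complex" where
  "plog i t = (\<Sum>n. of_nat n ^ i * exp (- t) ^ n)"

lemma plog_summable: "Re t > 0 \<Longrightarrow> summable (\<lambda>n. of_nat n ^ i * exp (- t) ^ n)"
  by (intro summable_power_times_geometric) (simp add: norm_exp_eq_Re)

lemma plog_0: "Re t > 0 \<Longrightarrow> plog 0 t = 1 / (1 - exp (- t))"
  unfolding plog_def by (simp add: suminf_geometric norm_exp_eq_Re)

lemma plog_derivative:
  assumes t: "Re t > 0"
  shows "(plog i has_field_derivative - plog (Suc i) t) (at t)"
proof -
  define c where "c = (\<lambda>n. of_nat n ^ i :: complex)"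
  define q where "q = exp (- t)"
  have q: "norm q < 1" using t by (simp add: q_def norm_exp_eq_Re)
  obtain K :: real where K: "norm q < K" "K < 1" using dense[OF q] by auto
  have "((\<lambda>x. \<Sum>n. c n * x ^ n) has_field_derivative (\<Sum>n. diffs c n * q ^ n)) (at q)"
    by (rule termdiffs_strong[of _ "of_real K"])
       (use K summable_power_times_geometric[of "of_real K" i] norm_ge_zero[of q] in \<open>auto simp: c_def simp del: norm_ge_zero\<close>)
  moreover have "((\<lambda>t. exp (- t)) has_field_derivative - q) (at t)"
    unfolding q_def by (auto intro!: derivative_eq_intros)
  ultimately have "((\<lambda>t. \<Sum>n. c n * exp (- t) ^ n) has_field_derivative (\<Sum>n. diffs c n * q ^ n) * - q) (at t)"
    unfolding q_def by (rule DERIV_chain2)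
  moreover have "(\<Sum>n. diffs c n * q ^ n) * - q = - plog (Suc i) t"
  proof -
    have sm: "summable (\<lambda>n. diffs c n * q ^ n)"
      by (rule termdiff_converges[OF q]) (auto simp: c_def intro: summable_power_times_geometric)
    have "plog (Suc i) t = (\<Sum>n. of_nat (Suc n) ^ Suc i * q ^ Suc n)"
      using suminf_split_head[OF plog_summable[OF t, of "Suc i"]] by (simp add: plog_def q_def)
    also have "\<dots> = (\<Sum>n. q * (diffs c n * q ^ n))"
      by (intro suminf_cong) (simp add: diffs_def c_def)
    also have "\<dots> = q * (\<Sum>n. diffs c n * q ^ n)"
      by (rule suminf_mult[OF sm])
    finally show ?thesis by simp
  qed
  ultimately show ?thesis by (simp add: plog_def[abs_def] c_def)
qed

lemma open_halfplane: "open {t. Re t > 0}"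
  by (rule open_halfspace_Re_gt)

lemma higher_deriv_plog:
  assumes "Re t > 0"
  shows "(deriv ^^ i) (plog 0) t = (-1) ^ i * plog i t"
  using assms
proof (induction i arbitrary: t)
  case (Suc i)
  have "deriv ((deriv ^^ i) (plog 0)) t = deriv (\<lambda>t. (-1) ^ i * plog i t) t"
  proof (rule deriv_cong_ev)
    have "\<forall>\<^sub>F x in nhds t. x \<in> {t. Re t > 0}"
      using Suc.prems by (intro eventually_nhds_in_open open_halfplane) auto
    then show "\<forall>\<^sub>F x in nhds t. (deriv ^^ i) (plog 0) x = (-1) ^ i * plog i x"
      by eventually_elim (use Suc.IH in auto)
  qed simp
  also have "\<dots> = (-1) ^ i * - plog (Suc i) t"
    by (intro DERIV_imp_deriv DERIV_cmult plog_derivative Suc.prems)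
  finally show ?case by simp
qed simp

lemma higher_deriv_inverse:
  fixes t :: complex
  assumes "t \<noteq> 0"
  shows "(deriv ^^ i) (\<lambda>t. 1 / t) t = (-1) ^ i * fact i / t ^ Suc i"
  using assms
proof (induction i arbitrary: t)
  case (Suc i)
  have "deriv ((deriv ^^ i) (\<lambda>t. 1 / t)) t = deriv (\<lambda>t. (-1) ^ i * fact i / t ^ Suc i) t"
  proof (rule deriv_cong_ev)
    have "\<forall>\<^sub>F x in nhds t. x \<in> - {0}"
      using Suc.prems by (intro eventually_nhds_in_open) auto
    then show "\<forall>\<^sub>F x in nhds t. (deriv ^^ i) (\<lambda>t. 1 / t) x = (-1) ^ i * fact i / x ^ Suc i"
      by eventually_elim (use Suc.IH in auto)
  qed simp
  also have "\<dots> = (-1) ^ Suc i * fact (Suc i) / t ^ Suc (Suc i)"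
  proof (rule DERIV_imp_deriv)
    have "((\<lambda>t. t ^ Suc i) has_field_derivative of_nat (Suc i) * t ^ i) (at t)"
      using DERIV_power[OF DERIV_ident, of "Suc i" t] by simp
    then have "((\<lambda>t. (-1) ^ i * fact i / t ^ Suc i) has_field_derivative
        (0 * t ^ Suc i - (-1) ^ i * fact i * (of_nat (Suc i) * t ^ i)) / (t ^ Suc i * t ^ Suc i)) (at t)"
      by (rule DERIV_divide[OF DERIV_const]) (use Suc.prems in auto)
    moreover have "(0 * t ^ Suc i - (-1) ^ i * fact i * (of_nat (Suc i) * t ^ i)) / (t ^ Suc i * t ^ Suc i) = (-1) ^ Suc i * fact (Suc i) / t ^ Suc (Suc i)"
      using Suc.prems by (simp add: field_simps)
    ultimately show "((\<lambda>t. (-1) ^ i * fact i / t ^ Suc i) has_field_derivative (-1) ^ Suc i * fact (Suc i) / t ^ Suc (Suc i)) (at t)"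
      by simp
  qed
  finally show ?case by simp
qed simp

lemma exp_neg_eq_1_strip:
  assumes "exp (- t) = 1" "\<bar>Im t\<bar> < 2 * pi"
  shows "t = 0"
proof -
  from assms(1) obtain n :: int where n: "Re t = 0" "- Im t = of_int (2 * n) * pi"
    by (auto simp: exp_eq_1)
  then have "\<bar>of_int (2 * n) * pi\<bar> < 2 * pi" using assms(2) by (metis abs_minus_cancel)
  then have "\<bar>of_int n :: real\<bar> < 1" by (simp add: abs_mult)
  then have "n = 0" by linarith
  then show ?thesis using n by (simp add: complex_eq_iff)
qed

text \<open>In this strip exp(-t) = 1 holds at 0 only, and the pole there is simple with residue 1;
  subtracting it leaves a removable singularity.\<close>

lemma bernoulli_regular_part:
  obtains g where "g holomorphic_on {t. \<bar>Im t\<bar> < 2 * pi}"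
    "\<And>t. \<bar>Im t\<bar> < 2 * pi \<Longrightarrow> t \<noteq> 0 \<Longrightarrow> g t = 1 / (1 - exp (- t)) - 1 / t"
proof -
  define S where "S = {t. \<bar>Im t\<bar> < 2 * pi}"
  define h where "h = (\<lambda>t. 1 / (1 - exp (- t)) - 1 / t :: complex)"
  have "S = {t. Im t < 2 * pi} \<inter> {t. Im t > - (2 * pi)}" by (auto simp: S_def)
  then have "open S" by (auto intro!: open_Int open_halfspace_Im_lt open_halfspace_Im_gt)
  have nz: "1 - exp (- t) \<noteq> 0" if "t \<in> S - {0}" for t
    using exp_neg_eq_1_strip[of t] that by (auto simp: S_def)
  have hol: "h holomorphic_on S - {0}"
    unfolding h_def by (intro holomorphic_intros) (use nz in auto)
  have "((\<lambda>t. 1 - exp (- t) :: complex) has_field_derivative 1) (at 0)"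
    by (auto intro!: derivative_eq_intros)
  then have "((\<lambda>t. (1 - exp (- t)) / t) \<longlongrightarrow> (1 :: complex)) (at 0)"
    by (simp add: DERIV_def)
  then have "((\<lambda>t. inverse ((1 - exp (- t)) / t) - 1) \<longlongrightarrow> inverse 1 - (1 :: complex)) (at 0)"
    by (intro tendsto_intros) auto
  moreover have "\<forall>\<^sub>F t in at 0. inverse ((1 - exp (- t)) / t) - 1 = (t - 0) * h t"
    using eventually_at_ball[OF zero_less_one, of 0]
    by (auto simp: eventually_at h_def right_diff_distrib intro!: exI[of _ 1])
  ultimately have "((\<lambda>t. (t - 0) * h t) \<longlongrightarrow> 0) (at 0)"
    using Lim_transform_eventually by fastforce
  moreover have "0 \<in> interior S" using \<open>open S\<close> by (simp add: interior_open S_def)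
  ultimately obtain g where "g holomorphic_on S" "\<And>z. z \<in> S - {0} \<Longrightarrow> g z = h z"
    using holomorphic_on_extend_lim[OF hol] by blast
  then show ?thesis by (intro that[of g]) (auto simp: S_def h_def)
qed

text \<open>Differentiating the regular part of \<open>plog 0\<close> i times gives
  \<open>plog i\<close> minus its polar term, up to sign. Cauchy's inequality on discs of radius 1/2
  then yields one bound valid for all t in the rectangle and all i.\<close>

lemma plog_bound:
  obtains B where "B \<ge> 0"
    "\<And>t i. 0 < Re t \<Longrightarrow> Re t \<le> 1 \<Longrightarrow> \<bar>Im t\<bar> \<le> pi \<Longrightarrow> norm (plog i t - fact i / t ^ Suc i) \<le> fact i * B * 2 ^ i"
proof -
  define S where "S = {t. \<bar>Im t\<bar> < 2 * pi}"
  obtain g where g: "g holomorphic_on S" "\<And>t. t \<in> S \<Longrightarrow> t \<noteq> 0 \<Longrightarrow> g t = 1 / (1 - exp (- t)) - 1 / t"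
    using bernoulli_regular_part unfolding S_def by (metis (lifting) mem_Collect_eq)
  have "S = {t. Im t < 2 * pi} \<inter> {t. Im t > - (2 * pi)}" by (auto simp: S_def)
  then have opS: "open S" by (auto intro!: open_Int open_halfspace_Im_lt open_halfspace_Im_gt)
  \<comment> \<open>The rectangle contains every disc of radius 1/2 around an admissible t, because
    1 + 1/2 <= 2 and pi + 1/2 < 5, and it lies in the strip because 5 < 2 pi.\<close>
  define K where "K = cbox (Complex (- 2) (- 5)) (Complex 2 5)"
  have K: "z \<in> K \<longleftrightarrow> \<bar>Re z\<bar> \<le> 2 \<and> \<bar>Im z\<bar> \<le> 5" for z
    by (auto simp: K_def in_cbox_complex_iff)
  have "K \<subseteq> S" using pi_gt3 by (auto simp: K S_def)
  then have "compact (g ` K)"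
    unfolding K_def by (intro compact_continuous_image holomorphic_on_imp_continuous_on holomorphic_on_subset[OF g(1)]) auto
  then have "bounded (g ` K)" by (rule compact_imp_bounded)
  then obtain B where B: "\<And>z. z \<in> K \<Longrightarrow> norm (g z) \<le> B" unfolding bounded_iff by blast
  have "0 \<in> K" by (simp add: K)
  then have "B \<ge> 0" using B[of 0] norm_ge_zero order_trans by blast
  moreover have "norm (plog i t - fact i / t ^ Suc i) \<le> fact i * B * 2 ^ i"
    if t: "0 < Re t" "Re t \<le> 1" "\<bar>Im t\<bar> \<le> pi" for t i
  proof -
    have sub: "cball t (1 / 2) \<subseteq> K"
    proof
      fix z assume "z \<in> cball t (1 / 2)"
      then have "norm (t - z) \<le> 1 / 2" by (simp add: dist_norm)
      then have "\<bar>Re t - Re z\<bar> \<le> 1 / 2" "\<bar>Im t - Im z\<bar> \<le> 1 / 2"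
        using abs_Re_le_cmod[of "t - z"] abs_Im_le_cmod[of "t - z"] by auto
      then show "z \<in> K" unfolding K using t pi_less_4 by linarith
    qed
    have "norm ((deriv ^^ i) g t) \<le> fact i * B / (1 / 2) ^ i"
    proof (rule Cauchy_inequality)
      show "g holomorphic_on ball t (1 / 2)"
        using sub \<open>K \<subseteq> S\<close> ball_subset_cball by (intro holomorphic_on_subset[OF g(1)]) blast
      show "continuous_on (cball t (1 / 2)) g"
        using sub \<open>K \<subseteq> S\<close> by (intro holomorphic_on_imp_continuous_on holomorphic_on_subset[OF g(1)]) blast
      show "norm (g x) \<le> B" if "norm (t - x) = 1 / 2" for x
        using sub that by (intro B) (auto simp: dist_norm subset_iff)
    qed simp
    moreover have "(deriv ^^ i) g t = (-1) ^ i * (plog i t - fact i / t ^ Suc i)"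
    proof -
      define U where "U = S \<inter> {t. Re t > 0}"
      have "\<bar>Im t\<bar> < 2 * pi" using t pi_gt_zero by linarith
      then have U: "open U" "t \<in> U" using opS t by (auto simp: U_def S_def open_halfplane)
      have h1: "plog 0 holomorphic_on U"
        unfolding U_def by (rule holomorphic_on_subset[of _ "{t. Re t > 0}"])
          (auto simp: holomorphic_on_open[OF open_halfplane] intro!: plog_derivative exI)
      have h2: "(\<lambda>t. 1 / t) holomorphic_on U"
        by (auto intro!: holomorphic_intros simp: U_def)
      have "(deriv ^^ i) g t = (deriv ^^ i) (\<lambda>t. plog 0 t - 1 / t) t"
      proof (rule higher_deriv_transform_within_open[OF _ _ U])
        show "g holomorphic_on U" by (rule holomorphic_on_subset[OF g(1)]) (auto simp: U_def)
        show "(\<lambda>t. plog 0 t - 1 / t) holomorphic_on U" by (intro holomorphic_on_diff h1 h2)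
        fix w assume w: "w \<in> U"
        then have "w \<noteq> 0" by (auto simp: U_def)
        with w show "g w = plog 0 w - 1 / w" using g(2)[of w] plog_0[of w] by (auto simp: U_def)
      qed
      also have "\<dots> = (deriv ^^ i) (plog 0) t - (deriv ^^ i) (\<lambda>t. 1 / t) t"
        by (rule higher_deriv_diff[OF h1 h2 U])
      also have "\<dots> = (-1) ^ i * plog i t - (-1) ^ i * fact i / t ^ Suc i"
        using t by (subst higher_deriv_plog, simp, subst higher_deriv_inverse) auto
      finally show ?thesis by (simp add: right_diff_distrib)
    qed
    ultimately show ?thesis by (simp add: norm_mult norm_power power_divide)
  qed
  ultimately show ?thesis by (rule that)
qed

section \<open>Generating function of the main term\<close>

definition main_gf :: "complex \<Rightarrow> complex" where
  "main_gf q = (\<Sum>n. of_real (main_term n) * q ^ n)"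

text \<open>Interchange of the sums over n and i. All \<open>mcoeff\<close> are nonnegative, so
  \<open>main_term n\<close> itself dominates every partial sum over i.\<close>

lemma main_gf_partial_tendsto:
  assumes t: "Re t > 0"
  shows "(\<lambda>I. \<Sum>i<I. of_real (mcoeff i) * plog i t) \<longlonglongrightarrow> main_gf (exp (- t))"
proof -
  have eq: "(\<Sum>i<I. of_real (mcoeff i) * plog i t) = (\<Sum>n. of_real (\<Sum>i<I. mcoeff i * real n ^ i) * exp (- t) ^ n)" for I
  proof -
    have "(\<Sum>i<I. of_real (mcoeff i) * plog i t) = (\<Sum>i<I. \<Sum>n. of_real (mcoeff i) * (of_nat n ^ i * exp (- t) ^ n))"
      unfolding plog_def using plog_summable[OF t] by (simp add: suminf_mult)
    also have "\<dots> = (\<Sum>n. \<Sum>i<I. of_real (mcoeff i) * (of_nat n ^ i * exp (- t) ^ n))"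
      by (rule suminf_sum[symmetric]) (intro summable_mult plog_summable[OF t])
    finally show ?thesis by (simp add: sum_distrib_right mult.assoc)
  qed
  have "(\<lambda>I. \<Sum>n. of_real (\<Sum>i<I. mcoeff i * real n ^ i) * exp (- t) ^ n) \<longlonglongrightarrow> (\<Sum>n. of_real (main_term n) * exp (- t) ^ n)"
  proof (rule tannerys_theorem[THEN conjunct2, THEN conjunct2])
    show "(\<lambda>I. of_real (\<Sum>i<I. mcoeff i * real n ^ i) * exp (- t) ^ n) \<longlonglongrightarrow> of_real (main_term n) * exp (- t) ^ n" for n
      unfolding main_term_def by (intro tendsto_mult tendsto_of_real tendsto_const summable_LIMSEQ main_term_summable)
    have "norm (of_real (\<Sum>i<I. mcoeff i * real n ^ i) * exp (- t) ^ n) \<le> main_term n * exp (- Re t) ^ n" for n I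
    proof -
      have "(\<Sum>i<I. mcoeff i * real n ^ i) \<le> main_term n"
        unfolding main_term_def by (intro sum_le_suminf main_term_summable) (auto simp: mcoeff_nonneg)
      moreover have "(\<Sum>i<I. mcoeff i * real n ^ i) \<ge> 0" by (intro sum_nonneg) (auto simp: mcoeff_nonneg)
      ultimately show ?thesis
        unfolding norm_mult norm_power norm_of_real norm_exp_eq_Re by (simp add: mult_right_mono)
    qed
    then show "\<forall>\<^sub>F (n, I) in at_top \<times>\<^sub>F sequentially. norm (of_real (\<Sum>i<I. mcoeff i * real n ^ i) * exp (- t) ^ n) \<le> main_term n * exp (- Re t) ^ n"
      by (intro always_eventually) auto
    show "summable (\<lambda>n. main_term n * exp (- Re t) ^ n)" by (rule main_gf_summable[OF t])
  qed auto
  then show ?thesis by (simp only: eq main_gf_def)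
qed

text \<open>The polar terms i!/t^(i+1) reassemble to Kummer's series without its constant term,
  whence the - 1. The errors i! B 2^i are summable against \<open>mcoeff\<close>: they form a
  multiple of Kummer's series at pi^2/2.\<close>

lemma main_gf_kummer:
  obtains C where "C \<ge> 0"
    "\<And>t. 0 < Re t \<Longrightarrow> Re t \<le> 1 \<Longrightarrow> \<bar>Im t\<bar> \<le> pi \<Longrightarrow>
       norm (main_gf (exp (- t)) - (kummer (of_real (pi\<^sup>2 / 4) / t) - 1)) \<le> C"
proof -
  obtain B where B: "B \<ge> 0"
    "\<And>t i. 0 < Re t \<Longrightarrow> Re t \<le> 1 \<Longrightarrow> \<bar>Im t\<bar> \<le> pi \<Longrightarrow> norm (plog i t - fact i / t ^ Suc i) \<le> fact i * B * 2 ^ i"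
    using plog_bound by blast
  have sm: "summable (\<lambda>i. norm (of_real (kcoeff i) * of_real (pi\<^sup>2 / 2) ^ i :: complex))"
    by (rule kummer_summable_norm)
  then have "summable (\<lambda>i. kcoeff i * (pi\<^sup>2 / 2) ^ i)"
    by (simp add: norm_mult norm_power less_imp_le[OF kcoeff_pos])
  then have sm: "summable (\<lambda>i. B / 2 * (kcoeff (Suc i) * (pi\<^sup>2 / 2) ^ Suc i))"
    by (intro summable_mult) (subst summable_Suc_iff)
  define C where "C = (\<Sum>i. B / 2 * (kcoeff (Suc i) * (pi\<^sup>2 / 2) ^ Suc i))"
  have nn: "0 \<le> B / 2 * (kcoeff (Suc i) * (pi\<^sup>2 / 2) ^ Suc i)" for i
    using B kcoeff_pos[of "Suc i"] by (intro mult_nonneg_nonneg) auto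
  have "C \<ge> 0" unfolding C_def by (intro suminf_nonneg sm nn)
  moreover have "norm (main_gf (exp (- t)) - (kummer (of_real (pi\<^sup>2 / 4) / t) - 1)) \<le> C"
    if t: "0 < Re t" "Re t \<le> 1" "\<bar>Im t\<bar> \<le> pi" for t
  proof -
    define y where "y = of_real (pi\<^sup>2 / 4) / t"
    have "(\<lambda>i. of_real (kcoeff (Suc i)) * y ^ Suc i) sums (kummer y - of_real (kcoeff 0) * y ^ 0)"
      using kummer_sums[of y] by (subst sums_Suc_iff) simp
    then have "(\<lambda>I. \<Sum>i<I. of_real (kcoeff (Suc i)) * y ^ Suc i) \<longlonglongrightarrow> kummer y - 1"
      by (simp add: sums_def)
    with main_gf_partial_tendsto[OF t(1)]
    have lim: "(\<lambda>I. (\<Sum>i<I. of_real (mcoeff i) * plog i t) - (\<Sum>i<I. of_real (kcoeff (Suc i)) * y ^ Suc i))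
        \<longlonglongrightarrow> main_gf (exp (- t)) - (kummer y - 1)"
      by (rule tendsto_diff)
    have "norm ((\<Sum>i<I. of_real (mcoeff i) * plog i t) - (\<Sum>i<I. of_real (kcoeff (Suc i)) * y ^ Suc i)) \<le> C" for I
    proof -
      have "norm ((\<Sum>i<I. of_real (mcoeff i) * plog i t) - (\<Sum>i<I. of_real (kcoeff (Suc i)) * y ^ Suc i)) \<le>
            (\<Sum>i<I. B / 2 * (kcoeff (Suc i) * (pi\<^sup>2 / 2) ^ Suc i))"
        unfolding sum_subtractf[symmetric]
      proof (rule sum_norm_le)
        fix i
        have "complex_of_real (kcoeff (Suc i)) * y ^ Suc i = of_real (mcoeff i) * (fact i / t ^ Suc i)"
          by (simp add: mcoeff_def y_def power_divide field_simps)
        then have "norm (of_real (mcoeff i) * plog i t - of_real (kcoeff (Suc i)) * y ^ Suc i) = mcoeff i * norm (plog i t - fact i / t ^ Suc i)"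
          using mcoeff_nonneg[of i] by (simp only: right_diff_distrib[symmetric] norm_mult norm_of_real abs_of_nonneg)
        also have "\<dots> \<le> mcoeff i * (fact i * B * 2 ^ i)"
          by (intro mult_left_mono B t mcoeff_nonneg)
        also have "\<dots> = B / 2 * (kcoeff (Suc i) * ((pi\<^sup>2 / 4) ^ Suc i * 2 ^ Suc i))"
          by (simp add: mcoeff_def)
        also have "(pi\<^sup>2 / 4) ^ Suc i * 2 ^ Suc i = (pi\<^sup>2 / 2) ^ Suc i"
          by (simp only: power_mult_distrib[symmetric]) simp
        finally show "norm (of_real (mcoeff i) * plog i t - of_real (kcoeff (Suc i)) * y ^ Suc i) \<le> B / 2 * (kcoeff (Suc i) * (pi\<^sup>2 / 2) ^ Suc i)" .
      qed
      also have "\<dots> \<le> C" unfolding C_def by (intro sum_le_suminf sm nn) auto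
      finally show ?thesis .
    qed
    then show ?thesis
      unfolding y_def[symmetric] by (intro LIMSEQ_le_const2[OF tendsto_norm[OF lim]]) auto
  qed
  ultimately show ?thesis by (rule that)
qed

section \<open>Circle method\<close>

text \<open>In log((1+z)/(1-z)) = 2(z + z^3/3 + z^5/5 + ...) all terms but the first are estimated
  by their moduli, while the linear term keeps its real part. The gain is exp(2 Re z - 2
  |z|).\<close>

lemma norm_factor_refined:
  fixes z :: complex
  assumes z: "norm z < 1"
  shows "norm ((1 + z) / (1 - z)) \<le> (1 + norm z) / (1 - norm z) * exp (2 * Re z - 2 * norm z)"
proof -
  \<comment> \<open>The Taylor coefficients of that logarithm with the linear one removed; they are
    nonnegative, so the series at |z| is the majorant.\<close>
  define a where "a = (\<lambda>n. if n = 1 then 0 else (if odd n then 2 / real n else 0))"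
  have a_nonneg: "a n \<ge> 0" for n by (simp add: a_def)
  have S: "(\<lambda>n. of_real (a n) * w ^ n) sums (ln (1 + w) - ln (1 - w) - 2 * w)"
    if "norm w < 1" for w :: complex
  proof -
    have "(\<lambda>n. - ((- w) ^ n) / of_nat n) sums ln (1 + w)" using Ln_series'[of w] that by simp
    moreover have "(\<lambda>n. - (w ^ n) / of_nat n) sums ln (1 - w)" using Ln_series'[of "-w"] that by simp
    moreover have "(\<lambda>n. if n = 1 then 2 * w else 0) sums (2 * w)"
      by (rule sums_single)
    ultimately have "(\<lambda>n. - ((- w) ^ n) / of_nat n - - (w ^ n) / of_nat n - (if n = 1 then 2 * w else 0)) sums (ln (1 + w) - ln (1 - w) - 2 * w)"
      by (intro sums_diff)
    also have "(\<lambda>n. - ((- w) ^ n) / of_nat n - - (w ^ n) / of_nat n - (if n = 1 then 2 * w else 0)) = (\<lambda>n. of_real (a n) * w ^ n)"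
      by (rule ext) (auto simp: a_def power_minus_odd power_minus_even)
    finally show ?thesis .
  qed
  define r where "r = norm z"
  have r: "0 \<le> r" "r < 1" using z by (auto simp: r_def)
  have "summable (\<lambda>n. of_real (a n) * of_real r ^ n :: complex)"
    using S[of "of_real r"] r by (auto simp: sums_iff)
  then have sr: "summable (\<lambda>n. a n * r ^ n)"
    by (simp flip: of_real_power of_real_mult add: summable_complex_of_real)
  define s where "s = (\<Sum>n. a n * r ^ n)"
  have "(\<lambda>n. of_real (a n * r ^ n)) sums complex_of_real s"
    unfolding s_def by (intro sums_of_real summable_sums sr)
  then have s: "complex_of_real s = ln (1 + of_real r) - ln (1 - of_real r) - 2 * of_real r"
    using S[of "of_real r"] r by (simp add: sums_iff)
  have expq: "exp (ln (1 + w) - ln (1 - w) - 2 * w) = (1 + w) / (1 - w) * exp (- 2 * w)" if "norm w < 1" for w :: complex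
  proof -
    have "1 + w \<noteq> 0" "1 - w \<noteq> 0" using that by (auto simp: add_eq_0_iff)
    then show ?thesis unfolding exp_diff by (simp add: exp_minus divide_inverse)
  qed
  have "complex_of_real (exp s) = of_real ((1 + r) / (1 - r) * exp (- 2 * r))"
    using expq[of "of_real r"] r s by (simp add: exp_of_real[symmetric])
  then have es: "exp s = (1 + r) / (1 - r) * exp (- 2 * r)" by (simp only: of_real_eq_iff)
  have "norm (ln (1 + z) - ln (1 - z) - 2 * z) \<le> s"
  proof -
    have sn: "summable (\<lambda>n. norm (of_real (a n) * z ^ n))"
      using sr a_nonneg by (simp add: norm_mult norm_power r_def)
    have "ln (1 + z) - ln (1 - z) - 2 * z = (\<Sum>n. of_real (a n) * z ^ n)"
      using S[OF z] by (simp add: sums_iff)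
    also have "norm \<dots> \<le> (\<Sum>n. norm (of_real (a n) * z ^ n))" by (rule summable_norm[OF sn])
    also have "\<dots> = s" unfolding s_def using a_nonneg by (simp add: norm_mult norm_power r_def)
    finally show ?thesis .
  qed
  then have "Re (ln (1 + z) - ln (1 - z) - 2 * z) \<le> s"
    using complex_Re_le_cmod order_trans by blast
  then have "norm (exp (ln (1 + z) - ln (1 - z) - 2 * z)) \<le> exp s"
    by (simp only: norm_exp_eq_Re exp_le_cancel_iff)
  then have "norm ((1 + z) / (1 - z)) * exp (- 2 * Re z) \<le> (1 + r) / (1 - r) * exp (- 2 * r)"
    unfolding expq[OF z] es norm_mult norm_exp_eq_Re by simp
  then have "norm ((1 + z) / (1 - z)) * exp (- 2 * Re z) * exp (2 * Re z) \<le> (1 + r) / (1 - r) * exp (- 2 * r) * exp (2 * Re z)"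
    by (rule mult_right_mono) simp
  then show ?thesis
    by (simp add: r_def mult.assoc flip: exp_add)
qed

text \<open>Applying \<open>norm_factor_refined\<close> to z = q^k for all k and summing the linear
  terms gives two geometric series.\<close>

lemma norm_over_gf_refined:
  fixes q :: complex
  assumes q: "norm q < 1"
  shows "norm (over_gf q) \<le> over_gf (norm q) * exp (2 * Re (q / (1 - q)) - 2 * (norm q / (1 - norm q)))"
proof -
  define r where "r = norm q"
  have r: "0 \<le> r" "r < 1" using q by (auto simp: r_def)
  have fin: "norm (over_prod m q) \<le> over_prod m r * exp (2 * Re (\<Sum>k<m. q ^ Suc k) - 2 * (\<Sum>k<m. r ^ Suc k))" for m
  proof (induction m)
    case (Suc m)
    have "norm (over_prod (Suc m) q) = norm (over_prod m q) * norm ((1 + q ^ Suc m) / (1 - q ^ Suc m))"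
      by (simp add: over_prod_Suc norm_mult norm_divide)
    also have "\<dots> \<le> (over_prod m r * exp (2 * Re (\<Sum>k<m. q ^ Suc k) - 2 * (\<Sum>k<m. r ^ Suc k))) *
         ((1 + norm (q ^ Suc m)) / (1 - norm (q ^ Suc m)) * exp (2 * Re (q ^ Suc m) - 2 * norm (q ^ Suc m)))"
      using over_prod_real_bounds(1)[OF r, of m]
      by (intro mult_mono Suc.IH norm_factor_refined norm_power_less_one q) auto
    also have "norm (q ^ Suc m) = r ^ Suc m" by (simp only: norm_power r_def)
    also have "(over_prod m r * exp (2 * Re (\<Sum>k<m. q ^ Suc k) - 2 * (\<Sum>k<m. r ^ Suc k))) *
         ((1 + r ^ Suc m) / (1 - r ^ Suc m) * exp (2 * Re (q ^ Suc m) - 2 * r ^ Suc m)) =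
        over_prod (Suc m) r * (exp (2 * Re (\<Sum>k<m. q ^ Suc k) - 2 * (\<Sum>k<m. r ^ Suc k)) * exp (2 * Re (q ^ Suc m) - 2 * r ^ Suc m))"
      by (simp only: over_prod_Suc mult_ac)
    also have "exp (2 * Re (\<Sum>k<m. q ^ Suc k) - 2 * (\<Sum>k<m. r ^ Suc k)) * exp (2 * Re (q ^ Suc m) - 2 * r ^ Suc m) =
        exp (2 * Re (\<Sum>k<Suc m. q ^ Suc k) - 2 * (\<Sum>k<Suc m. r ^ Suc k))"
      by (simp only: exp_add[symmetric] sum.lessThan_Suc plus_complex.sel) (simp add: algebra_simps)
    finally show ?case .
  qed simp
  have geo_q: "(\<lambda>m. \<Sum>k<m. q ^ Suc k) \<longlonglongrightarrow> q / (1 - q)"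
    using sums_mult[OF geometric_sums[OF q], of q] by (simp add: sums_def)
  have geo_r: "(\<lambda>m. \<Sum>k<m. r ^ Suc k) \<longlonglongrightarrow> r / (1 - r)"
    using sums_mult[OF geometric_sums[of r], of r] r by (simp add: sums_def)
  have "norm (over_gf q) \<le> over_gf r * exp (2 * Re (q / (1 - q)) - 2 * (r / (1 - r)))"
  proof (rule tendsto_le[OF sequentially_bot])
    show "(\<lambda>m. norm (over_prod m q)) \<longlonglongrightarrow> norm (over_gf q)"
      by (intro tendsto_norm over_prod_tendsto q)
    show "(\<lambda>m. over_prod m r * exp (2 * Re (\<Sum>k<m. q ^ Suc k) - 2 * (\<Sum>k<m. r ^ Suc k))) \<longlonglongrightarrow>
            over_gf r * exp (2 * Re (q / (1 - q)) - 2 * (r / (1 - r)))"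
      by (intro tendsto_mult tendsto_exp tendsto_diff tendsto_const tendsto_Re geo_q geo_r over_prod_tendsto) (use r in auto)
  qed (use fin in auto)
  then show ?thesis by (simp add: r_def)
qed

text \<open>Outside the sector, |1 - q| is at least 5/4 (1 - r). The exponent in
  \<open>norm_over_gf_refined\<close> is therefore at most -(2/5) r/(1 - r), and r >= 5/6 with 1 - r
  <= s turns this into -1/(3s).\<close>

lemma minor_arc_bound:
  assumes t: "0 < Re t" "Re t \<le> 1 / 6" "\<bar>Im t\<bar> \<le> pi" and minor: "norm t > 2 * Re t"
  shows "norm (over_gf (exp (- t))) \<le> over_gf (exp (- Re t)) * exp (- (1 / (3 * Re t)))"
proof -
  define s \<theta> where "s = Re t" and "\<theta> = Im t"
  define q r where "q = exp (- t)" and "r = exp (- s)"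
  have s: "0 < s" "s \<le> 1 / 6" using t by (auto simp: s_def)
  have nq: "norm q = r" by (simp add: q_def r_def s_def norm_exp_eq_Re)
  have r1: "r < 1" using s by (simp add: r_def)
  have r2: "1 - r \<le> s" using exp_ge_add_one_self[of "- s"] by (simp add: r_def)
  have r3: "r \<ge> 5 / 6" using r2 s by simp
  have th: "\<theta>\<^sup>2 \<ge> 3 * s\<^sup>2"
  proof -
    have "(2 * s)\<^sup>2 < (norm t)\<^sup>2" using minor s unfolding s_def by (intro power_strict_mono) auto
    then show ?thesis by (simp add: cmod_power2 s_def \<theta>_def power_mult_distrib)
  qed
  have sin2: "(sin (\<theta> / 2))\<^sup>2 \<ge> (\<theta> / pi)\<^sup>2"
  proof -
    have "2 * (\<bar>\<theta>\<bar> / 2) / pi \<le> sin (\<bar>\<theta>\<bar> / 2)"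
      using t by (intro jordan_inequality) (auto simp: \<theta>_def)
    then have "(\<bar>\<theta>\<bar> / pi)\<^sup>2 \<le> (sin (\<bar>\<theta>\<bar> / 2))\<^sup>2"
      by (intro power_mono) auto
    moreover have "(sin (\<bar>\<theta>\<bar> / 2))\<^sup>2 = (sin (\<theta> / 2))\<^sup>2"
      by (cases "\<theta> \<ge> 0") auto
    ultimately show ?thesis by (simp add: power_divide)
  qed
  have "q = of_real r * cis (- \<theta>)"
    by (simp add: q_def r_def s_def \<theta>_def exp_eq_polar)
  then have "Re (1 - q) = 1 - r * cos \<theta>" "Im (1 - q) = r * sin \<theta>"
    by auto
  then have "(norm (1 - q))\<^sup>2 = (1 - r * cos \<theta>)\<^sup>2 + (r * sin \<theta>)\<^sup>2"
    by (simp only: cmod_power2)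
  also have "\<dots> = 1 - 2 * r * cos \<theta> + r\<^sup>2 * ((sin \<theta>)\<^sup>2 + (cos \<theta>)\<^sup>2)"
    by (simp only: power2_diff power_mult_distrib distrib_left) simp
  also have "\<dots> = 1 - 2 * r * cos \<theta> + r\<^sup>2" by simp
  also have "cos \<theta> = 1 - 2 * (sin (\<theta> / 2))\<^sup>2"
    using cos_double_sin[of "\<theta> / 2"] by simp
  also have "1 - 2 * r * (1 - 2 * (sin (\<theta> / 2))\<^sup>2) + r\<^sup>2 = (1 - r)\<^sup>2 + 4 * r * (sin (\<theta> / 2))\<^sup>2"
    by (simp add: power2_eq_square algebra_simps)
  \<comment> \<open>Here 5/8 = 4 (5/6) (3/16), from r >= 5/6, from |Im t|^2 >= 3 s^2 and from pi <=
    4. The total 1 + 5/8 exceeds (5/4)^2 = 25/16.\<close>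
  also have "\<dots> \<ge> (1 - r)\<^sup>2 + 5 / 8 * (1 - r)\<^sup>2"
  proof -
    have "pi\<^sup>2 \<le> 4\<^sup>2" using pi_less_4 by (intro power_mono) auto
    then have "3 * s\<^sup>2 / 16 \<le> \<theta>\<^sup>2 / pi\<^sup>2"
      using th by (intro frac_le) auto
    then have "3 * s\<^sup>2 / 16 \<le> (sin (\<theta> / 2))\<^sup>2"
      using sin2 unfolding power_divide by linarith
    then have "4 * (5 / 6) * (3 * s\<^sup>2 / 16) \<le> 4 * r * (sin (\<theta> / 2))\<^sup>2"
      using r3 by (intro mult_mono[of "4 * (5 / 6)" "4 * r"]) auto
    moreover have "(1 - r)\<^sup>2 \<le> s\<^sup>2" using r1 r2 by (intro power_mono) auto
    ultimately show ?thesis by simp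
  qed
  finally have "(1 - r)\<^sup>2 + 5 / 8 * (1 - r)\<^sup>2 \<le> (norm (1 - q))\<^sup>2" .
  moreover have "(5 / 4 * (1 - r))\<^sup>2 = 25 / 16 * (1 - r)\<^sup>2"
    by (simp only: power_mult_distrib power_divide) simp
  ultimately have "(5 / 4 * (1 - r))\<^sup>2 \<le> (norm (1 - q))\<^sup>2"
    using zero_le_power2[of "1 - r"] by linarith
  then have n1: "5 / 4 * (1 - r) \<le> norm (1 - q)"
    by (rule power2_le_imp_le) simp
  have "Re (q / (1 - q)) \<le> r / norm (1 - q)"
    using complex_Re_le_cmod[of "q / (1 - q)"] by (simp add: norm_divide nq)
  also have "\<dots> \<le> r / (5 / 4 * (1 - r))"
    using n1 r1 r3 by (intro divide_left_mono mult_pos_pos) auto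
  also have "\<dots> = 4 / 5 * (r / (1 - r))" by simp
  finally have "2 * Re (q / (1 - q)) - 2 * (r / (1 - r)) \<le> - (2 / 5 * (r / (1 - r)))"
    by linarith
  also have "\<dots> \<le> - (2 / 5 * ((5 / 6) / s))"
    using r1 r2 r3 s by (intro le_imp_neg_le mult_left_mono frac_le) auto
  also have "\<dots> = - (1 / (3 * s))" by simp
  finally have *: "2 * Re (q / (1 - q)) - 2 * (r / (1 - r)) \<le> - (1 / (3 * s))" .
  have "norm (over_gf q) \<le> over_gf r * exp (2 * Re (q / (1 - q)) - 2 * (r / (1 - r)))"
    using norm_over_gf_refined[of q] nq r1 by simp
  also have "\<dots> \<le> over_gf r * exp (- (1 / (3 * s)))"
    using over_gf_real_ge_1[of r] r1 r3 * by (intro mult_left_mono) auto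
  finally show ?thesis by (simp add: q_def r_def s_def)
qed

section \<open>The major arc and the estimate on the whole circle\<close>

text \<open>On the right half-plane the principal root has positive real part, and so has its
  reciprocal, which selects the correct branch.\<close>

lemma csqrt_divide_pos:
  assumes "Re t > 0" "a > 0"
  shows "csqrt (of_real (a\<^sup>2) / t) = of_real a / csqrt t"
proof -
  have "t \<noteq> 0" using assms by auto
  have "Re (csqrt t) > 0"
    using norm_ge_zero[of t] assms by (simp add: add_nonneg_pos)
  then have "Re (of_real a / csqrt t) > 0"
    using assms \<open>t \<noteq> 0\<close> by (subst Re_inverse_pos) auto
  then have "csqrt ((of_real a / csqrt t)\<^sup>2) = of_real a / csqrt t"
    by (intro csqrt_square) auto
  then show ?thesis by (simp add: power_divide)
qed

text \<open>With y = pi^2/(4t), inversion writes \<open>over_gf\<close> as sqrt t exp y / (2L)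
  divided by \<open>tri_gf\<close> = 1 + O(exp(-8 Re y)); in the sector Re y >= 1, so this
  correction is absolutely bounded. \<open>kummer_asymptotics\<close> has the same leading term up
  to a constant factor.\<close>

lemma major_arc_approximation:
  obtains \<kappa> C :: real where "\<kappa> > 0" "C \<ge> 0"
    "\<And>t. 0 < Re t \<Longrightarrow> Re t \<le> 1 / 6 \<Longrightarrow> norm t \<le> 2 * Re t \<Longrightarrow>
       norm (over_gf (exp (- t)) - of_real \<kappa> * kummer (of_real (pi\<^sup>2 / 4) / t)) \<le> C"
proof -
  obtain L where L: "L > 0" and inv: "\<And>t. Re t > 0 \<Longrightarrow>
       over_gf (exp (- t)) * (2 * of_real L / csqrt t) * exp (- (of_real (pi\<^sup>2 / 4) / t)) *
         tri_gf (exp (- 8 * (of_real (pi\<^sup>2 / 4) / t))) = 1"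
    using theta_inversion by blast
  obtain c where c: "c > 0" and ka: "\<And>y. Re y \<ge> 1 \<Longrightarrow> norm (kummer y - of_real c * exp y / csqrt y) \<le> 1"
    using kummer_asymptotics by blast
  \<comment> \<open>As csqrt y = (pi/2) / sqrt t, the leading term of \<open>kummer y\<close> is
    (2c/pi) sqrt t exp y; this factor scales it to sqrt t exp y / (2L).\<close>
  define \<kappa> where "\<kappa> = pi / (4 * L * c)"
  have kap: "\<kappa> > 0" using L c by (simp add: \<kappa>_def)
  define C where "C = 2 / L + \<kappa>"
  have "norm (over_gf (exp (- t)) - of_real \<kappa> * kummer (of_real (pi\<^sup>2 / 4) / t)) \<le> C"
    if t: "0 < Re t" "Re t \<le> 1 / 6" "norm t \<le> 2 * Re t" for t
  proof -
    define y where "y = of_real (pi\<^sup>2 / 4) / t"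
    have "t \<noteq> 0" using t by auto
    have Rey: "Re y = pi\<^sup>2 / 4 * Re t / (norm t)\<^sup>2"
      unfolding y_def by (rule Re_inverse_pos[OF t(1)])
    have Re1: "Re y \<ge> 1"
    proof -
      have "(norm t)\<^sup>2 \<le> (2 * Re t)\<^sup>2" using t by (intro power_mono) auto
      also have "\<dots> = 4 * Re t * Re t" by (simp add: power2_eq_square)
      also have "\<dots> \<le> 4 * (1 / 6) * Re t" using t by (intro mult_right_mono) auto
      also have "\<dots> \<le> 9 / 4 * Re t" using t by simp
      also have "\<dots> \<le> pi\<^sup>2 / 4 * Re t"
        using power_mono[of 3 pi 2] pi_gt3 t by (intro mult_right_mono) auto
      finally show ?thesis
        unfolding Rey using \<open>t \<noteq> 0\<close> by (simp add: field_simps)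
    qed
    define s where "s = csqrt t"
    have s: "s \<noteq> 0" using \<open>t \<noteq> 0\<close> by (simp add: s_def)
    define A where "A = s * exp y / (2 * of_real L)"
    define \<Phi> where "\<Phi> = tri_gf (exp (- 8 * y))"
    define x where "x = norm (exp (- 8 * y))"
    have x: "x = exp (- 8 * Re y)" by (simp add: x_def norm_exp_eq_Re)
    have "x \<le> exp (- 8)" using Re1 by (simp add: x)
    also have "\<dots> \<le> 1 / 9" using exp_ge_add_one_self[of 8] by (simp add: exp_minus field_simps)
    finally have x9: "x \<le> 1 / 9" .
    have x0: "x \<ge> 0" by (simp add: x_def)
    have "norm (\<Phi> - 1) \<le> x / (1 - x)"
      unfolding \<Phi>_def x_def by (rule norm_tri_gf_minus_1) (use x9 in \<open>unfold x_def, linarith\<close>)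
    also have "\<dots> \<le> x / (1 / 2)"
      using x9 x0 by (intro divide_left_mono) auto
    finally have P1: "norm (\<Phi> - 1) \<le> 2 * x" by simp
    have P2: "norm \<Phi> \<ge> 1 / 2"
      using norm_triangle_ineq2[of 1 "1 - \<Phi>"] P1 x9 by (simp add: norm_minus_commute)
    then have "\<Phi> \<noteq> 0" by auto
    have "over_gf (exp (- t)) * (2 * of_real L / s) * exp (- y) * \<Phi> = 1"
      using inv[OF t(1)] by (simp only: s_def y_def \<Phi>_def)
    then have PA: "over_gf (exp (- t)) = A / \<Phi>"
      using s L \<open>\<Phi> \<noteq> 0\<close> by (simp add: A_def field_simps exp_minus)
    have "norm (A / \<Phi> - A) = norm A * norm (\<Phi> - 1) / norm \<Phi>"
    proof -
      have "A / \<Phi> - A = A * (1 - \<Phi>) / \<Phi>" using \<open>\<Phi> \<noteq> 0\<close> by (simp add: field_simps)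
      then show ?thesis by (simp add: norm_mult norm_divide norm_minus_commute)
    qed
    also have "\<dots> \<le> norm A * (2 * x) / (1 / 2)"
      using P1 P2 x0 by (intro frac_le mult_left_mono) auto
    also have "\<dots> = 2 / L * norm s * (exp (Re y) * x)"
      using L by (simp add: A_def norm_mult norm_divide norm_exp_eq_Re)
    also have "\<dots> \<le> 2 / L * 1 * 1"
    proof (intro mult_mono)
      have "norm t \<le> 1" using t by simp
      then show "norm s \<le> 1" by (simp add: s_def)
      show "exp (Re y) * x \<le> 1" using Re1 unfolding x by (simp flip: exp_add)
    qed (use L x0 in auto)
    finally have D1: "norm (over_gf (exp (- t)) - A) \<le> 2 / L" by (simp add: PA)
    have cy: "csqrt y = of_real (pi / 2) / s"
      unfolding y_def s_def using csqrt_divide_pos[OF t(1), of "pi / 2"] by (simp add: power_divide)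
    have "of_real \<kappa> * (of_real c * exp y / csqrt y) = A"
      unfolding cy using s L c by (simp add: \<kappa>_def A_def field_simps)
    then have "of_real \<kappa> * kummer y - A = of_real \<kappa> * (kummer y - of_real c * exp y / csqrt y)"
      by (simp add: right_diff_distrib)
    then have "norm (of_real \<kappa> * kummer y - A) = \<kappa> * norm (kummer y - of_real c * exp y / csqrt y)"
      using kap by (simp add: norm_mult)
    also have "\<dots> \<le> \<kappa> * 1" using ka[OF Re1] kap by (intro mult_left_mono) auto
    finally have D2: "norm (of_real \<kappa> * kummer y - A) \<le> \<kappa>" by simp
    have "norm (over_gf (exp (- t)) - of_real \<kappa> * kummer y) \<le> norm (over_gf (exp (- t)) - A) + norm (of_real \<kappa> * kummer y - A)"
      using norm_triangle_ineq4[of "over_gf (exp (- t)) - A" "of_real \<kappa> * kummer y - A"] by simp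
    then show ?thesis using D1 D2 unfolding C_def y_def by linarith
  qed
  moreover have "C \<ge> 0" using L kap by (simp add: C_def)
  ultimately show ?thesis using kap that by blast
qed


text \<open>In the sector the difference is bounded. Outside it, the two functions are small
  separately: \<open>over_gf\<close> by the gain 1/(3s), and Kummer's function because |y| <
  pi^2/(8s), which is below (pi^2/4 - 1/3)/s.\<close>

lemma circle_estimate:
  obtains \<kappa> K :: real where "\<kappa> > 0" "K \<ge> 0"
    "\<And>t. 0 < Re t \<Longrightarrow> Re t \<le> 1 / 6 \<Longrightarrow> \<bar>Im t\<bar> \<le> pi \<Longrightarrow>
       norm (over_gf (exp (- t)) - of_real \<kappa> * main_gf (exp (- t))) \<le> K * exp ((pi\<^sup>2 / 4 - 1 / 3) / Re t)"
proof -
  obtain \<kappa> C1 :: real where kap: "\<kappa> > 0" and C1: "C1 \<ge> 0" and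
    major: "\<And>t. 0 < Re t \<Longrightarrow> Re t \<le> 1 / 6 \<Longrightarrow> norm t \<le> 2 * Re t \<Longrightarrow>
       norm (over_gf (exp (- t)) - of_real \<kappa> * kummer (of_real (pi\<^sup>2 / 4) / t)) \<le> C1"
    using major_arc_approximation by metis
  obtain C2 where C2: "C2 \<ge> 0" and
    mk: "\<And>t. 0 < Re t \<Longrightarrow> Re t \<le> 1 \<Longrightarrow> \<bar>Im t\<bar> \<le> pi \<Longrightarrow>
       norm (main_gf (exp (- t)) - (kummer (of_real (pi\<^sup>2 / 4) / t) - 1)) \<le> C2"
    using main_gf_kummer by blast
  define K where "K = (C1 + \<kappa>) + \<kappa> * (C2 + 2)"
  have K0: "K \<ge> 0" using kap C1 C2 by (simp add: K_def)
  have pi9: "pi\<^sup>2 \<ge> 9" using power_mono[of 3 pi 2] pi_gt3 by simp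
  have "norm (over_gf (exp (- t)) - of_real \<kappa> * main_gf (exp (- t))) \<le> K * exp ((pi\<^sup>2 / 4 - 1 / 3) / Re t)"
    if t: "0 < Re t" "Re t \<le> 1 / 6" "\<bar>Im t\<bar> \<le> pi" for t
  proof -
    define y where "y = of_real (pi\<^sup>2 / 4) / t"
    define M P where "M = main_gf (exp (- t))" and "P = (over_gf (exp (- t)) :: complex)"
    define E where "E = exp ((pi\<^sup>2 / 4 - 1 / 3) / Re t)"
    have E1: "E \<ge> 1" using pi9 t by (simp add: E_def)
    have mk': "norm (M - (kummer y - 1)) \<le> C2" using mk[of t] t by (simp add: M_def y_def)
    show ?thesis
    proof (cases "norm t \<le> 2 * Re t")
      case True
      have "P - of_real \<kappa> * M = (P - of_real \<kappa> * kummer y) - of_real \<kappa> * (M - (kummer y - 1)) + of_real \<kappa>"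
        by (simp add: algebra_simps)
      then have "norm (P - of_real \<kappa> * M) \<le> norm (P - of_real \<kappa> * kummer y) + norm (of_real \<kappa> * (M - (kummer y - 1))) + norm (complex_of_real \<kappa>)"
        by (simp only:) (rule order_trans[OF norm_triangle_ineq add_right_mono[OF norm_triangle_ineq4]])
      also have "\<dots> \<le> C1 + \<kappa> * C2 + \<kappa>"
      proof (intro add_mono)
        show "norm (P - of_real \<kappa> * kummer y) \<le> C1" unfolding P_def y_def by (rule major[OF t(1,2) True])
        show "norm (of_real \<kappa> * (M - (kummer y - 1))) \<le> \<kappa> * C2"
          using mk' kap by (simp add: norm_mult)
      qed (use kap in simp)
      also have "\<dots> \<le> K * 1" using kap C1 C2 by (simp add: K_def algebra_simps)
      also have "\<dots> \<le> K * E" using E1 K0 by (intro mult_left_mono)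
      finally show ?thesis by (simp add: P_def M_def E_def)
    next
      case False
      define s where "s = Re t"
      have s: "s > 0" "s \<le> 1 / 6" using t by (auto simp: s_def)
      \<comment> \<open>The size on the positive axis, which the minor arc bound refers to, follows
        from the major arc estimate at the real point s.\<close>
      have Ps: "over_gf (exp (- s)) \<le> (C1 + \<kappa>) * exp (pi\<^sup>2 / 4 / s)"
      proof -
        have "exp (- complex_of_real s) = of_real (exp (- s))" by (simp add: exp_of_real[symmetric])
        then have "complex_of_real (over_gf (exp (- s))) = over_gf (exp (- complex_of_real s))"
          using over_gf_of_real[of "exp (- s)"] s by simp
        moreover have "norm (over_gf (exp (- complex_of_real s)) - of_real \<kappa> * kummer (of_real (pi\<^sup>2 / 4) / of_real s)) \<le> C1"
          using s by (intro major) auto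
        ultimately have "norm (complex_of_real (over_gf (exp (- s))) - of_real \<kappa> * kummer (of_real (pi\<^sup>2 / 4) / of_real s)) \<le> C1"
          by simp
        then have "norm (complex_of_real (over_gf (exp (- s)))) \<le> C1 + norm (of_real \<kappa> * kummer (of_real (pi\<^sup>2 / 4) / of_real s))"
          using norm_triangle_ineq2 by (smt (verit))
        also have "norm (of_real \<kappa> * kummer (of_real (pi\<^sup>2 / 4) / of_real s)) \<le> \<kappa> * exp (norm (complex_of_real (pi\<^sup>2 / 4) / of_real s))"
          unfolding norm_mult using kap by (intro mult_mono norm_kummer_le) auto
        also have "norm (complex_of_real (pi\<^sup>2 / 4) / of_real s) = pi\<^sup>2 / 4 / s"
          using s by (simp add: norm_divide norm_power)
        finally have "over_gf (exp (- s)) \<le> C1 * 1 + \<kappa> * exp (pi\<^sup>2 / 4 / s)" by simp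
        also have "\<dots> \<le> C1 * exp (pi\<^sup>2 / 4 / s) + \<kappa> * exp (pi\<^sup>2 / 4 / s)"
          using C1 s kap by (intro add_mono mult_left_mono) auto
        finally show ?thesis by (simp add: distrib_right)
      qed
      have "norm P \<le> over_gf (exp (- s)) * exp (- (1 / (3 * s)))"
        unfolding P_def s_def using t False by (intro minor_arc_bound) auto
      also have "\<dots> \<le> (C1 + \<kappa>) * exp (pi\<^sup>2 / 4 / s) * exp (- (1 / (3 * s)))"
        by (intro mult_right_mono Ps) auto
      also have "\<dots> = (C1 + \<kappa>) * E"
        by (simp add: E_def s_def mult.assoc diff_divide_distrib flip: exp_add)
      finally have n1: "norm P \<le> (C1 + \<kappa>) * E" .
      have "norm (kummer y) \<le> exp (norm y)" by (rule norm_kummer_le)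
      also have "norm y = pi\<^sup>2 / 4 / norm t" by (simp add: y_def norm_divide norm_power)
      also have "exp \<dots> \<le> E"
      proof -
        have "pi\<^sup>2 / 4 / norm t \<le> pi\<^sup>2 / 4 / (2 * s)"
          using False s t unfolding s_def by (intro divide_left_mono mult_pos_pos) auto
        also have "\<dots> = (pi\<^sup>2 / 8) / s" by simp
        also have "\<dots> \<le> (pi\<^sup>2 / 4 - 1 / 3) / s" using pi9 s by (intro divide_right_mono) auto
        finally show ?thesis by (simp add: E_def s_def)
      qed
      finally have k1: "norm (kummer y) \<le> E" .
      have "norm M \<le> norm (M - (kummer y - 1)) + norm (kummer y - 1)"
        using norm_triangle_ineq[of "M - (kummer y - 1)" "kummer y - 1"] by simp
      also have "\<dots> \<le> C2 + (E + 1)"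
        using mk' k1 norm_triangle_ineq4[of "kummer y" 1] by (intro add_mono) auto
      also have "\<dots> \<le> C2 * E + (E + E)"
        using C2 E1 mult_left_mono[of 1 E C2] by (intro add_mono) auto
      finally have n2: "norm M \<le> (C2 + 2) * E" by (simp add: algebra_simps)
      have "norm (P - of_real \<kappa> * M) \<le> norm P + \<kappa> * norm M"
        using norm_triangle_ineq4[of P "of_real \<kappa> * M"] kap by (simp add: norm_mult)
      also have "\<dots> \<le> (C1 + \<kappa>) * E + \<kappa> * ((C2 + 2) * E)"
        using n1 n2 kap by (intro add_mono mult_left_mono) auto
      also have "\<dots> = K * E" by (simp add: K_def algebra_simps)
      finally show ?thesis by (simp add: P_def M_def E_def)
    qed
  qed
  with kap K0 show ?thesis using that by blast
qed

section \<open>From the circle to the coefficients\<close>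

lemma power_series_coeff_bound:
  fixes f :: "complex \<Rightarrow> complex" and a :: "nat \<Rightarrow> complex"
  assumes sums: "\<And>q. norm q < 1 \<Longrightarrow> (\<lambda>n. a n * q ^ n) sums f q"
    and r: "0 < r" "r < 1" and B: "\<And>q. norm q = r \<Longrightarrow> norm (f q) \<le> B"
  shows "norm (a n) \<le> B / r ^ n"
proof -
  have hol: "f holomorphic_on ball 0 1"
    by (rule power_series_holomorphic[of _ _ a]) (use sums in auto)
  have "f has_fps_expansion Abs_fps a"
  proof (rule has_fps_expansionI)
    have "\<forall>\<^sub>F u in nhds (0::complex). u \<in> ball 0 1" by (intro eventually_nhds_in_open) auto
    then show "\<forall>\<^sub>F u in nhds 0. (\<lambda>n. fps_nth (Abs_fps a) n * u ^ n) sums f u"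
      by eventually_elim (use sums in auto)
  qed
  from fps_nth_fps_expansion[OF this, of n] have "a n = (deriv ^^ n) f 0 / fact n" by simp
  moreover have "norm ((deriv ^^ n) f 0) \<le> fact n * B / r ^ n"
  proof (rule Cauchy_inequality)
    show "f holomorphic_on ball 0 r" using r by (intro holomorphic_on_subset[OF hol]) auto
    show "continuous_on (cball 0 r) f"
      using r by (intro holomorphic_on_imp_continuous_on holomorphic_on_subset[OF hol]) auto
  qed (use r B in auto)
  then have "norm ((deriv ^^ n) f 0) / fact n \<le> (fact n * B / r ^ n) / fact n"
    by (rule divide_right_mono) simp
  ultimately have "norm (a n) \<le> (fact n * B / r ^ n) / fact n"
    by (simp add: norm_divide)
  then show ?thesis by simp
qed

lemma main_gf_sums:
  assumes "norm q < 1"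
  shows "(\<lambda>n. of_real (main_term n) * q ^ n) sums main_gf q"
proof (cases "q = 0")
  case True
  then show ?thesis
    using powser_sums_zero[of "\<lambda>n. complex_of_real (main_term n)"] by (simp add: main_gf_def)
next
  case False
  have "summable (\<lambda>n. main_term n * exp (- (- ln (norm q))) ^ n)"
    using assms False by (intro main_gf_summable) simp
  then have "summable (\<lambda>n. norm (of_real (main_term n) * q ^ n))"
    using False by (simp add: norm_mult norm_power main_term_nonneg)
  then show ?thesis
    unfolding main_gf_def by (rule summable_sums[OF summable_norm_cancel])
qed

text \<open>Cauchy's inequality costs exp(ns) on the circle of radius exp(-s). Since
  \<open>main_term n\<close> has size exp(pi sqrt n)/n, the saving 2/(3 pi) in the exponent makes
  the relative error exponentially small in sqrt n.\<close>

lemma overp_asymptotics: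
  obtains \<kappa> K :: real where "\<kappa> > 0" "K \<ge> 0"
    "\<And>n. n \<ge> 144 \<Longrightarrow> \<bar>real (overp n) - \<kappa> * main_term n\<bar> \<le> K * exp ((pi - 2 / (3 * pi)) * sqrt (real n))"
proof -
  obtain \<kappa> K :: real where kap: "\<kappa> > 0" and K: "K \<ge> 0" and
    ce: "\<And>t. 0 < Re t \<Longrightarrow> Re t \<le> 1 / 6 \<Longrightarrow> \<bar>Im t\<bar> \<le> pi \<Longrightarrow>
       norm (over_gf (exp (- t)) - of_real \<kappa> * main_gf (exp (- t))) \<le> K * exp ((pi\<^sup>2 / 4 - 1 / 3) / Re t)"
    using circle_estimate by metis
  have "\<bar>real (overp n) - \<kappa> * main_term n\<bar> \<le> K * exp ((pi - 2 / (3 * pi)) * sqrt (real n))" if n: "n \<ge> 144" for n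
  proof -
    \<comment> \<open>This s minimises pi^2/(4s) + ns, with minimum pi sqrt n, and the gain (1/3)/s
      becomes (2/(3 pi)) sqrt n. For n >= 144 one has s <= pi/24 < 1/6.\<close>
    define s where "s = pi / (2 * sqrt (real n))"
    define B where "B = K * exp ((pi\<^sup>2 / 4 - 1 / 3) / s)"
    have "sqrt 144 \<le> sqrt (real n)" using n by (intro real_sqrt_le_mono) simp
    moreover have "sqrt 144 = (12 :: real)" by (rule real_sqrt_unique) auto
    ultimately have sq: "sqrt (real n) \<ge> 12" by simp
    have s: "s > 0" "s \<le> 1 / 6"
      using sq n pi_less_4 by (auto simp: s_def divide_le_eq intro!: divide_pos_pos)
    have "norm (of_real (real (overp n) - \<kappa> * main_term n) :: complex) \<le> B / exp (- s) ^ n"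
    proof (rule power_series_coeff_bound[where f = "\<lambda>q. over_gf q - of_real \<kappa> * main_gf q"])
      fix q :: complex assume q: "norm q < 1"
      have "(\<lambda>n. of_nat (overp n) * q ^ n) sums over_gf q"
        unfolding over_gf_def by (intro summable_sums overp_summable q)
      from sums_diff[OF this sums_mult[OF main_gf_sums[OF q], of "of_real \<kappa>"]]
      show "(\<lambda>n. of_real (real (overp n) - \<kappa> * main_term n) * q ^ n) sums (over_gf q - of_real \<kappa> * main_gf q)"
        by (simp add: algebra_simps)
    next
      fix q :: complex assume q: "norm q = exp (- s)"
      \<comment> \<open>The principal logarithm keeps Im t within [-pi, pi], the range covered by
        \<open>ce\<close>.\<close>
      define t where "t = - Ln q"
      have "q \<noteq> 0" using q by auto
      then have "q = exp (- t)" "Re t = s" "\<bar>Im t\<bar> \<le> pi"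
        using q mpi_less_Im_Ln[of q] Im_Ln_le_pi[of q] by (auto simp: t_def)
      then show "norm (over_gf q - of_real \<kappa> * main_gf q) \<le> B"
        using ce[of t] s by (simp add: B_def)
    qed (use s in auto)
    also have "B / exp (- s) ^ n = K * exp ((pi\<^sup>2 / 4 - 1 / 3) / s + real n * s)"
    proof -
      have "exp (- s) ^ n = exp (- (real n * s))" using exp_of_nat_mult[of n "- s"] by simp
      then show ?thesis by (simp add: B_def exp_add exp_minus field_simps)
    qed
    also have "(pi\<^sup>2 / 4 - 1 / 3) / s + real n * s = (pi - 2 / (3 * pi)) * sqrt (real n)"
    proof -
      define w where "w = sqrt (real n)"
      have w: "w > 0" "real n = w * w" using sq n by (auto simp: w_def)
      show ?thesis unfolding s_def w_def[symmetric] w(2) using w(1)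
        by (simp add: field_simps power2_eq_square)
    qed
    finally show ?thesis by (simp only: norm_of_real)
  qed
  with kap K show ?thesis using that by blast
qed

section \<open>Sequences with expansions in powers of the inverse square root\<close>

text \<open>Since K is arbitrary, the bound 1 is as strong as convergence to 0: any constant or
  further power is absorbed by a larger K. The same remark justifies the constant 1 in
  \<open>poly_bounded\<close>.\<close>

definition negligible_seq :: "(nat \<Rightarrow> complex) \<Rightarrow> bool" where
  "negligible_seq e \<longleftrightarrow> (\<forall>K. \<forall>\<^sub>F n in sequentially. norm (e n) * real n ^ K \<le> 1)"

definition poly_bounded :: "(nat \<Rightarrow> complex) \<Rightarrow> bool" where
  "poly_bounded y \<longleftrightarrow> (\<exists>K. \<forall>\<^sub>F n in sequentially. norm (y n) \<le> real n ^ K)"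

lemma negligible_seq_mono:
  assumes "negligible_seq f" "\<forall>\<^sub>F n in sequentially. norm (e n) \<le> norm (f n)"
  shows "negligible_seq e"
  unfolding negligible_seq_def
proof
  fix K
  show "\<forall>\<^sub>F n in sequentially. norm (e n) * real n ^ K \<le> 1"
    using assms(1)[unfolded negligible_seq_def, rule_format, of K] assms(2)
    by eventually_elim (meson mult_right_mono of_nat_0_le_iff order_trans zero_le_power)
qed

lemma negligible_seq_add:
  assumes "negligible_seq e" "negligible_seq f"
  shows "negligible_seq (\<lambda>n. e n + f n)"
  unfolding negligible_seq_def
proof
  fix K
  show "\<forall>\<^sub>F n in sequentially. norm (e n + f n) * real n ^ K \<le> 1"
    \<comment> \<open>One additional power of n, with n >= 2, pays for the factor 2 of the
      sum.\<close>
    using assms(1)[unfolded negligible_seq_def, rule_format, of "Suc K"]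
      assms(2)[unfolded negligible_seq_def, rule_format, of "Suc K"] eventually_ge_at_top[of 2]
  proof eventually_elim
    case (elim n)
    have "norm (e n + f n) * real n ^ K * 2 \<le> (norm (e n) + norm (f n)) * real n ^ K * real n"
      using elim norm_triangle_ineq[of "e n" "f n"] by (intro mult_mono) auto
    also have "\<dots> = norm (e n) * real n ^ Suc K + norm (f n) * real n ^ Suc K"
      by (simp add: algebra_simps)
    also have "\<dots> \<le> 2" using elim by simp
    finally show ?case by simp
  qed
qed

lemma negligible_seq_mult:
  assumes "negligible_seq e" "poly_bounded y"
  shows "negligible_seq (\<lambda>n. e n * y n)"
  unfolding negligible_seq_def
proof
  fix K
  obtain k where k: "\<forall>\<^sub>F n in sequentially. norm (y n) \<le> real n ^ k"
    using assms(2) by (auto simp: poly_bounded_def)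
  show "\<forall>\<^sub>F n in sequentially. norm (e n * y n) * real n ^ K \<le> 1"
    using assms(1)[unfolded negligible_seq_def, rule_format, of "k + K"] k
  proof eventually_elim
    case (elim n)
    have "norm (e n * y n) * real n ^ K \<le> norm (e n) * real n ^ k * real n ^ K"
      unfolding norm_mult using elim by (intro mult_right_mono mult_left_mono) auto
    also have "\<dots> \<le> 1" using elim by (simp add: power_add mult.assoc)
    finally show ?case .
  qed
qed

lemma negligible_seq_Suc:
  assumes "negligible_seq e"
  shows "negligible_seq (\<lambda>n. e (Suc n))"
  unfolding negligible_seq_def
proof
  fix K
  have "\<forall>\<^sub>F n in sequentially. norm (e (Suc n)) * real (Suc n) ^ K \<le> 1"
    using assms[unfolded negligible_seq_def, rule_format, of K] eventually_sequentially_Suc[of "\<lambda>n. norm (e n) * real n ^ K \<le> 1"] by simp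
  then show "\<forall>\<^sub>F n in sequentially. norm (e (Suc n)) * real n ^ K \<le> 1"
  proof eventually_elim
    case (elim n)
    have "norm (e (Suc n)) * real n ^ K \<le> norm (e (Suc n)) * real (Suc n) ^ K"
      by (intro mult_left_mono power_mono) auto
    with elim show ?case by linarith
  qed
qed

lemma negligible_seq_0 [simp]: "negligible_seq (\<lambda>_. 0)"
  by (simp add: negligible_seq_def)

lemma negligible_seq_tendsto:
  assumes "negligible_seq e"
  shows "e \<longlonglongrightarrow> 0"
proof (rule Lim_null_comparison)
  show "\<forall>\<^sub>F n in sequentially. norm (e n) \<le> 1 / real n"
    using assms[unfolded negligible_seq_def, rule_format, of 1] eventually_gt_at_top[of 0]
    by eventually_elim (simp add: field_simps)
  show "(\<lambda>n. 1 / real n) \<longlonglongrightarrow> 0" by (rule lim_1_over_n)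
qed

lemma convergent_poly_bounded:
  assumes "y \<longlonglongrightarrow> l"
  shows "poly_bounded y"
proof -
  from tendsto_norm[OF assms] have "\<forall>\<^sub>F n in sequentially. norm (y n) < norm l + 1"
    by (rule order_tendstoD) simp
  moreover have "\<forall>\<^sub>F n in sequentially. norm l + 1 \<le> real n"
    using eventually_ge_at_top[of "nat \<lceil>norm l + 1\<rceil>"] by eventually_elim linarith
  ultimately have "\<forall>\<^sub>F n in sequentially. norm (y n) \<le> real n ^ 1"
    by eventually_elim simp
  then show ?thesis unfolding poly_bounded_def by blast
qed

section \<open>Calculus of analytic models in the inverse square root\<close>

definition inv_sqrt :: "nat \<Rightarrow> complex" where
  "inv_sqrt n = of_real (1 / sqrt (real n))"

text \<open>The model is a convergent analytic function instead of a truncated series, so no order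
  of precision has to be tracked through products, quotients and shifts.\<close>

definition asy :: "(complex \<Rightarrow> complex) \<Rightarrow> (nat \<Rightarrow> complex) \<Rightarrow> bool" where
  "asy f x \<longleftrightarrow> f analytic_on {0} \<and> negligible_seq (\<lambda>n. x n - f (inv_sqrt n))"

lemma inv_sqrt_tendsto: "inv_sqrt \<longlonglongrightarrow> 0"
proof -
  have "(\<lambda>n. sqrt (1 / real n)) \<longlonglongrightarrow> sqrt 0" by (intro tendsto_real_sqrt lim_1_over_n)
  then have "(\<lambda>n. complex_of_real (1 / sqrt (real n))) \<longlonglongrightarrow> of_real 0"
    by (intro tendsto_of_real) (simp add: real_sqrt_divide)
  then show ?thesis by (simp add: inv_sqrt_def[abs_def])
qed

lemma inv_sqrt_nonzero: "n > 0 \<Longrightarrow> inv_sqrt n \<noteq> 0"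
  by (simp add: inv_sqrt_def)

lemma analytic_inv_sqrt_tendsto:
  assumes "f analytic_on {0}"
  shows "(\<lambda>n. f (inv_sqrt n)) \<longlonglongrightarrow> f 0"
proof -
  have "isCont f 0" using assms by (intro analytic_at_imp_isCont)
  then show ?thesis using inv_sqrt_tendsto by (rule isCont_tendsto_compose)
qed

lemma asy_tendsto:
  assumes "asy f x"
  shows "x \<longlonglongrightarrow> f 0"
proof -
  have "(\<lambda>n. (x n - f (inv_sqrt n)) + f (inv_sqrt n)) \<longlonglongrightarrow> 0 + f 0"
    using assms unfolding asy_def by (intro tendsto_add negligible_seq_tendsto analytic_inv_sqrt_tendsto) auto
  then show ?thesis by simp
qed

lemma asy_exact:
  assumes "f analytic_on {0}" "\<forall>\<^sub>F n in sequentially. x n = f (inv_sqrt n)"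
  shows "asy f x"
  unfolding asy_def using assms
  by (auto intro!: negligible_seq_mono[OF negligible_seq_0] elim: eventually_mono)

lemma asy_cong:
  assumes "asy f x" "\<forall>\<^sub>F n in sequentially. x n = y n"
  shows "asy f y"
  unfolding asy_def
proof
  show "negligible_seq (\<lambda>n. y n - f (inv_sqrt n))"
    by (rule negligible_seq_mono[of "\<lambda>n. x n - f (inv_sqrt n)"])
       (use assms in \<open>auto simp: asy_def elim: eventually_mono\<close>)
qed (use assms in \<open>simp add: asy_def\<close>)

lemma asy_add:
  assumes "asy f x" "asy g y"
  shows "asy (\<lambda>z. f z + g z) (\<lambda>n. x n + y n)"
  using assms negligible_seq_add[of "\<lambda>n. x n - f (inv_sqrt n)" "\<lambda>n. y n - g (inv_sqrt n)"]
  unfolding asy_def by (auto intro!: analytic_intros simp: algebra_simps)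

lemma asy_mult:
  assumes "asy f x" "asy g y"
  shows "asy (\<lambda>z. f z * g z) (\<lambda>n. x n * y n)"
proof -
  have "negligible_seq (\<lambda>n. (x n - f (inv_sqrt n)) * y n)"
    using assms by (intro negligible_seq_mult convergent_poly_bounded[OF asy_tendsto]) (auto simp: asy_def)
  moreover have "negligible_seq (\<lambda>n. (y n - g (inv_sqrt n)) * f (inv_sqrt n))"
    using assms by (intro negligible_seq_mult convergent_poly_bounded[OF analytic_inv_sqrt_tendsto]) (auto simp: asy_def)
  ultimately have "negligible_seq (\<lambda>n. (x n - f (inv_sqrt n)) * y n + (y n - g (inv_sqrt n)) * f (inv_sqrt n))"
    by (rule negligible_seq_add)
  also have "(\<lambda>n. (x n - f (inv_sqrt n)) * y n + (y n - g (inv_sqrt n)) * f (inv_sqrt n)) = (\<lambda>n. x n * y n - f (inv_sqrt n) * g (inv_sqrt n))"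
    by (auto simp: algebra_simps)
  finally show ?thesis using assms unfolding asy_def by (auto intro!: analytic_intros)
qed

lemma asy_const: "asy (\<lambda>_. c) (\<lambda>_. c)"
  by (simp add: asy_def)

lemma asy_diff:
  assumes "asy f x" "asy g y"
  shows "asy (\<lambda>z. f z - g z) (\<lambda>n. x n - y n)"
  using asy_add[OF assms(1) asy_mult[OF asy_const[of "-1"] assms(2)]] by simp

lemma asy_power:
  assumes "asy f x"
  shows "asy (\<lambda>z. f z ^ k) (\<lambda>n. x n ^ k)"
proof (induction k)
  case 0
  then show ?case using asy_const[of 1] by simp
next
  case (Suc k)
  then show ?case using asy_mult[OF assms Suc] by simp
qed

lemma asy_inverse:
  assumes "asy f x" "f 0 \<noteq> 0"
  shows "asy (\<lambda>z. inverse (f z)) (\<lambda>n. inverse (x n))"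
proof -
  have lx: "x \<longlonglongrightarrow> f 0" by (rule asy_tendsto[OF assms(1)])
  have lf: "(\<lambda>n. f (inv_sqrt n)) \<longlonglongrightarrow> f 0" using assms by (intro analytic_inv_sqrt_tendsto) (simp add: asy_def)
  have "(\<lambda>n. - (inverse (x n) * inverse (f (inv_sqrt n)))) \<longlonglongrightarrow> - (inverse (f 0) * inverse (f 0))"
    by (intro tendsto_intros lx lf assms)
  then have "negligible_seq (\<lambda>n. (x n - f (inv_sqrt n)) * - (inverse (x n) * inverse (f (inv_sqrt n))))"
    using assms by (intro negligible_seq_mult convergent_poly_bounded) (auto simp: asy_def)
  moreover have "\<forall>\<^sub>F n in sequentially. norm (inverse (x n) - inverse (f (inv_sqrt n))) \<le> norm ((x n - f (inv_sqrt n)) * - (inverse (x n) * inverse (f (inv_sqrt n))))"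
    using tendsto_imp_eventually_ne[OF lx assms(2)] tendsto_imp_eventually_ne[OF lf assms(2)]
  proof eventually_elim
    case (elim n)
    then have "inverse (x n) - inverse (f (inv_sqrt n)) = (x n - f (inv_sqrt n)) * - (inverse (x n) * inverse (f (inv_sqrt n)))"
      by (simp add: field_simps)
    then show ?case by simp
  qed
  ultimately have "negligible_seq (\<lambda>n. inverse (x n) - inverse (f (inv_sqrt n)))"
    by (rule negligible_seq_mono)
  moreover have "(\<lambda>z. inverse (f z)) analytic_on {0}"
    using assms by (intro analytic_intros) (auto simp: asy_def)
  ultimately show ?thesis by (simp add: asy_def)
qed

lemma asy_divide:
  assumes "asy f x" "asy g y" "g 0 \<noteq> 0"
  shows "asy (\<lambda>z. f z / g z) (\<lambda>n. x n / y n)"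
  using asy_mult[OF assms(1) asy_inverse[OF assms(2,3)]] by (simp add: divide_inverse)

section \<open>The shift as a substitution\<close>

definition tau :: "complex \<Rightarrow> complex" where "tau z = 1 / csqrt (1 + z\<^sup>2)"

text \<open>For z = 1/sqrt n this is 1/sqrt(n+1), so shifting the sequence is composing its model
  with \<open>next_arg\<close>.\<close>

definition next_arg :: "complex \<Rightarrow> complex" where "next_arg z = z * tau z"

lemma tau_0 [simp]: "tau 0 = 1" by (simp add: tau_def)

lemma next_arg_0 [simp]: "next_arg 0 = 0" by (simp add: next_arg_def)

lemma tau_analytic: "tau analytic_on {0}"
  unfolding tau_def[abs_def] by (auto intro!: analytic_intros simp: complex_nonpos_Reals_iff)

lemma next_arg_analytic: "next_arg analytic_on {0}"
  unfolding next_arg_def[abs_def] by (intro analytic_intros tau_analytic)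

lemma analytic_next_arg:
  assumes "f analytic_on {0}"
  shows "(\<lambda>z. f (next_arg z)) analytic_on {0}"
  using analytic_on_compose[OF next_arg_analytic, of f] assms by (simp add: o_def)

lemma inv_sqrt_Suc:
  assumes "n > 0"
  shows "inv_sqrt (Suc n) = next_arg (inv_sqrt n)"
proof -
  have "1 + (inv_sqrt n)\<^sup>2 = of_real (1 + 1 / real n)"
    by (simp add: inv_sqrt_def power_divide flip: of_real_power)
  then have "csqrt (1 + (inv_sqrt n)\<^sup>2) = of_real (sqrt (1 + 1 / real n))"
    by (simp only:) (subst csqrt_of_real_nonneg, auto)
  then have "next_arg (inv_sqrt n) = of_real (1 / sqrt (real n) * (1 / sqrt (1 + 1 / real n)))"
    by (simp add: next_arg_def tau_def inv_sqrt_def)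
  also have "1 / sqrt (real n) * (1 / sqrt (1 + 1 / real n)) = 1 / sqrt (real n * (1 + 1 / real n))"
    by (simp add: real_sqrt_mult)
  also have "real n * (1 + 1 / real n) = real (Suc n)"
    using assms by (simp add: field_simps)
  finally show ?thesis by (simp add: inv_sqrt_def)
qed

lemma asy_Suc:
  assumes "asy f x"
  shows "asy (\<lambda>z. f (next_arg z)) (\<lambda>n. x (Suc n))"
proof -
  have "negligible_seq (\<lambda>n. x (Suc n) - f (inv_sqrt (Suc n)))"
    using assms negligible_seq_Suc[of "\<lambda>n. x n - f (inv_sqrt n)"] by (simp add: asy_def)
  then have "negligible_seq (\<lambda>n. x (Suc n) - f (next_arg (inv_sqrt n)))"
    by (rule negligible_seq_mono) (use eventually_gt_at_top[of 0] in \<open>eventually_elim, simp add: inv_sqrt_Suc\<close>)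
  then show ?thesis using assms by (simp add: asy_def analytic_next_arg)
qed

lemma removable_power:
  assumes f: "f analytic_on {0}" and lim: "((\<lambda>z. f z / z ^ k) \<longlongrightarrow> c) (at 0)"
  shows "(\<lambda>z. if z = 0 then c else f z / z ^ k) analytic_on {0}"
proof (rule removable_singularity'[OF _ lim])
  obtain S where S: "open S" "0 \<in> S" "f holomorphic_on S"
    using f by (auto simp: analytic_at)
  have "(\<lambda>z. f z / z ^ k) holomorphic_on S - {0}"
    using S by (intro holomorphic_intros holomorphic_on_subset[OF S(3)]) auto
  then show "isolated_singularity_at (\<lambda>z. f z / z ^ k) 0"
    using S by (intro isolated_singularity_at_holomorphic)
qed

lemma inv_sqrt_cube: "n > 0 \<Longrightarrow> inv_sqrt n ^ 3 = inverse (of_real (real n * sqrt (real n)))"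
proof -
  have "sqrt (real n) ^ 3 = real n * sqrt (real n)" by (simp add: power3_eq_cube)
  then show ?thesis by (simp add: inv_sqrt_def power_divide divide_inverse power_inverse flip: of_real_power)
qed

text \<open>A negligible error survives multiplication by n^(3/2), and the model stays analytic
  because the limit removes the singularity of f z / z^3.\<close>

lemma asy_divide_cube:
  assumes x: "asy f x" and lim: "((\<lambda>z. f z / z ^ 3) \<longlongrightarrow> c) (at 0)"
  shows "asy (\<lambda>z. if z = 0 then c else f z / z ^ 3) (\<lambda>n. of_real (real n * sqrt (real n)) * x n)"
    (is "asy ?g _")
proof -
  have "negligible_seq (\<lambda>n. (x n - f (inv_sqrt n)) * of_real (real n * sqrt (real n)))"
  proof (rule negligible_seq_mult)
    show "poly_bounded (\<lambda>n. of_real (real n * sqrt (real n)))"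
      unfolding poly_bounded_def
    proof (intro exI[of _ 2])
      show "\<forall>\<^sub>F n in sequentially. norm (complex_of_real (real n * sqrt (real n))) \<le> (real n)\<^sup>2"
        using eventually_ge_at_top[of 1]
      proof eventually_elim
        case (elim n)
        have "sqrt (real n) \<le> real n" using elim by (intro real_le_lsqrt) (auto simp: power2_eq_square)
        then show ?case by (simp add: power2_eq_square norm_mult mult_left_mono)
      qed
    qed
  qed (use x in \<open>simp add: asy_def\<close>)
  then have "negligible_seq (\<lambda>n. of_real (real n * sqrt (real n)) * x n - ?g (inv_sqrt n))"
  proof (rule negligible_seq_mono)
    show "\<forall>\<^sub>F n in sequentially. norm (of_real (real n * sqrt (real n)) * x n - ?g (inv_sqrt n)) \<le>
        norm ((x n - f (inv_sqrt n)) * of_real (real n * sqrt (real n)))"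
      using eventually_gt_at_top[of 0]
    proof eventually_elim
      case (elim n)
      have "?g (inv_sqrt n) = f (inv_sqrt n) * of_real (real n * sqrt (real n))"
        using elim inv_sqrt_nonzero[OF elim] by (simp add: inv_sqrt_cube divide_inverse)
      then have "of_real (real n * sqrt (real n)) * x n - ?g (inv_sqrt n) = (x n - f (inv_sqrt n)) * of_real (real n * sqrt (real n))"
        by (simp only: left_diff_distrib mult.commute)
      then show ?case by simp
    qed
  qed
  moreover have "?g analytic_on {0}" using x lim by (intro removable_power) (simp add: asy_def)
  ultimately show ?thesis by (simp add: asy_def)
qed

section \<open>Log-concavity of regular sequences\<close>

text \<open>The curvature of a regular sequence has exact order \<open>z\<^sup>3\<close>, where \<open>z = n\<^bsup>-1/2\<^esup>\<close>, so factors
  \<open>1 + o(z\<^sup>3)\<close> do not affect its leading coefficient.\<close>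

definition flat :: "(complex \<Rightarrow> complex) \<Rightarrow> bool" where
  "flat f \<longleftrightarrow> f analytic_on {0} \<and> ((\<lambda>z. (f z - 1) / z ^ 3) \<longlongrightarrow> 0) (at 0)"

lemma analytic_tendsto_at: "f analytic_on {0} \<Longrightarrow> (f \<longlongrightarrow> f 0) (at 0)" for f :: "complex \<Rightarrow> complex"
  using analytic_at_imp_isCont[of f 0] by (simp add: isCont_def)

lemma flat_mult:
  assumes "flat f" "flat g"
  shows "flat (\<lambda>z. f z * g z)"
proof -
  have "((\<lambda>z. (f z - 1) / z ^ 3 * g z + (g z - 1) / z ^ 3) \<longlongrightarrow> 0 * g 0 + 0) (at 0)"
    using assms unfolding flat_def by (intro tendsto_intros analytic_tendsto_at) auto
  also have "(\<lambda>z. (f z - 1) / z ^ 3 * g z + (g z - 1) / z ^ 3) = (\<lambda>z. (f z * g z - 1) / z ^ 3)"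
    by (auto simp: algebra_simps simp flip: add_divide_distrib diff_divide_distrib)
  finally show ?thesis using assms unfolding flat_def by (auto intro!: analytic_intros)
qed

lemma flat_power: "flat f \<Longrightarrow> flat (\<lambda>z. f z ^ k)"
proof (induction k)
  case 0
  then show ?case by (simp add: flat_def)
next
  case (Suc k)
  then show ?case using flat_mult[of f "\<lambda>z. f z ^ k"] by simp
qed

lemma ev_nz_0: "\<forall>\<^sub>F z in at (0::complex). z \<noteq> 0"
  by (rule eventually_at_topological[THEN iffD2]) auto

lemma flat_at_0: "flat f \<Longrightarrow> f 0 = 1"
proof -
  assume f: "flat f"
  have "((\<lambda>z. (f z - 1) / z ^ 3 * z ^ 3 + 1) \<longlongrightarrow> 0 * 0 ^ 3 + 1) (at 0)"
    using f unfolding flat_def by (intro tendsto_intros) auto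
  then have "((\<lambda>z. (f z - 1) / z ^ 3 * z ^ 3 + 1) \<longlongrightarrow> 1) (at 0)" by simp
  moreover have "\<forall>\<^sub>F z in at 0. (f z - 1) / z ^ 3 * z ^ 3 + 1 = f z"
    using ev_nz_0 by eventually_elim simp
  ultimately have "(f \<longlongrightarrow> 1) (at 0)" by (rule Lim_transform_eventually)
  moreover have "(f \<longlongrightarrow> f 0) (at 0)" using f by (intro analytic_tendsto_at) (simp add: flat_def)
  ultimately show ?thesis using tendsto_unique[OF trivial_limit_at] by metis
qed

lemma ev_analytic_nz:
  assumes "f analytic_on {0}" "f 0 \<noteq> 0"
  shows "\<forall>\<^sub>F z in at (0::complex). f z \<noteq> 0"
  using analytic_tendsto_at[OF assms(1)] assms(2) by (rule tendsto_imp_eventually_ne)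

lemma analytic_quotient_tendsto:
  fixes f :: "complex \<Rightarrow> complex"
  assumes "f analytic_on {0}" "f 0 = 0"
  shows "((\<lambda>z. f z / z) \<longlongrightarrow> deriv f 0) (at 0)"
proof -
  have "(f has_field_derivative deriv f 0) (at 0)"
    using assms(1) by (simp add: analytic_on_imp_differentiable_at DERIV_deriv_iff_field_differentiable)
  then show ?thesis using assms(2) by (simp add: DERIV_def)
qed

lemma analytic_split_linear:
  fixes f :: "complex \<Rightarrow> complex"
  assumes "f analytic_on {0}"
  obtains u where "u analytic_on {0}" "\<And>z. f z = f 0 + z * u z"
proof -
  define u where "u = (\<lambda>z. if z = 0 then deriv (\<lambda>z. f z - f 0) 0 else (f z - f 0) / z ^ 1)"
  have "u analytic_on {0}"
  proof -
    have fa: "(\<lambda>z. f z - f 0) analytic_on {0}" using assms by (intro analytic_intros)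
    have "((\<lambda>z. (f z - f 0) / z ^ 1) \<longlongrightarrow> deriv (\<lambda>z. f z - f 0) 0) (at 0)"
      using analytic_quotient_tendsto[OF fa] by simp
    then show ?thesis unfolding u_def by (rule removable_power[OF fa])
  qed
  moreover have "f z = f 0 + z * u z" for z by (simp add: u_def)
  ultimately show ?thesis using that by blast
qed

lemma tau_tendsto: "(tau \<longlongrightarrow> 1) (at 0)"
  using analytic_tendsto_at[OF tau_analytic] by simp

text \<open>With c = sqrt(1 + z^2), rationalising 1/c - 1 gives -z^2/(c(1 + c)).\<close>

lemma tau_quadratic: "((\<lambda>z. (tau z - 1) / z\<^sup>2) \<longlongrightarrow> - 1 / 2) (at 0)"
proof -
  define c where "c = (\<lambda>z::complex. csqrt (1 + z\<^sup>2))"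
  have ca: "c analytic_on {0}"
    unfolding c_def by (auto intro!: analytic_intros simp: complex_nonpos_Reals_iff)
  have c0: "c 0 = 1" by (simp add: c_def)
  have c2: "c z * c z = 1 + z\<^sup>2" for z unfolding c_def by (simp flip: power2_eq_square)
  have n1: "\<forall>\<^sub>F z in at 0. c z \<noteq> 0"
    by (rule ev_analytic_nz[OF ca]) (simp add: c0)
  have n2: "\<forall>\<^sub>F z in at 0. 1 + c z \<noteq> 0"
    by (rule ev_analytic_nz) (auto intro!: analytic_intros ca simp: c0)
  have "((\<lambda>z. - 1 / (c z * (1 + c z))) \<longlongrightarrow> - 1 / (c 0 * (1 + c 0))) (at 0)"
    by (intro tendsto_intros analytic_tendsto_at ca) (auto simp: c0)
  then have "((\<lambda>z. - 1 / (c z * (1 + c z))) \<longlongrightarrow> - 1 / 2) (at 0)" by (simp add: c0)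
  moreover have "\<forall>\<^sub>F z in at 0. - 1 / (c z * (1 + c z)) = (tau z - 1) / z\<^sup>2"
    using ev_nz_0 n1 n2
  proof eventually_elim
    case (elim z)
    note nz = elim
    have "tau z = 1 / c z" by (simp add: tau_def c_def)
    then have "tau z - 1 = (1 - c z) / c z" using nz by (simp add: diff_divide_distrib)
    also have "\<dots> = ((1 - c z) * (1 + c z)) / (c z * (1 + c z))" using nz by simp
    also have "(1 - c z) * (1 + c z) = - z\<^sup>2" using c2[of z] by (simp add: algebra_simps)
    finally show ?case using nz by simp
  qed
  ultimately show ?thesis by (rule Lim_transform_eventually)
qed

lemma ev_tau_nz: "\<forall>\<^sub>F z in at 0. tau z \<noteq> 0"
  by (rule ev_analytic_nz[OF tau_analytic]) simp

lemma next_arg_tendsto: "filterlim next_arg (at 0) (at 0)"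
proof -
  have "(next_arg \<longlongrightarrow> 0) (at 0)" using analytic_tendsto_at[OF next_arg_analytic] by simp
  moreover have "\<forall>\<^sub>F z in at 0. next_arg z \<noteq> 0"
    using ev_nz_0 ev_tau_nz by eventually_elim (simp add: next_arg_def)
  ultimately show ?thesis by (simp add: filterlim_at)
qed

text \<open>\<open>next_arg z\<close> differs from z only by O(z^3), and an analytic w inherits
  this. Splitting off linear factors twice avoids Taylor expansions: the increment of u is z
  \<open>G z\<close> with \<open>G 0 = 0\<close>, and tau z - 1 has order z^2.\<close>

lemma next_arg_increment:
  assumes w: "w analytic_on {0}"
  obtains d where "((\<lambda>z. (w (next_arg z) - w z) / z ^ 3) \<longlongrightarrow> d) (at 0)"
proof -
  obtain u where u: "u analytic_on {0}" "\<And>z. w z = w 0 + z * u z"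
    using analytic_split_linear[OF w] by metis
  obtain p where p: "p analytic_on {0}" "\<And>z. u z = u 0 + z * p z"
    using analytic_split_linear[OF u(1)] by metis
  define G where "G = (\<lambda>z. tau z * p (next_arg z) - p z)"
  have G: "G analytic_on {0}" "G 0 = 0"
    unfolding G_def by (auto intro!: analytic_intros tau_analytic analytic_next_arg p)
  have "((\<lambda>z. tau z * (G z / z) + (tau z - 1) / z\<^sup>2 * u z) \<longlongrightarrow> 1 * deriv G 0 + (- 1 / 2) * u 0) (at 0)"
    by (intro tendsto_intros tau_tendsto tau_quadratic analytic_quotient_tendsto G analytic_tendsto_at u)
  moreover have "\<forall>\<^sub>F z in at 0. tau z * (G z / z) + (tau z - 1) / z\<^sup>2 * u z = (w (next_arg z) - w z) / z ^ 3"
    using ev_nz_0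
  proof eventually_elim
    case (elim z)
    have e1: "u (next_arg z) - u z = z * G z"
      unfolding p(2)[of "next_arg z"] p(2)[of z] by (simp add: G_def next_arg_def algebra_simps)
    have "w (next_arg z) - w z = z * (tau z * (u (next_arg z) - u z) + (tau z - 1) * u z)"
      unfolding u(2)[of "next_arg z"] u(2)[of z] by (simp add: next_arg_def algebra_simps)
    also have "\<dots> = z * (tau z * (z * G z) + (tau z - 1) * u z)" by (simp only: e1)
    finally have eq: "w (next_arg z) - w z = z * (tau z * (z * G z) + (tau z - 1) * u z)" .
    show ?case
      unfolding eq using elim by (simp add: field_simps power2_eq_square power3_eq_cube)
  qed
  ultimately have "((\<lambda>z. (w (next_arg z) - w z) / z ^ 3) \<longlongrightarrow> 1 * deriv G 0 + (- 1 / 2) * u 0) (at 0)"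
    by (rule Lim_transform_eventually)
  then show ?thesis by (rule that)
qed

definition ratio2 :: "(complex \<Rightarrow> complex) \<Rightarrow> complex \<Rightarrow> complex" where
  "ratio2 w z = w z * w (next_arg (next_arg z)) / (w (next_arg z))\<^sup>2"

text \<open>For consecutive values A, B, C one has AC - B^2 = A(C - B) - B(B - A). Both increments
  are d z^3 + o(z^3) with the same d, so the terms of order z^3 cancel.\<close>

lemma flat_ratio2:
  assumes w: "w analytic_on {0}" "w 0 \<noteq> 0"
  shows "flat (ratio2 w)"
proof -
  have a1: "(\<lambda>z. w (next_arg z)) analytic_on {0}" by (rule analytic_next_arg[OF w(1)])
  have n1: "\<forall>\<^sub>F z in at 0. w (next_arg z) \<noteq> 0"
    by (rule ev_analytic_nz[OF a1]) (simp add: w)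
  have a2: "(\<lambda>z. w (next_arg (next_arg z))) analytic_on {0}" by (rule analytic_next_arg[OF a1])
  obtain d where d: "((\<lambda>z. (w (next_arg z) - w z) / z ^ 3) \<longlongrightarrow> d) (at 0)"
    using next_arg_increment[OF w(1)] .
  have d': "((\<lambda>z. (w (next_arg (next_arg z)) - w (next_arg z)) / (next_arg z) ^ 3) \<longlongrightarrow> d) (at 0)"
    using filterlim_compose[OF d next_arg_tendsto] .
  have "((\<lambda>z. (w z * ((w (next_arg (next_arg z)) - w (next_arg z)) / (next_arg z) ^ 3 * tau z ^ 3) - w (next_arg z) * ((w (next_arg z) - w z) / z ^ 3)) / (w (next_arg z))\<^sup>2)
      \<longlongrightarrow> (w 0 * (d * 1 ^ 3) - w (next_arg 0) * d) / (w (next_arg 0))\<^sup>2) (at 0)"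
    by (intro tendsto_intros d d' tau_tendsto analytic_tendsto_at[OF a1] analytic_tendsto_at[OF w(1)]) (use w in auto)
  then have "((\<lambda>z. (w z * ((w (next_arg (next_arg z)) - w (next_arg z)) / (next_arg z) ^ 3 * tau z ^ 3) - w (next_arg z) * ((w (next_arg z) - w z) / z ^ 3)) / (w (next_arg z))\<^sup>2)
      \<longlongrightarrow> 0) (at 0)" by simp
  moreover have "\<forall>\<^sub>F z in at 0. (w z * ((w (next_arg (next_arg z)) - w (next_arg z)) / (next_arg z) ^ 3 * tau z ^ 3) - w (next_arg z) * ((w (next_arg z) - w z) / z ^ 3)) / (w (next_arg z))\<^sup>2
     = (ratio2 w z - 1) / z ^ 3"
    using ev_nz_0 ev_tau_nz n1
  proof eventually_elim
    case (elim z)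
    define A B C where "A = w z" and "B = w (next_arg z)" and "C = w (next_arg (next_arg z))"
    have nz: "z \<noteq> 0" "tau z \<noteq> 0" "B \<noteq> 0" using elim w by (auto simp: B_def)
    have e: "(C - B) / (next_arg z) ^ 3 * tau z ^ 3 = (C - B) / z ^ 3"
      using nz by (simp add: next_arg_def power_mult_distrib)
    have "(A * (x / k) - B * (y / k)) / l = (A * x - B * y) / k / l" for x y k l
      by (simp add: diff_divide_distrib)
    then have "(A * ((C - B) / z ^ 3) - B * ((B - A) / z ^ 3)) / B\<^sup>2 = (A * (C - B) - B * (B - A)) / z ^ 3 / B\<^sup>2" .
    also have "A * (C - B) - B * (B - A) = A * C - B\<^sup>2" by (simp add: algebra_simps power2_eq_square)
    also have "(A * C - B\<^sup>2) / z ^ 3 / B\<^sup>2 = (A * C / B\<^sup>2 - 1) / z ^ 3"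
      using nz by (simp add: field_simps)
    finally show ?case unfolding ratio2_def A_def[symmetric] B_def[symmetric] C_def[symmetric] e .
  qed
  ultimately have "((\<lambda>z. (ratio2 w z - 1) / z ^ 3) \<longlongrightarrow> 0) (at 0)" by (rule Lim_transform_eventually)
  moreover have "ratio2 w analytic_on {0}"
    unfolding ratio2_def[abs_def] by (intro analytic_intros a1 a2 w) (use w in auto)
  ultimately show ?thesis by (simp add: flat_def)
qed

text \<open>This is the ratio of \<open>ratio2\<close> for the identity function with the zeros at 0
  cancelled. The identity vanishes at 0, so \<open>flat_ratio2\<close> does not cover it and
  flatness is shown directly.\<close>

definition rho :: "complex \<Rightarrow> complex" where "rho z = tau (next_arg z) / tau z"

lemma rho_analytic: "rho analytic_on {0}"
  unfolding rho_def[abs_def] by (intro analytic_intros analytic_next_arg tau_analytic) auto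

text \<open>The square is rational: (1 + z^2)^2 / (1 + 2 z^2) = 1 + z^4/(1 + 2 z^2), so
  \<open>rho\<close> deviates from 1 in order z^4.\<close>

lemma flat_rho: "flat rho"
proof -
  have n1: "\<forall>\<^sub>F z in at (0::complex). 1 + 2 * z\<^sup>2 \<noteq> 0" by (rule ev_analytic_nz) (auto intro!: analytic_intros)
  have n2: "\<forall>\<^sub>F z in at (0::complex). 1 + z\<^sup>2 \<noteq> 0" by (rule ev_analytic_nz) (auto intro!: analytic_intros)
  have n3: "\<forall>\<^sub>F z in at 0. rho z + 1 \<noteq> 0"
    by (rule ev_analytic_nz[OF analytic_on_add[OF rho_analytic analytic_on_const]]) (simp add: rho_def)
  have n4: "\<forall>\<^sub>F z in at 0. tau (next_arg z) \<noteq> 0"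
    by (rule ev_analytic_nz[OF analytic_next_arg[OF tau_analytic]]) simp
  have "((\<lambda>z. z / ((1 + 2 * z\<^sup>2) * (rho z + 1))) \<longlongrightarrow> 0 / ((1 + 2 * 0\<^sup>2) * (rho 0 + 1))) (at 0)"
    by (intro tendsto_intros analytic_tendsto_at[OF rho_analytic]) (auto simp: rho_def)
  then have "((\<lambda>z. z / ((1 + 2 * z\<^sup>2) * (rho z + 1))) \<longlongrightarrow> 0) (at 0)" by simp
  moreover have "\<forall>\<^sub>F z in at 0. z / ((1 + 2 * z\<^sup>2) * (rho z + 1)) = (rho z - 1) / z ^ 3"
    using ev_nz_0 ev_tau_nz n1 n2 n3 n4
  proof eventually_elim
    case (elim z)
    note nz = elim
    have t2: "(tau x)\<^sup>2 = 1 / (1 + x\<^sup>2)" for x by (simp add: tau_def power_divide)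
    have "(next_arg z)\<^sup>2 = z\<^sup>2 / (1 + z\<^sup>2)" by (simp add: next_arg_def power_mult_distrib t2)
    then have "1 + (next_arg z)\<^sup>2 = (1 + 2 * z\<^sup>2) / (1 + z\<^sup>2)" using nz by (simp add: field_simps)
    then have "(rho z)\<^sup>2 = (1 + z\<^sup>2)\<^sup>2 / (1 + 2 * z\<^sup>2)"
      by (simp add: rho_def power_divide t2 power2_eq_square[of "1 + z\<^sup>2"])
    also have "\<dots> = 1 + z ^ 4 / (1 + 2 * z\<^sup>2)"
      using nz by (simp add: field_simps) (simp add: power2_eq_square algebra_simps eval_nat_numeral)
    finally have "(rho z - 1) * (rho z + 1) = z ^ 4 / (1 + 2 * z\<^sup>2)"
      by (simp add: algebra_simps power2_eq_square)
    then have "rho z - 1 = z ^ 4 / (1 + 2 * z\<^sup>2) / (rho z + 1)"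
      by (subst nonzero_eq_divide_eq) (use nz in auto)
    then show ?case using nz by (simp add: eval_nat_numeral)
  qed
  ultimately have "((\<lambda>z. (rho z - 1) / z ^ 3) \<longlongrightarrow> 0) (at 0)" by (rule Lim_transform_eventually)
  then show ?thesis by (simp add: flat_def rho_analytic)
qed

lemma rho_inv_sqrt:
  assumes "n > 0"
  shows "inv_sqrt n * inv_sqrt (Suc (Suc n)) / (inv_sqrt (Suc n))\<^sup>2 = rho (inv_sqrt n)"
proof -
  have z: "inv_sqrt (Suc n) = inv_sqrt n * tau (inv_sqrt n)"
    using inv_sqrt_Suc[OF assms] by (simp add: next_arg_def)
  have zz: "inv_sqrt (Suc (Suc n)) = inv_sqrt (Suc n) * tau (inv_sqrt (Suc n))"
    using inv_sqrt_Suc[of "Suc n"] by (simp add: next_arg_def)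
  have nz: "inv_sqrt n \<noteq> 0" "inv_sqrt (Suc n) \<noteq> 0" using assms inv_sqrt_nonzero by auto
  then have "tau (inv_sqrt n) \<noteq> 0" using z by auto
  then show ?thesis
    unfolding rho_def inv_sqrt_Suc[OF assms, symmetric] zz using nz
    by (simp add: z power2_eq_square field_simps)
qed

lemma asy_ratio2:
  assumes "asy g x" "g 0 \<noteq> 0"
  shows "asy (ratio2 g) (\<lambda>n. x n * x (Suc (Suc n)) / (x (Suc n))\<^sup>2)"
  unfolding ratio2_def[abs_def]
  by (intro asy_divide asy_mult asy_power assms asy_Suc[OF assms(1)] asy_Suc[OF asy_Suc[OF assms(1)]]) (use assms in auto)

section \<open>Regular sequences under the log-concavity operator\<close>

text \<open>The scale-free form of the operator: where a(n+1) is nonzero, \<open>logc_op a n\<close>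
  is a(n+1)^2 times this quantity.\<close>

definition curvature :: "(nat \<Rightarrow> real) \<Rightarrow> nat \<Rightarrow> real" where
  "curvature a n = 1 - a n * a (Suc (Suc n)) / (a (Suc n))\<^sup>2"

text \<open>Only the curvature gets an analytic model. The growth of a itself is left open, which is
  what makes the class stable under iteration.\<close>

definition regular_seq :: "(nat \<Rightarrow> real) \<Rightarrow> bool" where
  "regular_seq a \<longleftrightarrow> (\<forall>\<^sub>F n in sequentially. a n > 0) \<and>
     (\<exists>g c. c > 0 \<and> g 0 = of_real c \<and> asy g (\<lambda>n. of_real (real n * sqrt (real n)) * of_real (curvature a n)))"

lemma regular_curvature_pos:
  assumes "g 0 = of_real c" "c > 0" "asy g (\<lambda>n. of_real (real n * sqrt (real n)) * of_real (v n))"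
  shows "\<forall>\<^sub>F n in sequentially. v n > 0"
proof -
  have "(\<lambda>n. Re (of_real (real n * sqrt (real n)) * of_real (v n))) \<longlonglongrightarrow> Re (g 0)"
    by (intro tendsto_Re asy_tendsto assms)
  then have "(\<lambda>n. real n * sqrt (real n) * v n) \<longlonglongrightarrow> c" using assms by simp
  then have "\<forall>\<^sub>F n in sequentially. real n * sqrt (real n) * v n > 0"
    using assms(2) by (rule order_tendstoD)
  then show ?thesis
  proof eventually_elim
    case (elim n)
    then show ?case using mult_nonneg_nonpos[of "real n * sqrt (real n)" "v n"] by force
  qed
qed

text \<open>With v the curvature of a, the new sequence is b(n) = a(n+1)^2 v(n), so its ratio b(n)
  b(n+2) / b(n+1)^2 is (1 - v(n+1))^2 times the same ratio for v. The model of v is z^3 g, hence the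
  latter ratio is flat, and the square contributes 2 v(n+1), that is 2c z^3.\<close>

lemma regular_seq_logc_op:
  assumes "regular_seq a"
  shows "regular_seq (logc_op a)"
proof -
  define v where "v = curvature a"
  obtain g c where pos: "\<forall>\<^sub>F n in sequentially. a n > 0" and c: "c > 0" "g 0 = of_real c"
    and g: "asy g (\<lambda>n. of_real (real n * sqrt (real n)) * of_real (v n))"
    using assms unfolding regular_seq_def v_def by blast
  define w where "w = (\<lambda>n. of_real (real n * sqrt (real n)) * complex_of_real (v n))"
  have vpos: "\<forall>\<^sub>F n in sequentially. v n > 0"
    by (rule regular_curvature_pos[OF c(2,1) g])
  define b where "b = logc_op a"
  have ga: "g analytic_on {0}" using g by (simp add: asy_def)
  have g0: "g 0 \<noteq> 0" using c by simp
  have gw: "asy g w" using g by (simp add: w_def)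
  have apos1: "\<forall>\<^sub>F n in sequentially. a (Suc n) > 0"
    using pos eventually_sequentially_Suc[of "\<lambda>n. a n > 0"] by simp
  have beq: "\<forall>\<^sub>F n in sequentially. b n = (a (Suc n))\<^sup>2 * v n"
    using apos1
  proof eventually_elim
    case (elim n)
    then show ?case
      by (simp add: b_def logc_op_def v_def curvature_def right_diff_distrib)
  qed
  have bpos: "\<forall>\<^sub>F n in sequentially. b n > 0"
    using beq apos1 vpos by eventually_elim simp
  have ev1: "\<forall>\<^sub>F n in sequentially. P (Suc n)" if "\<forall>\<^sub>F n in sequentially. P n" for P
    using that eventually_sequentially_Suc[of P] by simp
  \<comment> \<open>The model of v(n+1); below, F models the ratio of v, where
    \<open>rho z ^ 3\<close> comes from the factor z^3 in v.\<close>
  define X where "X = (\<lambda>z. (next_arg z) ^ 3 * g (next_arg z))"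
  define F where "F = (\<lambda>z. ratio2 g z * rho z ^ 3)"
  have F: "flat F" unfolding F_def by (intro flat_mult flat_power flat_rho flat_ratio2 ga g0)
  define R where "R = (\<lambda>z. (1 - X z)\<^sup>2 * F z)"
  have asyX: "asy X (\<lambda>n. of_real (v (Suc n)))"
  proof (rule asy_cong)
    show "asy X (\<lambda>n. inv_sqrt (Suc n) ^ 3 * w (Suc n))"
      unfolding X_def
      by (intro asy_mult asy_power asy_Suc[OF gw] asy_Suc[of "\<lambda>z. z" inv_sqrt]) (auto intro!: asy_exact analytic_intros)
    show "\<forall>\<^sub>F n in sequentially. inv_sqrt (Suc n) ^ 3 * w (Suc n) = of_real (v (Suc n))"
    proof (intro always_eventually allI)
      fix n
      have "complex_of_real (real (Suc n) * sqrt (real (Suc n))) \<noteq> 0"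
        unfolding of_real_eq_0_iff by simp
      then show "inv_sqrt (Suc n) ^ 3 * w (Suc n) = of_real (v (Suc n))"
        by (simp add: inv_sqrt_cube w_def del: of_nat_Suc of_real_mult)
    qed
  qed
  have asyR: "asy R (\<lambda>n. of_real (b n * b (Suc (Suc n)) / (b (Suc n))\<^sup>2))"
  proof (rule asy_cong)
    show "asy R (\<lambda>n. (1 - of_real (v (Suc n)))\<^sup>2 * (w n * w (Suc (Suc n)) / (w (Suc n))\<^sup>2 * rho (inv_sqrt n) ^ 3))"
      unfolding R_def F_def
      by (intro asy_mult asy_power asy_diff asy_const asyX asy_ratio2 gw g0)
         (auto intro!: asy_exact rho_analytic)
    show "\<forall>\<^sub>F n in sequentially. (1 - of_real (v (Suc n)))\<^sup>2 * (w n * w (Suc (Suc n)) / (w (Suc n))\<^sup>2 * rho (inv_sqrt n) ^ 3) =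
        complex_of_real (b n * b (Suc (Suc n)) / (b (Suc n))\<^sup>2)"
      using beq ev1[OF beq] ev1[OF ev1[OF beq]] vpos ev1[OF vpos] ev1[OF ev1[OF vpos]]
        apos1 ev1[OF apos1] ev1[OF ev1[OF apos1]] eventually_gt_at_top[of 0]
    proof eventually_elim
      case (elim n)
      have w: "w k = complex_of_real (v k) / inv_sqrt k ^ 3" if "k > 0" for k
        using inv_sqrt_cube[OF that] by (simp add: w_def divide_inverse mult.commute del: of_real_mult)
      have nz: "inv_sqrt n \<noteq> 0" "inv_sqrt (Suc n) \<noteq> 0" "inv_sqrt (Suc (Suc n)) \<noteq> 0"
        using elim inv_sqrt_nonzero by auto
      have "w n * w (Suc (Suc n)) / (w (Suc n))\<^sup>2 * rho (inv_sqrt n) ^ 3 =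
          of_real (v n * v (Suc (Suc n)) / (v (Suc n))\<^sup>2)"
        unfolding rho_inv_sqrt[OF \<open>0 < n\<close>, symmetric] w[OF \<open>0 < n\<close>] w[OF zero_less_Suc]
        using nz elim by (simp add: field_simps power2_eq_square power3_eq_cube)
      moreover have "b n * b (Suc (Suc n)) / (b (Suc n))\<^sup>2 = (1 - v (Suc n))\<^sup>2 * (v n * v (Suc (Suc n)) / (v (Suc n))\<^sup>2)"
      proof -
        have om: "1 - v (Suc n) = a (Suc n) * a (Suc (Suc (Suc n))) / (a (Suc (Suc n)))\<^sup>2"
          by (simp add: v_def curvature_def)
        show ?thesis
          unfolding om elim(1-3) using elim(4-9) by (simp add: field_simps power2_eq_square)
      qed
      ultimately show ?case by simp
    qed
  qed
  have asyC: "asy (\<lambda>z. 1 - R z) (\<lambda>n. of_real (curvature b n))"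
    using asy_diff[OF asy_const[of 1] asyR] by (simp add: curvature_def)
  have Xlim: "((\<lambda>z. X z / z ^ 3) \<longlongrightarrow> of_real c) (at 0)"
  proof -
    have "((\<lambda>z. tau z ^ 3 * g (next_arg z)) \<longlongrightarrow> 1 ^ 3 * g (next_arg 0)) (at 0)"
      by (intro tendsto_intros tau_tendsto analytic_tendsto_at[OF analytic_next_arg[OF ga]])
    then have "((\<lambda>z. tau z ^ 3 * g (next_arg z)) \<longlongrightarrow> of_real c) (at 0)" by (simp add: c)
    moreover have "\<forall>\<^sub>F z in at 0. tau z ^ 3 * g (next_arg z) = X z / z ^ 3"
      using ev_nz_0 by eventually_elim (simp add: X_def next_arg_def power_mult_distrib)
    ultimately show ?thesis by (rule Lim_transform_eventually)
  qed
  have Xa: "X analytic_on {0}" "X 0 = 0" using asyX by (auto simp: asy_def X_def)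
  have Fa: "F analytic_on {0}" using F by (simp add: flat_def)
  have "((\<lambda>z. (2 * (X z / z ^ 3) - X z / z ^ 3 * X z) * F z - (F z - 1) / z ^ 3) \<longlongrightarrow>
      (2 * of_real c - of_real c * X 0) * F 0 - 0) (at 0)"
    by (intro tendsto_intros Xlim analytic_tendsto_at Xa Fa) (use F in \<open>simp add: flat_def\<close>)
  then have "((\<lambda>z. (2 * (X z / z ^ 3) - X z / z ^ 3 * X z) * F z - (F z - 1) / z ^ 3) \<longlongrightarrow> of_real (2 * c)) (at 0)"
    by (simp add: Xa flat_at_0[OF F])
  moreover have "\<forall>\<^sub>F z in at 0. (2 * (X z / z ^ 3) - X z / z ^ 3 * X z) * F z - (F z - 1) / z ^ 3 = (1 - R z) / z ^ 3"
    using ev_nz_0 by eventually_elim (simp add: R_def field_simps power2_eq_square)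
  ultimately have "((\<lambda>z. (1 - R z) / z ^ 3) \<longlongrightarrow> of_real (2 * c)) (at 0)" by (rule Lim_transform_eventually)
  from asy_divide_cube[OF asyC this] bpos c show ?thesis
    unfolding regular_seq_def b_def[symmetric]
    by (intro conjI exI[of _ "\<lambda>z. if z = 0 then of_real (2 * c) else (1 - R z) / z ^ 3"] exI[of _ "2 * c"]) auto
qed

lemma regular_seq_iterate:
  assumes "regular_seq a"
  shows "regular_seq ((logc_op ^^ k) a)"
  by (induction k) (use assms regular_seq_logc_op in auto)

lemma logc_op_shift: "(logc_op ^^ k) (\<lambda>i. a (N + i)) = (\<lambda>n. (logc_op ^^ k) a (N + n))"
proof (induction k)
  case (Suc k)
  then show ?case by (simp add: logc_op_def add.assoc)
qed simp

lemma regular_seq_eventually_log_concave: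
  assumes "regular_seq a"
  shows "\<exists>N\<ge>1. \<forall>k\<in>{1..r}. \<forall>n. (logc_op ^^ k) (\<lambda>i. a (N + i)) n \<ge> 0"
proof -
  have "\<forall>\<^sub>F n in sequentially. \<forall>k\<in>{1..r}. (logc_op ^^ k) a n > 0"
    using regular_seq_iterate[OF assms] unfolding regular_seq_def
    by (intro eventually_ball_finite) auto
  then obtain N where N: "\<And>n k. n \<ge> N \<Longrightarrow> k \<in> {1..r} \<Longrightarrow> (logc_op ^^ k) a n > 0"
    unfolding eventually_sequentially by blast
  \<comment> \<open>Starting at \<open>Suc N\<close> secures a starting index of at least 1.\<close>
  show ?thesis
  proof (intro exI[of _ "Suc N"] conjI ballI allI)
    fix k n assume "k \<in> {1..r}"
    then show "(logc_op ^^ k) (\<lambda>i. a (Suc N + i)) n \<ge> 0"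
      unfolding logc_op_shift using N[of "Suc N + n" k] by simp
  qed simp
qed

section \<open>Overpartitions\<close>

lemma exp_sqrt_negligible:
  assumes d: "\<delta> > 0"
  shows "negligible_seq (\<lambda>n. of_real (exp (- (\<delta> * sqrt (real n)))))"
  unfolding negligible_seq_def
proof
  fix K
  have "filterlim (\<lambda>n. \<delta> * sqrt (real n)) at_top sequentially"
    by (intro filterlim_tendsto_pos_mult_at_top[OF tendsto_const d]
        filterlim_compose[OF sqrt_at_top] filterlim_real_sequentially)
  then have "(\<lambda>n. (\<delta> * sqrt (real n)) ^ (2 * K) / exp (\<delta> * sqrt (real n))) \<longlonglongrightarrow> 0"
    by (rule filterlim_compose[OF tendsto_power_div_exp_0])
  then have "\<forall>\<^sub>F n in sequentially. (\<delta> * sqrt (real n)) ^ (2 * K) / exp (\<delta> * sqrt (real n)) < \<delta> ^ (2 * K)"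
    using d by (intro order_tendstoD(2)) auto
  then show "\<forall>\<^sub>F n in sequentially. norm (complex_of_real (exp (- (\<delta> * sqrt (real n))))) * real n ^ K \<le> 1"
  proof eventually_elim
    case (elim n)
    have "(\<delta> * sqrt (real n)) ^ (2 * K) = \<delta> ^ (2 * K) * real n ^ K"
      by (simp add: power_mult_distrib power_mult)
    then have "\<delta> ^ (2 * K) * (real n ^ K / exp (\<delta> * sqrt (real n))) < \<delta> ^ (2 * K) * 1"
      using elim by simp
    then have "real n ^ K / exp (\<delta> * sqrt (real n)) < 1"
      by (rule mult_left_less_imp_less) (use d in auto)
    then show ?case unfolding norm_of_real by (simp add: exp_minus divide_inverse mult.commute)
  qed
qed

lemma poly_bounded_linear: "poly_bounded (\<lambda>n. of_real (C * real n))"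
  unfolding poly_bounded_def
proof (intro exI[of _ 2])
  show "\<forall>\<^sub>F n in sequentially. norm (complex_of_real (C * real n)) \<le> (real n)\<^sup>2"
    using eventually_ge_at_top[of "nat \<lceil>\<bar>C\<bar>\<rceil>"]
  proof eventually_elim
    case (elim n)
    then have "\<bar>C\<bar> \<le> real n" by linarith
    then show ?case by (simp add: norm_mult abs_mult power2_eq_square mult_right_mono)
  qed
qed

text \<open>As 1/x = z/pi for z = n^(-1/2), the main part is linear in z; everything else carries
  exp(-2x) and is negligible.\<close>

lemma main_term_normalised:
  assumes "n > 0"
  defines "x \<equiv> pi * sqrt (real n)"
  shows "main_term n * real n * exp (- x) = 1 / 4 * (1 - 1 / x) + 1 / 4 * exp (- 2 * x) * (1 + 1 / x)"
proof -
  have "x > 0" using assms by simp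
  have e: "exp (- 2 * x) = exp (- x) * exp (- x)" by (simp flip: exp_add)
  have m: "main_term n * real n = 1 / 4 * ((exp x + exp (- x)) - (exp x - exp (- x)) / x)"
  proof -
    have "main_term n * real n = (cosh x - sinh x / x) / 2"
      unfolding main_term_eq[OF assms(1)] x_def[symmetric] using assms(1) by simp
    then show ?thesis using \<open>x > 0\<close> by (simp add: cosh_field_def sinh_field_def field_simps)
  qed
  have "1 / 4 * ((P + Q) - (P - Q) / x) * Q = 1 / 4 * (P * Q - P * Q / x) + 1 / 4 * (Q * Q) * (1 + 1 / x)" for P Q :: real
    using \<open>x > 0\<close> by (simp add: field_simps)
  from this[of "exp x" "exp (- x)"] show ?thesis
    unfolding m e by (simp flip: exp_add)
qed

text \<open>The model is a constant times 1 - z/pi. Both the exp(-2x) part of the main term and the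
  error of \<open>overp_asymptotics\<close> are bounded by a multiple of n exp(-(2/(3 pi)) sqrt
  n).\<close>

lemma overp_normalised_asy:
  obtains g \<kappa> where "g analytic_on {0}" "g 0 = of_real \<kappa>" "\<kappa> > 0"
    "asy g (\<lambda>n. of_real (real (overp n) * real n * exp (- (pi * sqrt (real n)))))"
proof -
  obtain \<kappa> K :: real where kap: "\<kappa> > 0" and K: "K \<ge> 0"
    and est: "\<And>n. n \<ge> 144 \<Longrightarrow> \<bar>real (overp n) - \<kappa> * main_term n\<bar> \<le> K * exp ((pi - 2 / (3 * pi)) * sqrt (real n))"
    using overp_asymptotics by metis
  define \<delta> where "\<delta> = 2 / (3 * pi)"
  define g where "g = (\<lambda>z :: complex. of_real (\<kappa> / 4) * (1 - z / of_real pi))"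
  have d: "\<delta> > 0" by (simp add: \<delta>_def)
  \<comment> \<open>Needed to absorb exp(-2x) = exp(-2 pi sqrt n) into the weaker decay rate of the
    circle method error.\<close>
  have dpi: "\<delta> \<le> 2 * pi"
  proof -
    have "2 / (3 * pi) \<le> 2 / 3" using pi_gt3 by (intro divide_left_mono) auto
    then show ?thesis using pi_gt3 by (simp add: \<delta>_def)
  qed
  have ga: "g analytic_on {0}" unfolding g_def by (intro analytic_intros) auto
  have "negligible_seq (\<lambda>n. of_real (exp (- (\<delta> * sqrt (real n)))) * of_real ((\<kappa> / 2 + K) * real n))"
    by (intro negligible_seq_mult exp_sqrt_negligible poly_bounded_linear d)
  then have "negligible_seq (\<lambda>n. of_real (real (overp n) * real n * exp (- (pi * sqrt (real n)))) - g (inv_sqrt n))"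
  proof (rule negligible_seq_mono)
    show "\<forall>\<^sub>F n in sequentially. norm (of_real (real (overp n) * real n * exp (- (pi * sqrt (real n)))) - g (inv_sqrt n))
        \<le> norm (complex_of_real (exp (- (\<delta> * sqrt (real n)))) * of_real ((\<kappa> / 2 + K) * real n))"
      using eventually_ge_at_top[of 144]
    proof eventually_elim
      case (elim n)
      define x where "x = pi * sqrt (real n)"
      define E where "E = exp (- (\<delta> * sqrt (real n)))"
      have "sqrt (real n) \<ge> 1" using elim by simp
      then have x: "x \<ge> 1" using pi_gt3 mult_mono[of 1 pi 1 "sqrt (real n)"] by (simp add: x_def)
      define e where "e = real (overp n) - \<kappa> * main_term n"
      have eb: "\<bar>e\<bar> \<le> K * exp ((pi - \<delta>) * sqrt (real n))"
        using est[OF elim] by (simp add: e_def \<delta>_def)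
      have gz: "g (inv_sqrt n) = of_real (\<kappa> * (1 / 4 * (1 - 1 / x)))"
        by (simp add: g_def inv_sqrt_def x_def mult.commute)
      have "real (overp n) * real n * exp (- x) = \<kappa> * (main_term n * real n * exp (- x)) + e * real n * exp (- x)"
        by (simp add: e_def algebra_simps)
      also have "main_term n * real n * exp (- x) = 1 / 4 * (1 - 1 / x) + 1 / 4 * exp (- 2 * x) * (1 + 1 / x)"
        using main_term_normalised[of n] elim by (simp add: x_def)
      finally have "real (overp n) * real n * exp (- x) - \<kappa> * (1 / 4 * (1 - 1 / x)) =
          \<kappa> / 4 * exp (- 2 * x) * (1 + 1 / x) + e * real n * exp (- x)"
        by (simp add: algebra_simps)
      also have "\<bar>\<dots>\<bar> \<le> \<kappa> / 4 * E * 2 + K * real n * E"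
      proof (rule order_trans[OF abs_triangle_ineq add_mono])
        have "exp (- 2 * x) \<le> E"
          using mult_right_mono[OF dpi, of "sqrt (real n)"] by (simp add: E_def x_def)
        then have "\<kappa> / 4 * exp (- 2 * x) * (1 + 1 / x) \<le> \<kappa> / 4 * E * 2"
          using kap x by (intro mult_mono) (auto simp: E_def field_simps)
        moreover have "\<kappa> / 4 * exp (- 2 * x) * (1 + 1 / x) \<ge> 0" using kap x by simp
        ultimately show "\<bar>\<kappa> / 4 * exp (- 2 * x) * (1 + 1 / x)\<bar> \<le> \<kappa> / 4 * E * 2" by simp
        have "\<bar>e * real n * exp (- x)\<bar> = \<bar>e\<bar> * real n * exp (- x)" by (simp add: abs_mult)
        also have "\<dots> \<le> K * exp ((pi - \<delta>) * sqrt (real n)) * real n * exp (- x)"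
          by (intro mult_right_mono eb) auto
        also have "\<dots> = K * real n * (exp ((pi - \<delta>) * sqrt (real n)) * exp (- x))" by simp
        also have "exp ((pi - \<delta>) * sqrt (real n)) * exp (- x) = E"
          by (simp add: E_def x_def left_diff_distrib flip: exp_add)
        finally show "\<bar>e * real n * exp (- x)\<bar> \<le> K * real n * E" .
      qed
      also have "\<dots> \<le> (\<kappa> / 2 * real n) * E + K * real n * E"
        using kap elim by (intro add_mono) (auto simp: E_def)
      also have "\<dots> = E * ((\<kappa> / 2 + K) * real n)" by (simp add: algebra_simps)
      finally have "\<bar>real (overp n) * real n * exp (- x) - \<kappa> * (1 / 4 * (1 - 1 / x))\<bar> \<le> E * ((\<kappa> / 2 + K) * real n)" .
      moreover have "norm (complex_of_real E * of_real ((\<kappa> / 2 + K) * real n)) = E * ((\<kappa> / 2 + K) * real n)"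
        unfolding of_real_mult[symmetric] norm_of_real using kap K by (simp add: E_def)
      ultimately show ?case
        unfolding gz x_def[symmetric] E_def[symmetric] of_real_diff[symmetric] norm_of_real by simp
    qed
  qed
  then have "asy g (\<lambda>n. of_real (real (overp n) * real n * exp (- (pi * sqrt (real n)))))"
    using ga by (simp add: asy_def)
  moreover have "g 0 = of_real (\<kappa> / 4)" by (simp add: g_def)
  moreover have "\<kappa> / 4 > 0" using kap by simp
  ultimately show ?thesis using ga that by blast
qed

section \<open>Curvature of exp(pi sqrt n) and of the overpartition numbers\<close>

text \<open>At z = 1/sqrt n, s and s' are sqrt((n+1)/n) and sqrt((n+2)/n): this is the rationalised
  second difference of the square root, divided by n^(-3/2). Its value at 0 is -1/4.\<close>

definition sqrt_curv :: "complex \<Rightarrow> complex" where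
  "sqrt_curv z = (let s = 1 / tau z; s' = 1 / (tau z * tau (next_arg z))
     in - 2 / ((1 + s) * (s + s') * (1 + s')))"

lemma sqrt_curv_analytic: "sqrt_curv analytic_on {0}"
  unfolding sqrt_curv_def[abs_def] Let_def
  by (intro analytic_intros tau_analytic analytic_next_arg) auto

text \<open>For roots p, q, r of consecutive integers, (p - q) + (r - q) = -1/(p+q) + 1/(q+r) = (p -
  r)/((p+q)(q+r)), and p - r = -2/(p+r).\<close>

lemma sqrt_second_difference:
  assumes "n > 0"
  shows "of_real (sqrt (real n) + sqrt (real (Suc (Suc n))) - 2 * sqrt (real (Suc n))) =
           inv_sqrt n ^ 3 * sqrt_curv (inv_sqrt n)"
proof -
  define p q r where "p = sqrt (real n)" and "q = sqrt (real (Suc n))" and "r = sqrt (real (Suc (Suc n)))"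
  have pos: "p > 0" "q > 0" "r > 0" using assms by (auto simp: p_def q_def r_def)
  have sq: "q * q = p * p + 1" "r * r = p * p + 2" using assms by (auto simp: p_def q_def r_def)
  have iv: "inv_sqrt n = of_real (1 / p)" "inv_sqrt (Suc n) = of_real (1 / q)" "inv_sqrt (Suc (Suc n)) = of_real (1 / r)"
    by (simp_all add: inv_sqrt_def p_def q_def r_def)
  have t1: "tau (inv_sqrt n) = of_real (p / q)"
  proof -
    define T where "T = tau (inv_sqrt n)"
    have "inv_sqrt (Suc n) = inv_sqrt n * T"
      using inv_sqrt_Suc[OF assms] by (simp add: next_arg_def T_def)
    then have "T = of_real (p / q)" unfolding iv using pos by (simp add: field_simps)
    then show ?thesis by (simp only: T_def)
  qed
  have t2: "tau (next_arg (inv_sqrt n)) = of_real (q / r)"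
  proof -
    define T where "T = tau (inv_sqrt (Suc n))"
    have "inv_sqrt (Suc (Suc n)) = inv_sqrt (Suc n) * T"
      using inv_sqrt_Suc[of "Suc n"] by (simp add: next_arg_def T_def)
    then have "T = of_real (q / r)" unfolding iv using pos by (simp add: field_simps)
    then show ?thesis by (simp only: T_def inv_sqrt_Suc[OF assms])
  qed
  have s: "1 / tau (inv_sqrt n) = of_real (q / p)" "1 / (tau (inv_sqrt n) * tau (next_arg (inv_sqrt n))) = of_real (r / p)"
    using pos by (simp_all add: t1 t2)
  have "inv_sqrt n ^ 3 * sqrt_curv (inv_sqrt n) = of_real ((1 / p) ^ 3 * (- 2 / ((1 + q / p) * (q / p + r / p) * (1 + r / p))))"
    unfolding sqrt_curv_def Let_def s unfolding iv by simp
  also have "(1 / p) ^ 3 * (- 2 / ((1 + q / p) * (q / p + r / p) * (1 + r / p))) = - 2 / ((p + q) * (q + r) * (p + r))"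
  proof -
    have "1 + q / p = (p + q) / p" "q / p + r / p = (q + r) / p" "1 + r / p = (p + r) / p"
      using pos by (auto simp: field_simps)
    then show ?thesis using pos by (simp add: power3_eq_cube)
  qed
  also have "\<dots> = p + r - 2 * q"
  proof -
    have h1: "(p - q) * (p + q) = - 1" using sq(1) by (simp add: algebra_simps)
    have h2: "(r - q) * (q + r) = 1" using sq by (simp add: algebra_simps)
    have h3: "(p - r) * (p + r) = - 2" using sq(2) by (simp add: right_diff_distrib left_diff_distrib distrib_left)
    have "(p + r - 2 * q) * ((p + q) * (q + r) * (p + r)) =
        ((p - q) * (p + q) * (q + r) + (r - q) * (q + r) * (p + q)) * (p + r)"
      by (simp add: algebra_simps)
    also have "\<dots> = (p - r) * (p + r)" unfolding h1 h2 by simp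
    also have "\<dots> = - 2" by (rule h3)
    finally show ?thesis using pos by (subst divide_eq_eq) auto
  qed
  finally show ?thesis by (simp add: p_def q_def r_def)
qed

text \<open>Composes the entire function (exp s - 1)/s, equal to 1 at 0, with s = z^3 k(z).\<close>

lemma exp_cube_tendsto:
  assumes k: "k analytic_on {0}"
  shows "((\<lambda>z. (exp (z ^ 3 * k z) - 1) / z ^ 3) \<longlongrightarrow> k 0) (at (0::complex))"
proof -
  define X where "X = (\<lambda>s::complex. if s = 0 then 1 else (exp s - 1) / s ^ 1)"
  have "((\<lambda>s. (exp s - 1) / s ^ 1) \<longlongrightarrow> (1::complex)) (at 0)"
    using DERIV_exp[of "0 :: complex"] by (simp add: DERIV_def)
  then have Xa: "X analytic_on {0}"
    unfolding X_def by (intro removable_power) (auto intro!: analytic_intros)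
  have Xs: "exp s - 1 = X s * s" for s by (simp add: X_def)
  have ha: "(\<lambda>z. z ^ 3 * k z) analytic_on {0}" by (intro analytic_intros k)
  have "(\<lambda>z. X (z ^ 3 * k z)) analytic_on {0}"
    using analytic_on_compose[OF ha, of X] Xa by (simp add: o_def)
  then have "((\<lambda>z. X (z ^ 3 * k z) * k z) \<longlongrightarrow> X (0 ^ 3 * k 0) * k 0) (at 0)"
    by (intro tendsto_mult analytic_tendsto_at[of "\<lambda>z. X (z ^ 3 * k z)"] analytic_tendsto_at k)
  then have "((\<lambda>z. X (z ^ 3 * k z) * k z) \<longlongrightarrow> k 0) (at 0)" by (simp add: X_def)
  moreover have "\<forall>\<^sub>F z in at 0. X (z ^ 3 * k z) * k z = (exp (z ^ 3 * k z) - 1) / z ^ 3"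
    using ev_nz_0 by eventually_elim (simp add: Xs)
  ultimately show ?thesis by (rule Lim_transform_eventually)
qed

text \<open>Write a(n) = \<open>\<beta> n\<close> z^2 exp(pi sqrt n) with z = n^(-1/2). In a(n)
  a(n+2) / a(n+1)^2 the first factor gives \<open>ratio2 g\<close> and the second
  \<open>rho z ^ 2\<close>, both flat; the exponential gives exp(pi z^3 \<open>sqrt_curv z\<close>).
  As \<open>sqrt_curv 0\<close> = -1/4, the curvature has leading coefficient pi/4.\<close>

lemma regular_seq_overp: "regular_seq (\<lambda>n. real (overp n))"
proof -
  define a where "a = (\<lambda>n. real (overp n))"
  obtain g \<kappa> where g: "g analytic_on {0}" "g 0 = of_real \<kappa>" "\<kappa> > 0"
    and asyg: "asy g (\<lambda>n. of_real (a n * real n * exp (- (pi * sqrt (real n)))))"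
    unfolding a_def by (rule overp_normalised_asy)
  define \<beta> where "\<beta> = (\<lambda>n. a n * real n * exp (- (pi * sqrt (real n))))"
  have g0: "g 0 \<noteq> 0" using g by simp
  have asyb: "asy g (\<lambda>n. of_real (\<beta> n))" using asyg by (simp add: \<beta>_def)
  have "(\<lambda>n. Re (of_real (\<beta> n))) \<longlonglongrightarrow> Re (g 0)" by (intro tendsto_Re asy_tendsto asyb)
  then have "\<beta> \<longlonglongrightarrow> \<kappa>" using g by simp
  then have bpos: "\<forall>\<^sub>F n in sequentially. \<beta> n > 0" using g by (intro order_tendstoD) auto
  have apos: "\<forall>\<^sub>F n in sequentially. a n > 0"
    using bpos
  proof eventually_elim
    case (elim n)
    then have "a n \<noteq> 0" by (auto simp: \<beta>_def)
    then show ?case by (simp add: a_def)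
  qed
  have ev1: "\<forall>\<^sub>F n in sequentially. P (Suc n)" if "\<forall>\<^sub>F n in sequentially. P n" for P
    using that eventually_sequentially_Suc[of P] by simp
  define k where "k = (\<lambda>z. of_real pi * sqrt_curv z)"
  have ka: "k analytic_on {0}" unfolding k_def by (intro analytic_intros sqrt_curv_analytic)
  have k0: "k 0 = - of_real (pi / 4)" by (simp add: k_def sqrt_curv_def)
  define F where "F = (\<lambda>z. ratio2 g z * rho z ^ 2)"
  have F: "flat F" unfolding F_def by (intro flat_mult flat_power flat_rho flat_ratio2 g g0)
  define R where "R = (\<lambda>z. F z * exp (z ^ 3 * k z))"
  have asyR: "asy R (\<lambda>n. of_real (a n * a (Suc (Suc n)) / (a (Suc n))\<^sup>2))"
  proof (rule asy_cong)
    show "asy R (\<lambda>n. of_real (\<beta> n) * of_real (\<beta> (Suc (Suc n))) / (of_real (\<beta> (Suc n)))\<^sup>2 * rho (inv_sqrt n) ^ 2 *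
        exp (inv_sqrt n ^ 3 * k (inv_sqrt n)))"
      unfolding R_def F_def
      by (intro asy_mult asy_power asy_ratio2 asyb g0) (auto intro!: asy_exact rho_analytic analytic_intros ka)
    show "\<forall>\<^sub>F n in sequentially. of_real (\<beta> n) * of_real (\<beta> (Suc (Suc n))) / (of_real (\<beta> (Suc n)))\<^sup>2 * rho (inv_sqrt n) ^ 2 *
        exp (inv_sqrt n ^ 3 * k (inv_sqrt n)) = complex_of_real (a n * a (Suc (Suc n)) / (a (Suc n))\<^sup>2)"
      using eventually_gt_at_top[of 0] ev1[OF apos]
    proof eventually_elim
      case (elim n)
      define p q r where "p = sqrt (real n)" and "q = sqrt (real (Suc n))" and "r = sqrt (real (Suc (Suc n)))"
      have pos: "p > 0" "q > 0" "r > 0" using elim by (auto simp: p_def q_def r_def)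
      have sq: "real n = p\<^sup>2" "real (Suc n) = q\<^sup>2" "real (Suc (Suc n)) = r\<^sup>2"
        by (auto simp: p_def q_def r_def)
      have rho: "rho (inv_sqrt n) = of_real (q\<^sup>2 / (p * r))"
      proof -
        have iv: "inv_sqrt n = of_real (1 / p)" "inv_sqrt (Suc n) = of_real (1 / q)" "inv_sqrt (Suc (Suc n)) = of_real (1 / r)"
          by (simp_all add: inv_sqrt_def p_def q_def r_def)
        show ?thesis
          unfolding rho_inv_sqrt[OF elim(1), symmetric] unfolding iv using pos
          by (simp add: field_simps)
      qed
      have ex: "exp (inv_sqrt n ^ 3 * k (inv_sqrt n)) = of_real (exp (pi * (p + r - 2 * q)))"
      proof -
        have "inv_sqrt n ^ 3 * k (inv_sqrt n) = of_real pi * (inv_sqrt n ^ 3 * sqrt_curv (inv_sqrt n))"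
          by (simp add: k_def)
        also have "\<dots> = of_real (pi * (p + r - 2 * q))"
          unfolding sqrt_second_difference[OF elim(1), symmetric] p_def q_def r_def by (simp only: of_real_mult)
        finally show ?thesis by (simp only: exp_of_real)
      qed
      have b: "\<beta> n = a n * p\<^sup>2 * exp (- (pi * p))" "\<beta> (Suc n) = a (Suc n) * q\<^sup>2 * exp (- (pi * q))"
        "\<beta> (Suc (Suc n)) = a (Suc (Suc n)) * r\<^sup>2 * exp (- (pi * r))"
        unfolding \<beta>_def sq by (simp_all add: p_def q_def r_def)
      have "\<beta> n * \<beta> (Suc (Suc n)) / (\<beta> (Suc n))\<^sup>2 * (q\<^sup>2 / (p * r))\<^sup>2 * exp (pi * (p + r - 2 * q)) =
          a n * a (Suc (Suc n)) / (a (Suc n))\<^sup>2"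
      proof -
        define P Q S where "P = exp (pi * p)" and "Q = exp (pi * q)" and "S = exp (pi * r)"
        have nz: "P \<noteq> 0" "Q \<noteq> 0" "S \<noteq> 0" by (auto simp: P_def Q_def S_def)
        have ee: "exp (pi * (p + r - 2 * q)) = P * S / Q\<^sup>2"
        proof -
          have "pi * (p + r - 2 * q) = pi * p + pi * r - (pi * q + pi * q)" by (simp add: algebra_simps)
          then show ?thesis by (simp only: exp_diff exp_add P_def Q_def S_def power2_eq_square)
        qed
        have en: "exp (- (pi * p)) = 1 / P" "exp (- (pi * q)) = 1 / Q" "exp (- (pi * r)) = 1 / S"
          by (simp_all add: P_def Q_def S_def exp_minus divide_inverse)
        show ?thesis
          unfolding b ee en using nz pos elim(2) by (simp add: field_simps power2_eq_square)
      qed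
      then show ?case
        unfolding rho ex by (simp only: of_real_mult[symmetric] of_real_divide[symmetric] of_real_power[symmetric])
    qed
  qed
  have asyC: "asy (\<lambda>z. 1 - R z) (\<lambda>n. of_real (curvature a n))"
    using asy_diff[OF asy_const[of 1] asyR] by (simp add: curvature_def)
  have Ea: "(\<lambda>z. exp (z ^ 3 * k z)) analytic_on {0}" by (intro analytic_intros ka)
  have "((\<lambda>z. - ((F z - 1) / z ^ 3 * exp (z ^ 3 * k z)) - (exp (z ^ 3 * k z) - 1) / z ^ 3) \<longlongrightarrow> - (0 * exp (0 ^ 3 * k 0)) - k 0) (at 0)"
    using F by (intro tendsto_diff tendsto_minus tendsto_mult exp_cube_tendsto ka analytic_tendsto_at[OF Ea]) (simp add: flat_def)
  then have "((\<lambda>z. - ((F z - 1) / z ^ 3 * exp (z ^ 3 * k z)) - (exp (z ^ 3 * k z) - 1) / z ^ 3) \<longlongrightarrow> of_real (pi / 4)) (at 0)"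
    by (simp add: k0)
  moreover have "\<forall>\<^sub>F z in at 0. - ((F z - 1) / z ^ 3 * exp (z ^ 3 * k z)) - (exp (z ^ 3 * k z) - 1) / z ^ 3 = (1 - R z) / z ^ 3"
    using ev_nz_0 by eventually_elim (simp add: R_def field_simps)
  ultimately have "((\<lambda>z. (1 - R z) / z ^ 3) \<longlongrightarrow> of_real (pi / 4)) (at 0)" by (rule Lim_transform_eventually)
  from asy_divide_cube[OF asyC this] apos show ?thesis
    unfolding regular_seq_def a_def[symmetric]
    by (intro conjI exI[of _ "\<lambda>z. if z = 0 then of_real (pi / 4) else (1 - R z) / z ^ 3"] exI[of _ "pi / 4"]) auto
qed

theorem theorem1p2:
  fixes r :: nat
  assumes "r \<ge> 1"
  shows "\<exists>N \<ge> 1. \<forall>k \<in> {1..r}. \<forall>n. (logc_op ^^ k) (\<lambda>i. real (overp (N + i))) n \<ge> 0"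
  using regular_seq_eventually_log_concave[OF regular_seq_overp] .

end
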